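(* Let $p\neq 2$ be a prime. For every integer $n>0$ with $n\equiv 0,3 \pmod 4$, $$ 12\sum_{Q \in \mathcal{Q}_{p,-4n}/\Gamma_0(p)} \frac{2}{|\Gamma_0(p)_Q|} - 24\sum_{Q \in \mathcal{Q}_{p,-n}/\Gamma_0(p)} \frac{2}{|\Gamma_0(p)_Q|} = 4r_3(n)-2\big(r_3(p^2 n) - p\, r_3(n)\big). $$
   Context: For a positive integer $N$ and an integer $n$, let $\mathcal{Q}_{N,n}$ be the set of integral binary quadratic forms $ax^2+bxy+cy^2$ ($a,b,c\in\mathbb{Z}$) with $N\mid a$ and $b^2-4ac=n$ (both positive definite and negative definite forms are included when $n<0$). The group $\Gamma_0(N)=\{\begin{pmatrix}a&b\\c&d\end{pmatrix}\in\mathrm{SL}_2(\mathbb{Z}) : c\equiv 0 \pmod N\}$ acts on $\mathcal{Q}_{N,n}$ by linear substitution of variables; the sums run over the (finitely many) orbits, and $\Gamma_0(N)_Q$ denotes the stabilizer of $Q$ in $\Gamma_0(N)$ (a subgroup of $\mathrm{SL}_2(\mathbb{Z})$, so it contains $\pm I$). $r_3(n)$ is the number of $(x,y,z)\in\mathbb{Z}^3$ with $x^2+y^2+z^2=n$. *)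

theory Defs
  imports Complex_Main "HOL-Computational_Algebra.Primes"
begin

text \<open>A binary quadratic form a x^2 + b x y + c y^2 is the triple (a,b,c).
A 2x2 integer matrix (a b; c d) is the quadruple (a,b,c,d).\<close>

type_synonym qform = "int \<times> int \<times> int"
type_synonym mat2 = "int \<times> int \<times> int \<times> int"

definition Gamma0 :: "int \<Rightarrow> mat2 set" where
  "Gamma0 N = {(a,b,c,d). a*d - b*c = 1 \<and> N dvd c}"

definition QF :: "int \<Rightarrow> int \<Rightarrow> qform set" where
  "QF N n = {(A,B,C). N dvd A \<and> B^2 - 4*A*C = n}"

text \<open>Linear substitution: (Q . g)(x,y) = Q(a x + b y, c x + d y).\<close>
definition act :: "qform \<Rightarrow> mat2 \<Rightarrow> qform" where
  "act Q g = (case Q of (A,B,C) \<Rightarrow> case g of (a,b,c,d) \<Rightarrow>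
     (A*a^2 + B*a*c + C*c^2,
      2*A*a*b + B*(a*d + b*c) + 2*C*c*d,
      A*b^2 + B*b*d + C*d^2))"

definition orbit :: "int \<Rightarrow> qform \<Rightarrow> qform set" where
  "orbit N Q = (\<lambda>g. act Q g) ` Gamma0 N"

definition stab :: "int \<Rightarrow> qform \<Rightarrow> mat2 set" where
  "stab N Q = {g \<in> Gamma0 N. act Q g = Q}"

definition orbits :: "int \<Rightarrow> int \<Rightarrow> qform set set" where
  "orbits N n = orbit N ` QF N n"

text \<open>Sum over orbits of 2/|Gamma0(N)_Q|, Q a representative of the orbit
(the value does not depend on the representative).\<close>
definition orbsum :: "int \<Rightarrow> int \<Rightarrow> real" where
  "orbsum N n = (\<Sum>Ob\<in>orbits N n. 2 / real (card (stab N (SOME Q. Q \<in> Ob))))"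

definition r3 :: "int \<Rightarrow> nat" where
  "r3 n = card {(x::int,y::int,z::int). x^2 + y^2 + z^2 = n}"

end

theory Submission
  imports Defs
begin

text \<open>Write a positive definite form as \<open>A x^2 + B y^2 + C (x - y)^2\<close> (Selling). Its root in the upper half plane lies in
the ideal triangle with vertices 0, 1, infinity iff \<open>A, B, C \<ge> 0\<close>, and every \<open>SL_2(Z)\<close>-class meets this triangle with the
same total weight, so sums of \<open>2 / |stab|\<close> over classes become sums over triples \<open>(A, B, C)\<close>.

Let \<open>H(D)\<close> be the weighted class number of discriminant \<open>-D\<close> and \<open>H_p(D)\<close> its analogue for \<open>\<Gamma>_0(p)\<close>. Counting pairs (form,
sublattice of index \<open>p\<close>) in two ways gives \<open>H_p(D) = (p + 2) H(D) - H(p^2 D)\<close>, which reduces the theorem to Gauss's formula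
\<open>r_3(n) = 12 (H(4n) - 2 H(n))\<close>.

Gauss's formula follows by induction on \<open>n\<close> once both sides, evaluated at \<open>n - s^2\<close> and summed over \<open>s\<close>, are known to agree.
For \<open>r_3\<close> the sum is \<open>r_4(n)\<close>, given by Jacobi's theorem; the latter follows from the recursion
\<open>\<Sum>\<^sub>s (n - 5 s^2) r_4(n - s^2) = 0\<close> (symmetry of five squares) and a Liouville identity for the divisor side. For the class numbers
it is a Kronecker relation: solutions of \<open>s^2 + AB + BC + CA = n\<close> are integer matrices of determinant \<open>n\<close> and trace \<open>2s\<close>, and the
condition that the fixed point lies in the triangle is a combination of conditions on how the matrix moves the edges of the
triangle. Those cancel when the off-diagonal entries are negated, up to degenerate matrices that contribute divisor sums.\<close>

section \<open>A Kronecker class number relation\<close>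

text \<open>A fundamental domain would require choices on its boundary. A multiplicity replaces it:
  2 inside the triangle and 1 on its edges. The total along each class is then always 12, from three
  rotations of the triangle, the signs +-g and the multiplicity 2. The matrix count meets the same
  boundary, which is why its conditions are half-open and leave degenerate matrices on both sides.
  In both inductions the unknown is the term \<open>s = 0\<close>; every other term has a smaller
  argument. At \<open>s^2 = n\<close> the values r_3(0) = r_4(0) = 1 have no counterpart among
  divisor sums or class numbers, and this produces the corrections at square n. At level p the two
  counts concern forms of discriminants -D and -p^2 D. The Fricke substitution matches their orbits
  but not their position relative to the triangle, so the comparison has to pass through orbit sums.
  That p is odd enters where 2 is cancelled modulo p.\<close>

text \<open>\<open>(A, B, C, s)\<close> encodes the matrix with rows \<open>(s + C, -(B + C))\<close> and \<open>(A + C, s - C)\<close>. The first two terms on the left say that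
its fixed point lies in the triangle. The other terms record crossings between edges and images of edges; those involving an
equation belong to matrices mapping a cusp of the triangle to a cusp. The assumptions hold when the determinant is positive.\<close>

lemma selling_chamber_identity:
  fixes A B C s :: int
  assumes "s > 0"
    and "B + C = 0 \<Longrightarrow> -s < B \<and> B < s" and "A + C = 0 \<Longrightarrow> -s < A \<and> A < s" and "A + B = 0 \<Longrightarrow> -s < A \<and> A < s"
    and "A = s \<Longrightarrow> (s+B>0 \<and> s+C>0) \<or> (s+B<0 \<and> s+C<0)"
    and "B = -s \<Longrightarrow> (B+C>0 \<and> A+B>0) \<or> (B+C<0 \<and> A+B<0)"
    and "C = -s \<Longrightarrow> (B+C>0 \<and> A+C>0) \<or> (B+C<0 \<and> A+C<0)"
  shows "of_bool (A>0 \<and> B\<ge>0 \<and> C\<ge>0 \<and> B+C>0) + of_bool (A\<le>0 \<and> B<0 \<and> C<0)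
     + of_bool (s+B>0 \<and> s+C>0 \<and> B+C<0 \<and> A<s)
     + of_bool (0<A \<and> A<s \<and> A+C<0 \<and> A+B<0)
     + of_bool (-s<B \<and> B<0 \<and> B+C>0 \<and> A+B>0)
     + of_bool (-s<C \<and> C<0 \<and> B+C>0 \<and> A+C>0)
     + of_bool (B+C=0 \<and> \<bar>B\<bar><A \<and> A<s)
     = of_bool (s+B>0 \<and> s+C>0 \<and> B+C>0 \<and> A>s)
     + of_bool (s+B<0 \<and> s+C<0 \<and> A<s)
     + of_bool (0<A \<and> A<s \<and> A+C>0 \<and> A+B>0)
     + of_bool (-s<B \<and> B<0 \<and> B+C<0 \<and> A+B<0)
     + of_bool (-s<C \<and> C<0 \<and> B+C<0 \<and> A+C<0)
     + of_bool (A=s \<and> B+C>0 \<and> s+B>0 \<and> s+C>0)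
     + of_bool (B=-s \<and> A<s \<and> C\<le>-s) + of_bool (C=-s \<and> A<s \<and> B < -s)
     + of_bool (C=-A \<and> 0<A \<and> A<s \<and> -A\<le>B \<and> B<A)
     + (of_bool (B=-A \<and> 0<A \<and> A<s \<and> -A<C \<and> C<A) :: int)"
  using assms unfolding of_bool_def by (smt (verit))

text \<open>The sign is \<open>-1\<close> iff both outer coefficients \<open>A + C\<close> and \<open>B + C\<close> are even; it turns the count of forms of discriminant \<open>-4n\<close>
into \<open>H(4n) - 2 H(n)\<close>.\<close>

definition selling_sign :: "int \<Rightarrow> int \<Rightarrow> int \<Rightarrow> int" where
  "selling_sign A B C = (if even (A - B) \<and> even (B - C) then -1 else 1)"

definition signed_count :: "int \<Rightarrow> (int \<Rightarrow> int \<Rightarrow> int \<Rightarrow> int \<Rightarrow> bool) \<Rightarrow> int" where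
  "signed_count n P = (\<Sum>(A,B,C,s) \<in> {(A,B,C,s). s^2 + A*B + B*C + C*A = n \<and> P A B C s}. selling_sign A B C)"

text \<open>One finite set containing the solutions of every condition in the balance, so that a
  pointwise identity can be summed over it. The bound \<open>4*n\<close> is generous.\<close>

definition quad_box :: "int \<Rightarrow> (int \<times> int \<times> int \<times> int) set" where
  "quad_box n = {(A,B,C,s). s^2 + A*B + B*C + C*A = n \<and> \<bar>A\<bar> \<le> 4*n \<and> \<bar>B\<bar> \<le> 4*n \<and> \<bar>C\<bar> \<le> 4*n \<and> 0 < s \<and> s \<le> 4*n}"

lemma finite_quad_box: "finite (quad_box n)"
  by (rule finite_subset[of _ "{-4*n..4*n} \<times> {-4*n..4*n} \<times> {-4*n..4*n} \<times> {-4*n..4*n}"])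
    (auto simp: quad_box_def)

lemma signed_count_quad_box:
  assumes "\<And>A B C s. s^2 + A*B + B*C + C*A = n \<Longrightarrow> P A B C s \<Longrightarrow>
     \<bar>A\<bar> \<le> 4*n \<and> \<bar>B\<bar> \<le> 4*n \<and> \<bar>C\<bar> \<le> 4*n \<and> 0 < s \<and> s \<le> 4*n"
  shows "signed_count n P = (\<Sum>(A,B,C,s) \<in> quad_box n. selling_sign A B C * of_bool (P A B C s))"
  unfolding signed_count_def
  by (rule sum.mono_neutral_cong_left) (use assms finite_quad_box in \<open>auto simp: quad_box_def\<close>)

lemma abs_le_square_int: "\<bar>s :: int\<bar> \<le> s^2"
proof (cases "s = 0")
  case False
  then have "\<bar>s\<bar> * 1 \<le> \<bar>s\<bar> * \<bar>s\<bar>" by (intro mult_left_mono) auto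
  then show ?thesis by (simp add: power2_eq_square)
qed simp

lemma pos_mult_bound:
  fixes x y z n :: int
  assumes "x > 0" "y > 0" "z \<ge> 0" "x * y + z = n"
  shows "x \<le> n" "y \<le> n"
proof -
  have "x * 1 \<le> x * y" "1 * y \<le> x * y" using assms by (intro mult_left_mono mult_right_mono; simp)+
  then show "x \<le> n" "y \<le> n" using assms(3,4) by linarith+
qed

lemma pos_mult_bound2:
  fixes x y z t n :: int
  assumes "x > 0" "y > 0" "z > 0" "t > 0" "x * y + z * t = n"
  shows "x \<le> n \<and> y \<le> n \<and> z \<le> n \<and> t \<le> n"
  using pos_mult_bound[of x y "z*t" n] pos_mult_bound[of z t "x*y" n] assms by auto

section \<open>Sign-change involutions on the solutions\<close>

text \<open>Since \<open>(s-A)*(s+A) + (A+B)*(A+C) = n\<close>, the substitution that fixes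
  \<open>A\<close> and \<open>s\<close> and negates \<open>A+B\<close> and \<open>A+C\<close>
  preserves the equation. These are the off-diagonal entries in a basis attached to one edge of the
  triangle, up to sign. Parities do not change, so the sign survives. The next two lemmas treat the
  other two edges.\<close>

lemma signed_count_negate_BC:
  "signed_count n (\<lambda>A B C s. 0<A \<and> A<s \<and> A+C<0 \<and> A+B<0) = signed_count n (\<lambda>A B C s. 0<A \<and> A<s \<and> A+C>0 \<and> A+B>0)"
  unfolding signed_count_def
  by (rule sum.reindex_bij_witness[where i="\<lambda>(A,B,C,s). (A,-2*A-B,-2*A-C,s)" and j="\<lambda>(A,B,C,s). (A,-2*A-B,-2*A-C,s)"])
     (auto simp: algebra_simps power2_eq_square selling_sign_def)

lemma signed_count_negate_AC:
  "signed_count n (\<lambda>A B C s. 0<s \<and> -s<B \<and> B<0 \<and> B+C>0 \<and> A+B>0) = signed_count n (\<lambda>A B C s. 0<s \<and> -s<B \<and> B<0 \<and> B+C<0 \<and> A+B<0)"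
  unfolding signed_count_def
  by (rule sum.reindex_bij_witness[where i="\<lambda>(A,B,C,s). (-2*B-A,B,-2*B-C,s)" and j="\<lambda>(A,B,C,s). (-2*B-A,B,-2*B-C,s)"])
     (auto simp: algebra_simps power2_eq_square selling_sign_def)

lemma signed_count_negate_AB:
  "signed_count n (\<lambda>A B C s. 0<s \<and> -s<C \<and> C<0 \<and> B+C>0 \<and> A+C>0) = signed_count n (\<lambda>A B C s. 0<s \<and> -s<C \<and> C<0 \<and> B+C<0 \<and> A+C<0)"
  unfolding signed_count_def
  by (rule sum.reindex_bij_witness[where i="\<lambda>(A,B,C,s). (-2*C-A,-2*C-B,C,s)" and j="\<lambda>(A,B,C,s). (-2*C-A,-2*C-B,C,s)"])
     (auto simp: algebra_simps power2_eq_square selling_sign_def)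

text \<open>The entries \<open>B + C\<close> and \<open>A - s\<close> of the matrix with rows \<open>(s + C, -(B + C))\<close> and \<open>(A - s, s + B)\<close> change sign.\<close>

lemma signed_count_negate_offdiag:
  "signed_count n (\<lambda>A B C s. 0<s \<and> s+B>0 \<and> s+C>0 \<and> B+C<0 \<and> A<s) = signed_count n (\<lambda>A B C s. s+B>0 \<and> s+C>0 \<and> B+C>0 \<and> A>s)"
  unfolding signed_count_def
  by (rule sum.reindex_bij_witness[where i="\<lambda>(A,B,C,s). (2*s+B+C-A,-C,-B,s+B+C)" and j="\<lambda>(A,B,C,s). (2*s+B+C-A,-C,-B,s+B+C)"])
     (auto simp: algebra_simps power2_eq_square selling_sign_def)

text \<open>Passing to the negative of the matrix trades conditions with \<open>s < 0\<close> for
  conditions with \<open>s > 0\<close>.\<close>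

lemma signed_count_uminus:
  "signed_count n P = signed_count n (\<lambda>A B C s. P (-A) (-B) (-C) (-s))"
  unfolding signed_count_def
  by (rule sum.reindex_bij_witness[where i="\<lambda>(A,B,C,s). (-A,-B,-C,-s)" and j="\<lambda>(A,B,C,s). (-A,-B,-C,-s)"])
     (auto simp: algebra_simps power2_eq_square selling_sign_def)

text \<open>A sum over an infinite set is 0, so additivity depends on finite supports, whereas
  reindexing does not.\<close>

lemma signed_count_disj:
  assumes "finite {(A,B,C,s). s^2 + A*B + B*C + C*A = n \<and> P A B C s}"
     "finite {(A,B,C,s). s^2 + A*B + B*C + C*A = n \<and> Q A B C s}"
     "\<And>A B C s. s^2 + A*B + B*C + C*A = n \<Longrightarrow> \<not> (P A B C s \<and> Q A B C s)"
  shows "signed_count n (\<lambda>A B C s. P A B C s \<or> Q A B C s) = signed_count n P + signed_count n Q"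
proof -
  have *: "{(A,B,C,s). s^2 + A*B + B*C + C*A = n \<and> (P A B C s \<or> Q A B C s)} =
     {(A,B,C,s). s^2 + A*B + B*C + C*A = n \<and> P A B C s} \<union> {(A,B,C,s). s^2 + A*B + B*C + C*A = n \<and> Q A B C s}"
    by auto
  show ?thesis unfolding signed_count_def *
    by (rule sum.union_disjoint) (use assms in auto)
qed

lemma signed_count_cong:
  "(\<And>A B C s. s^2 + A*B + B*C + C*A = n \<Longrightarrow> P A B C s \<longleftrightarrow> Q A B C s) \<Longrightarrow> signed_count n P = signed_count n Q"
  unfolding signed_count_def by (intro sum.cong) auto

text \<open>Points on an edge belong to two triangles, hence have half the weight of interior points.\<close>

definition selling_mult :: "int \<Rightarrow> int \<Rightarrow> int \<Rightarrow> int" where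
  "selling_mult A B C = of_bool (A\<ge>0 \<and> B\<ge>0 \<and> C\<ge>0) + of_bool (A>0 \<and> B>0 \<and> C>0)"

definition divpairs :: "int \<Rightarrow> (int \<times> int) set" where
  "divpairs n = {(a,d). a > 0 \<and> d > 0 \<and> a * d = n}"

text \<open>The value of \<open>selling_sign\<close> on degenerate solutions, where the equation
  collapses to \<open>a * d = n\<close>.\<close>

definition even_sign :: "int \<Rightarrow> int \<Rightarrow> int" where
  "even_sign a d = (if even a \<and> even d then -1 else 1)"

text \<open>The chamber identity, weighted by \<open>selling_sign\<close> and summed over
  \<open>quad_box n\<close>. Each of the 17 conditions has to be shown to confine its solutions to
  the box.\<close>

lemma signed_count_boundary:
  assumes n: "n > 0"
  shows "signed_count n (\<lambda>A B C s. 0 < s \<and> A>0 \<and> B\<ge>0 \<and> C\<ge>0 \<and> B+C>0) + signed_count n (\<lambda>A B C s. 0 < s \<and> A\<le>0 \<and> B<0 \<and> C<0)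
     + signed_count n (\<lambda>A B C s. 0<s \<and> s+B>0 \<and> s+C>0 \<and> B+C<0 \<and> A<s)
     + signed_count n (\<lambda>A B C s. 0<A \<and> A<s \<and> A+C<0 \<and> A+B<0)
     + signed_count n (\<lambda>A B C s. 0<s \<and> -s<B \<and> B<0 \<and> B+C>0 \<and> A+B>0)
     + signed_count n (\<lambda>A B C s. 0<s \<and> -s<C \<and> C<0 \<and> B+C>0 \<and> A+C>0)
     + signed_count n (\<lambda>A B C s. B+C=0 \<and> \<bar>B\<bar><A \<and> A<s)
     = signed_count n (\<lambda>A B C s. 0<s \<and> s+B>0 \<and> s+C>0 \<and> B+C>0 \<and> A>s)
     + signed_count n (\<lambda>A B C s. 0<s \<and> s+B<0 \<and> s+C<0 \<and> A<s)
     + signed_count n (\<lambda>A B C s. 0<A \<and> A<s \<and> A+C>0 \<and> A+B>0)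
     + signed_count n (\<lambda>A B C s. 0<s \<and> -s<B \<and> B<0 \<and> B+C<0 \<and> A+B<0)
     + signed_count n (\<lambda>A B C s. 0<s \<and> -s<C \<and> C<0 \<and> B+C<0 \<and> A+C<0)
     + signed_count n (\<lambda>A B C s. 0<s \<and> A=s \<and> B+C>0 \<and> s+B>0 \<and> s+C>0)
     + signed_count n (\<lambda>A B C s. 0<s \<and> B=-s \<and> A<s \<and> C\<le>-s) + signed_count n (\<lambda>A B C s. 0<s \<and> C=-s \<and> A<s \<and> B < -s)
     + signed_count n (\<lambda>A B C s. C=-A \<and> 0<A \<and> A<s \<and> -A\<le>B \<and> B<A)
     + signed_count n (\<lambda>A B C s. B=-A \<and> 0<A \<and> A<s \<and> -A<C \<and> C<A)"
  (is "signed_count n ?L1 + signed_count n ?L2 + signed_count n ?L3 + signed_count n ?L4 + signed_count n ?L5 + signed_count n ?L6 + signed_count n ?L7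
   = signed_count n ?R1 + signed_count n ?R2 + signed_count n ?R3 + signed_count n ?R4 + signed_count n ?R5 + signed_count n ?R6 + signed_count n ?R7 + signed_count n ?R8 + signed_count n ?R9 + signed_count n ?R0")
proof -
  have box: "\<bar>A\<bar> \<le> 4*n \<and> \<bar>B\<bar> \<le> 4*n \<and> \<bar>C\<bar> \<le> 4*n \<and> 0 < s \<and> s \<le> 4*n"
    if e: "s^2 + A*B + B*C + C*A = n"
      and P: "?L1 A B C s \<or> ?L2 A B C s \<or> ?L3 A B C s \<or> ?L4 A B C s \<or> ?L5 A B C s \<or> ?L6 A B C s \<or> ?L7 A B C s
     \<or> ?R1 A B C s \<or> ?R2 A B C s \<or> ?R3 A B C s \<or> ?R4 A B C s \<or> ?R5 A B C s \<or> ?R6 A B C s \<or> ?R7 A B C s \<or> ?R8 A B C s \<or> ?R9 A B C s \<or> ?R0 A B C s" for A B C s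
  proof -
    \<comment> \<open>Each rewriting of \<open>n\<close> suits a region where its summands are
      nonnegative, so that positive factors are at most \<open>n\<close>. The negated copies serve
      regions where the factors are negative.\<close>
    have e1: "(s+B)*(s+C) + (B+C)*(A-s) = n" "(-s-B)*(-s-C) + (-(B+C))*(s-A) = n"
      "(s+B)*(s+C) + (-(B+C))*(s-A) = n"
      "(s-A)*(s+A) + (A+B)*(A+C) = n" "(s-A)*(s+A) + (-(A+B))*(-(A+C)) = n"
      "(s-B)*(s+B) + (A+B)*(B+C) = n" "(s-B)*(s+B) + (-(A+B))*(-(B+C)) = n"
      "(s-C)*(s+C) + (A+C)*(B+C) = n" "(s-C)*(s+C) + (-(A+C))*(-(B+C)) = n"
      "s * s + (A*(B+C) + B*C) = n" "s * s + (-A*(-B-C) + B*C) = n"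
      "A * (B+C) + (s*s + B*C) = n" "-A * (-B-C) + (s*s + B*C) = n" "(-B)*(-C) + (s*s + -A*(-B-C)) = n"
      using e by (simp_all add: algebra_simps power2_eq_square)
    consider (l1) "?L1 A B C s" | (l2) "?L2 A B C s" | (l3) "?L3 A B C s" | (l4) "?L4 A B C s" | (l5) "?L5 A B C s"
      | (l6) "?L6 A B C s" | (l7) "?L7 A B C s" | (r1) "?R1 A B C s" | (r2) "?R2 A B C s" | (r3) "?R3 A B C s"
      | (r4) "?R4 A B C s" | (r5) "?R5 A B C s" | (r6) "?R6 A B C s" | (r7) "?R7 A B C s" | (r8) "?R8 A B C s"
      | (r9) "?R9 A B C s" | (r0) "?R0 A B C s" using P by argo
    then show ?thesis
    proof cases
      case l1
      then have "B * C \<ge> 0" "A * (B+C) \<ge> 0" "s * s \<ge> 0" by auto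
      with l1 pos_mult_bound[OF _ _ _ e1(10)] pos_mult_bound[OF _ _ _ e1(12)] show ?thesis by auto
    next
      case l2
      then have "B * C \<ge> 0" "(-A) * (-B-C) \<ge> 0" "s * s \<ge> 0"
        by (auto intro: mult_nonpos_nonpos mult_nonneg_nonneg simp del: mult_minus_left mult_minus_right minus_add_distrib)
      with l2 pos_mult_bound[OF _ _ _ e1(11)] pos_mult_bound[OF _ _ _ e1(13)] pos_mult_bound[OF _ _ _ e1(14)] show ?thesis
        by (cases "A = 0") auto
    next
      case l3 with pos_mult_bound2[OF _ _ _ _ e1(3)] show ?thesis by auto
    next
      case l4 with pos_mult_bound2[OF _ _ _ _ e1(5)] show ?thesis by auto
    next
      case l5 with pos_mult_bound2[OF _ _ _ _ e1(6)] show ?thesis by auto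
    next
      case l6 with pos_mult_bound2[OF _ _ _ _ e1(8)] show ?thesis by auto
    next
      case l7 
      then have "C = - B" "0 < s - B" "0 < s + B" by auto
      with l7 pos_mult_bound[OF _ _ _ e1(6)] show ?thesis by auto
    next
      case r1 with pos_mult_bound2[OF _ _ _ _ e1(1)] show ?thesis by auto
    next
      case r2 with pos_mult_bound2[OF _ _ _ _ e1(2)] show ?thesis by auto
    next
      case r3 with pos_mult_bound2[OF _ _ _ _ e1(4)] show ?thesis by auto
    next
      case r4 with pos_mult_bound2[OF _ _ _ _ e1(7)] show ?thesis by auto
    next
      case r5 with pos_mult_bound2[OF _ _ _ _ e1(9)] show ?thesis by auto
    next
      case r6
      with pos_mult_bound[OF _ _ _ e1(1)] show ?thesis by auto
    next
      case r7
      have "(s-A) * (s-C) + 0 = n" using e r7 by (simp add: algebra_simps power2_eq_square)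
      from pos_mult_bound[OF _ _ _ this] r7 have "s - A \<le> n" "s - C \<le> n" by simp_all
      with r7 show ?thesis by auto
    next
      case r8
      have "(s-A) * (s-B) + 0 = n" using e r8 by (simp add: algebra_simps power2_eq_square)
      from pos_mult_bound[OF _ _ _ this] r8 have "s - A \<le> n" "s - B \<le> n" by simp_all
      with r8 show ?thesis by auto
    next
      case r9
      with pos_mult_bound[OF _ _ _ e1(4)] show ?thesis by auto
    next
      case r0
      with pos_mult_bound[OF _ _ _ e1(4)] show ?thesis by auto
    qed
  qed
  have key: "of_bool (?L1 A B C s) + of_bool (?L2 A B C s) + of_bool (?L3 A B C s) + of_bool (?L4 A B C s)
     + of_bool (?L5 A B C s) + of_bool (?L6 A B C s) + of_bool (?L7 A B C s)
    = of_bool (?R1 A B C s) + of_bool (?R2 A B C s) + of_bool (?R3 A B C s) + of_bool (?R4 A B C s)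
     + of_bool (?R5 A B C s) + of_bool (?R6 A B C s) + of_bool (?R7 A B C s) + of_bool (?R8 A B C s) + of_bool (?R9 A B C s)
     + (of_bool (?R0 A B C s) :: int)"
    if x: "(A,B,C,s) \<in> quad_box n" for A B C s
  proof -
    have s: "s > 0" and e: "s^2 + A*B + B*C + C*A = n" using x by (auto simp: quad_box_def)
    \<comment> \<open>On each degenerate locus \<open>n\<close> collapses to a difference of two
      squares or to a single product. Its positivity is what the hypotheses of the chamber identity
      express.\<close>
    have e1: "B + C = 0 \<Longrightarrow> s^2 - B^2 > 0" "A + C = 0 \<Longrightarrow> s^2 - A^2 > 0" "A + B = 0 \<Longrightarrow> s^2 - A^2 > 0"
      using e n by (auto simp: algebra_simps power2_eq_square eq_neg_iff_add_eq_0[symmetric])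
    have sq: "-s < y \<and> y < s" if "s^2 - y^2 > 0" for y
      using that s abs_le_square_iff[of s y] by auto
    have e2: "A = s \<Longrightarrow> (s+B)*(s+C) > 0" "B = -s \<Longrightarrow> (B+C)*(A+B) > 0" "C = -s \<Longrightarrow> (B+C)*(A+C) > 0"
      using e n by (auto simp: algebra_simps power2_eq_square)
    note main = selling_chamber_identity[of s B C A, OF s]
    show ?thesis using main e1 e2 s sq unfolding zero_less_mult_iff by simp
  qed
  define g :: "(int \<Rightarrow> int \<Rightarrow> int \<Rightarrow> int \<Rightarrow> bool) \<Rightarrow> int \<times> int \<times> int \<times> int \<Rightarrow> int"
    where "g P = (\<lambda>(A,B,C,s). of_bool (P A B C s))" for P
  define sg where "sg = (\<lambda>(A,B,C,s::int). selling_sign A B C)"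
  have W: "signed_count n P = (\<Sum>x\<in>quad_box n. sg x * g P x)"
    if "P \<in> {?L1, ?L2, ?L3, ?L4, ?L5, ?L6, ?L7, ?R1, ?R2, ?R3, ?R4, ?R5, ?R6, ?R7, ?R8, ?R9, ?R0}" for P
  proof -
    have "signed_count n P = (\<Sum>(A,B,C,s) \<in> quad_box n. selling_sign A B C * of_bool (P A B C s))"
      by (rule signed_count_quad_box, rule box, assumption) (use that in \<open>elim insertE emptyE; simp only: simp_thms\<close>)
    then show ?thesis by (simp add: sg_def g_def case_prod_unfold)
  qed
  have key': "g ?L1 x + g ?L2 x + g ?L3 x + g ?L4 x + g ?L5 x + g ?L6 x + g ?L7 x
    = g ?R1 x + g ?R2 x + g ?R3 x + g ?R4 x + g ?R5 x + g ?R6 x + g ?R7 x + g ?R8 x + g ?R9 x + g ?R0 x"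
    if "x \<in> quad_box n" for x
  proof -
    obtain A B C s where x: "x = (A,B,C,s)" by (cases x)
    show ?thesis using key[of A B C s] that unfolding x g_def prod.case by blast
  qed
  have "signed_count n ?L1 + signed_count n ?L2 + signed_count n ?L3 + signed_count n ?L4 + signed_count n ?L5 + signed_count n ?L6 + signed_count n ?L7
    = (\<Sum>x\<in>quad_box n. sg x * (g ?L1 x + g ?L2 x + g ?L3 x + g ?L4 x + g ?L5 x + g ?L6 x + g ?L7 x))"
    using W by (simp only: insert_iff simp_thms sum.distrib distrib_left)
  also have "\<dots> = (\<Sum>x\<in>quad_box n. sg x * (g ?R1 x + g ?R2 x + g ?R3 x + g ?R4 x + g ?R5 x + g ?R6 x + g ?R7 x + g ?R8 x + g ?R9 x + g ?R0 x))"
    by (intro sum.cong refl arg_cong2[where f="(*)"] key')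
  also have "\<dots> = signed_count n ?R1 + signed_count n ?R2 + signed_count n ?R3 + signed_count n ?R4 + signed_count n ?R5 + signed_count n ?R6 + signed_count n ?R7 + signed_count n ?R8 + signed_count n ?R9 + signed_count n ?R0"
    using W by (simp only: insert_iff simp_thms sum.distrib distrib_left)
  finally show ?thesis .
qed

section \<open>Degenerate matrices as divisor sums\<close>

lemma finite_divpairs: "finite (divpairs n)"
proof (rule finite_subset)
  show "divpairs n \<subseteq> {1..n} \<times> {1..n}"
    using pos_mult_bound[of _ _ 0 n] by (auto simp: divpairs_def)
qed simp

lemma sum_divpairs_count:
  assumes "\<And>a d. (a,d) \<in> divpairs n \<Longrightarrow> N a d \<ge> 0"
    and "signed_count n P = (\<Sum>((a,d),s) \<in> Sigma (divpairs n) (\<lambda>(a,d). {1..N a d}). even_sign a d)"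
  shows "signed_count n P = (\<Sum>(a,d) \<in> divpairs n. even_sign a d * N a d)"
proof -
  have "(\<Sum>((a,d),s) \<in> Sigma (divpairs n) (\<lambda>(a,d). {1..N a d}). even_sign a d)
    = (\<Sum>x \<in> divpairs n. \<Sum>s \<in> (\<lambda>(a,d). {1..N a d}) x. even_sign (fst x) (snd x))"
    by (subst sum.Sigma) (auto simp: finite_divpairs case_prod_unfold)
  also have "\<dots> = (\<Sum>(a,d) \<in> divpairs n. even_sign a d * N a d)"
    by (rule sum.cong[OF refl]) (use assms(1) in auto)
  finally show ?thesis using assms(2) by simp
qed

text \<open>For \<open>A = s\<close> the equation is \<open>(s+B)*(s+C) = n\<close>. With
  \<open>a = s+C\<close> and \<open>d = s+B\<close>, the condition \<open>B+C > 0\<close> reads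
  \<open>2*s < a+d\<close> and leaves \<open>(a+d-1) div 2\<close> values of
  \<open>s\<close>.\<close>

lemma signed_count_diag:
  "signed_count n (\<lambda>A B C s. 0<s \<and> A=s \<and> B+C>0 \<and> s+B>0 \<and> s+C>0) = (\<Sum>(a,d) \<in> divpairs n. even_sign a d * ((a+d-1) div 2))"
proof (rule sum_divpairs_count)
  show "signed_count n (\<lambda>A B C s. 0<s \<and> A=s \<and> B+C>0 \<and> s+B>0 \<and> s+C>0) =
    (\<Sum>((a,d),s) \<in> Sigma (divpairs n) (\<lambda>(a,d). {1..(a+d-1) div 2}). even_sign a d)"
    unfolding signed_count_def
    by (rule sum.reindex_bij_witness[where i="\<lambda>((a,d),s). (s,d-s,a-s,s)" and j="\<lambda>(A,B,C,s). ((s+C,s+B),s)"])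
       (auto simp: divpairs_def selling_sign_def even_sign_def algebra_simps power2_eq_square)
qed (auto simp: divpairs_def)

text \<open>Here \<open>n = (s-A)*(s-C)\<close>, and with \<open>a = s-C\<close> the condition
  \<open>C \<le> -s\<close> reads \<open>2*s \<le> a\<close>.\<close>

lemma signed_count_diag_B:
  "signed_count n (\<lambda>A B C s. 0<s \<and> B=-s \<and> A<s \<and> C\<le>-s) = (\<Sum>(a,d) \<in> divpairs n. even_sign a d * (a div 2))"
proof (rule sum_divpairs_count)
  show "signed_count n (\<lambda>A B C s. 0<s \<and> B=-s \<and> A<s \<and> C\<le>-s) =
    (\<Sum>((a,d),s) \<in> Sigma (divpairs n) (\<lambda>(a,d). {1..a div 2}). even_sign a d)"
    unfolding signed_count_def
    by (rule sum.reindex_bij_witness[where i="\<lambda>((a,d),s). (s-d,-s,s-a,s)" and j="\<lambda>(A,B,C,s). ((s-C,s-A),s)"])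
       (auto simp: divpairs_def selling_sign_def even_sign_def algebra_simps power2_eq_square)
qed (auto simp: divpairs_def)

text \<open>The inequality is strict because the solutions with \<open>B = C = -s\<close> already
  belong to the preceding count; hence \<open>(a-1) div 2\<close> instead of
  \<open>a div 2\<close>.\<close>

lemma signed_count_diag_C:
  "signed_count n (\<lambda>A B C s. 0<s \<and> C=-s \<and> A<s \<and> B < -s) = (\<Sum>(a,d) \<in> divpairs n. even_sign a d * ((a-1) div 2))"
proof (rule sum_divpairs_count)
  show "signed_count n (\<lambda>A B C s. 0<s \<and> C=-s \<and> A<s \<and> B < -s) =
    (\<Sum>((a,d),s) \<in> Sigma (divpairs n) (\<lambda>(a,d). {1..(a-1) div 2}). even_sign a d)"
    unfolding signed_count_def
    by (rule sum.reindex_bij_witness[where i="\<lambda>((a,d),s). (s-d,s-a,-s,s)" and j="\<lambda>(A,B,C,s). ((s-B,s-A),s)"])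
       (auto simp: divpairs_def selling_sign_def even_sign_def algebra_simps power2_eq_square)
qed (auto simp: divpairs_def)

lemma alternating_sum:
  "(\<Sum>i\<in>{a<..a + int k}. if even (i - a) then -1 else 1 :: int) = of_bool (odd k)"
proof (induction k)
  case (Suc k)
  have "{a<..a + int (Suc k)} = insert (a + int (Suc k)) {a<..a + int k}" by auto
  then show ?case using Suc by auto
qed simp

text \<open>Factorizations of \<open>n\<close> into positive factors \<open>s-b\<close>,
  \<open>s+b\<close> of equal parity: the diagonals of matrices of trace \<open>2*s\<close> that are
  triangular in a basis attached to an edge.\<close>

definition square_diff :: "int \<Rightarrow> (int \<times> int) set" where
  "square_diff n = {(b,s). \<bar>b\<bar> < s \<and> s^2 - b^2 = n}"

lemma square_diff_divpairs:
  "bij_betw (\<lambda>(b,s). (s - b, s + b)) (square_diff n) {(a,d) \<in> divpairs n. even (a - d)}"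
proof -
  have "y \<in> (\<lambda>(b,s). (s - b, s + b)) ` square_diff n" if y: "y \<in> {(a,d) \<in> divpairs n. even (a - d)}" for y
  proof -
    obtain a d where ad: "y = (a,d)" "(a,d) \<in> divpairs n" "even (a - d)" using y by auto
    then obtain k where k: "a - d = 2 * k" by blast
    then have a: "a = d + 2 * k" by simp
    have "(-k, d + k) \<in> square_diff n" using ad(2) a by (auto simp: divpairs_def square_diff_def algebra_simps power2_eq_square)
    then show ?thesis using ad(1) a by force
  qed
  then show ?thesis
    unfolding bij_betw_def by (auto simp: inj_on_def divpairs_def square_diff_def algebra_simps power2_eq_square)
qed

lemma finite_square_diff: "finite (square_diff n)"
  using bij_betw_finite[OF square_diff_divpairs] finite_subset[OF _ finite_divpairs[of n], of "{(a,d) \<in> divpairs n. even (a - d)}"] by blast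

lemma card_square_diff_even:
  "card {(b,s) \<in> square_diff n. even (s - b)} = card {(a,d) \<in> divpairs n. even a \<and> even d}"
proof (rule bij_betw_same_card[OF bij_betw_subset[OF square_diff_divpairs]])
  have surj: "(\<lambda>(b,s). (s - b, s + b)) ` square_diff n = {(a,d) \<in> divpairs n. even (a - d)}"
    using square_diff_divpairs by (rule bij_betw_imp_surj_on)
  show "(\<lambda>(b,s). (s - b, s + b)) ` {(b,s) \<in> square_diff n. even (s - b)} = {(a,d) \<in> divpairs n. even a \<and> even d}" (is "?f ` ?X = ?Y")
  proof
    show "?f ` ?X \<subseteq> ?Y" using surj by auto
    show "?Y \<subseteq> ?f ` ?X"
    proof
      fix y assume "y \<in> ?Y"
      then obtain a d where y: "y = (a,d)" "(a,d) \<in> divpairs n" "even a" "even d" by auto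
      then have "(a,d) \<in> ?f ` square_diff n" unfolding surj by simp
      then show "y \<in> ?f ` ?X" using y by force
    qed
  qed
qed auto

lemma card_square_diff_pos:
  assumes "n > 0"
  shows "2 * int (card {(b,s) \<in> square_diff n. b > 0}) + of_bool (\<exists>l. n = l^2) = int (card {(a,d) \<in> divpairs n. even (a - d)})"
proof -
  let ?P = "{(b,s) \<in> square_diff n. b > 0}" and ?N = "{(b,s) \<in> square_diff n. b < 0}" and ?Z = "{(b,s) \<in> square_diff n. b = 0}"
  have fin: "finite ?P" "finite ?N" "finite ?Z" by (auto intro: finite_subset[OF _ finite_square_diff[of n]])
  have "square_diff n = ?P \<union> (?N \<union> ?Z)" by auto
  then have "card (square_diff n) = card (?P \<union> (?N \<union> ?Z))" by (rule arg_cong)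
  also have "\<dots> = card ?P + card (?N \<union> ?Z)"
    by (rule card_Un_disjoint) (use fin in auto)
  also have "card (?N \<union> ?Z) = card ?N + card ?Z"
    by (rule card_Un_disjoint) (use fin in auto)
  finally have "card (square_diff n) = card ?P + (card ?N + card ?Z)" .
  moreover have "card ?N = card ?P"
    by (rule bij_betw_same_card[of "\<lambda>(b,s). (-b,s)"], rule bij_betw_byWitness[where f'="\<lambda>(b,s). (-b,s)"])
      (auto simp: square_diff_def)
  moreover have "int (card ?Z) = of_bool (\<exists>l. n = l^2)"
  proof (cases "\<exists>l. n = l^2")
    case True
    then obtain l where l: "n = l^2" by blast
    have "?Z = {(0, \<bar>l\<bar>)}"
      using l assms by (auto simp: square_diff_def power2_eq_iff)
    then show ?thesis using True by simp
  next
    case False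
    then have Z: "?Z = {}" by (auto simp: square_diff_def)
    show ?thesis unfolding Z using False by simp
  qed
  moreover have "card (square_diff n) = card {(a,d) \<in> divpairs n. even (a - d)}"
    by (rule bij_betw_same_card[OF square_diff_divpairs])
  ultimately show ?thesis by simp
qed

text \<open>For \<open>B = -A\<close> the parameter \<open>C\<close> drops out of the equation,
  which becomes \<open>s^2 - A^2 = n\<close>. The signs alternate over the \<open>2*A-1\<close>
  values of \<open>C\<close>, starting with +1, and leave 1.\<close>

lemma signed_count_gamma:
  "signed_count n (\<lambda>A B C s. B=-A \<and> 0<A \<and> A<s \<and> -A<C \<and> C<A) = int (card {(b,s) \<in> square_diff n. b > 0})"
proof -
  have sg: "selling_sign A (-A) C = (if even (C - (-A)) then -1 else 1)" for A C
    by (auto simp: selling_sign_def)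
  have "signed_count n (\<lambda>A B C s. B=-A \<and> 0<A \<and> A<s \<and> -A<C \<and> C<A)
    = (\<Sum>(x,C) \<in> Sigma {(b,s) \<in> square_diff n. b > 0} (\<lambda>x. {-fst x<..<fst x}). if even (C - (-fst x)) then -1 else 1)"
    unfolding signed_count_def
    by (rule sum.reindex_bij_witness[where i="\<lambda>((A,s),C). (A,-A,C,s)" and j="\<lambda>(A,B,C,s). ((A,s),C)"])
       (auto simp: square_diff_def sg algebra_simps power2_eq_square)
  also have "\<dots> = (\<Sum>x \<in> {(b,s) \<in> square_diff n. b > 0}. \<Sum>C \<in> {-fst x<..<fst x}. if even (C - (-fst x)) then -1 else 1)"
    by (subst sum.Sigma) (auto intro: finite_subset[OF _ finite_square_diff[of n]])
  also have "\<dots> = (\<Sum>x \<in> {(b,s) \<in> square_diff n. b > 0}. 1)"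
  proof (rule sum.cong[OF refl])
    fix x assume "x \<in> {(b,s) \<in> square_diff n. b > 0}"
    then have pos: "fst x > 0" by auto
    then have "{-fst x<..<fst x} = {-fst x<..-fst x + int (nat (2 * fst x - 1))}" by auto
    then show "(\<Sum>C \<in> {-fst x<..<fst x}. if even (C - (-fst x)) then -1 else 1) = (1::int)"
      using pos by (simp only: alternating_sum) (simp add: even_nat_iff)
  qed
  finally show ?thesis by simp
qed

text \<open>Now \<open>B\<close> is the free parameter. Its half-open range has \<open>2*A\<close>
  elements, so the alternating signs cancel.\<close>

lemma signed_count_beta:
  "signed_count n (\<lambda>A B C s. C=-A \<and> 0<A \<and> A<s \<and> -A\<le>B \<and> B<A) = 0"
proof -
  have sg: "selling_sign A B (-A) = - (if even (B - (-A-1)) then -1 else 1)" for A B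
    unfolding selling_sign_def by presburger
  have "signed_count n (\<lambda>A B C s. C=-A \<and> 0<A \<and> A<s \<and> -A\<le>B \<and> B<A)
    = (\<Sum>(x,B) \<in> Sigma {(b,s) \<in> square_diff n. b > 0} (\<lambda>x. {-fst x..<fst x}). - (if even (B - (-fst x - 1)) then -1 else 1))"
    unfolding signed_count_def
    by (rule sum.reindex_bij_witness[where i="\<lambda>((A,s),B). (A,B,-A,s)" and j="\<lambda>(A,B,C,s). ((A,s),B)"])
       (auto simp: square_diff_def sg algebra_simps power2_eq_square)
  also have "\<dots> = (\<Sum>x \<in> {(b,s) \<in> square_diff n. b > 0}. \<Sum>B \<in> {-fst x..<fst x}. - (if even (B - (-fst x - 1)) then -1 else 1))"
    by (subst sum.Sigma) (auto intro: finite_subset[OF _ finite_square_diff[of n]])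
  also have "\<dots> = (\<Sum>x \<in> {(b,s) \<in> square_diff n. b > 0}. 0)"
  proof (rule sum.cong[OF refl])
    fix x assume "x \<in> {(b,s) \<in> square_diff n. b > 0}"
    then have pos: "fst x > 0" by auto
    then have "{-fst x..<fst x} = {-fst x - 1<..-fst x - 1 + int (nat (2 * fst x))}" by auto
    then show "(\<Sum>B \<in> {-fst x..<fst x}. - (if even (B - (-fst x - 1)) then -1 else 1)) = (0::int)"
      using pos by (simp only: alternating_sum sum_negf) (simp add: even_nat_iff)
  qed
  finally show ?thesis by simp
qed

text \<open>The free parameter \<open>A\<close> takes \<open>s-\<bar>B\<bar>-1\<close> values with
  alternating signs starting at +1; 1 remains exactly when \<open>s-B\<close> is even.\<close>

lemma signed_count_alpha:
  "signed_count n (\<lambda>A B C s. B+C=0 \<and> \<bar>B\<bar><A \<and> A<s) = int (card {(b,s) \<in> square_diff n. even (s - b)})"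
proof -
  have sg: "selling_sign A B (-B) = (if even (A - \<bar>B\<bar>) then -1 else 1)" for A B
    by (auto simp: selling_sign_def)
  have "signed_count n (\<lambda>A B C s. B+C=0 \<and> \<bar>B\<bar><A \<and> A<s)
    = (\<Sum>(x,A) \<in> Sigma (square_diff n) (\<lambda>x. {\<bar>fst x\<bar><..<snd x}). if even (A - \<bar>fst x\<bar>) then -1 else 1)"
    unfolding signed_count_def
    by (rule sum.reindex_bij_witness[where i="\<lambda>((B,s),A). (A,B,-B,s)" and j="\<lambda>(A,B,C,s). ((B,s),A)"])
       (auto simp: square_diff_def sg algebra_simps power2_eq_square add_eq_0_iff)
  also have "\<dots> = (\<Sum>x \<in> square_diff n. \<Sum>A \<in> {\<bar>fst x\<bar><..<snd x}. if even (A - \<bar>fst x\<bar>) then -1 else 1)"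
    by (subst sum.Sigma) (auto intro: finite_subset[OF _ finite_square_diff[of n]])
  also have "\<dots> = (\<Sum>x \<in> square_diff n. of_bool (even (snd x - fst x)))"
  proof (rule sum.cong[OF refl])
    fix x assume "x \<in> square_diff n"
    then have pos: "\<bar>fst x\<bar> < snd x" by (auto simp: square_diff_def)
    then have "{\<bar>fst x\<bar><..<snd x} = {\<bar>fst x\<bar><..\<bar>fst x\<bar> + int (nat (snd x - \<bar>fst x\<bar> - 1))}" by auto
    then show "(\<Sum>A \<in> {\<bar>fst x\<bar><..<snd x}. if even (A - \<bar>fst x\<bar>) then -1 else 1) = (of_bool (even (snd x - fst x)) :: int)"
      using pos by (simp only: alternating_sum) (simp add: even_nat_iff)
  qed
  also have "\<dots> = int (card {x \<in> square_diff n. even (snd x - fst x)})"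
    by (simp add: sum.If_cases finite_square_diff of_bool_def Int_def)
  also have "{x \<in> square_diff n. even (snd x - fst x)} = {(b,s) \<in> square_diff n. even (s - b)}" by auto
  finally show ?thesis .
qed

section \<open>The relation summed over all traces\<close>

definition selling_sum :: "int \<Rightarrow> int" where
  "selling_sum m = (\<Sum>(A,B,C) \<in> {(A,B,C). A*B + B*C + C*A = m \<and> A \<ge> 0 \<and> B \<ge> 0 \<and> C \<ge> 0}.
     selling_sign A B C * selling_mult A B C)"

lemma finite_selling:
  assumes "m > 0"
  shows "finite {(A,B,C). A*B + B*C + C*A = (m::int) \<and> A \<ge> 0 \<and> B \<ge> 0 \<and> C \<ge> 0}"
proof (rule finite_subset)
  show "{(A,B,C). A*B + B*C + C*A = m \<and> A \<ge> 0 \<and> B \<ge> 0 \<and> C \<ge> 0} \<subseteq> {0..m} \<times> {0..m} \<times> {0..m}"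
  proof
    fix x :: "int \<times> int \<times> int" assume "x \<in> {(A,B,C). A*B + B*C + C*A = m \<and> A \<ge> 0 \<and> B \<ge> 0 \<and> C \<ge> 0}"
    then obtain A B C where x: "x = (A,B,C)" and e: "A*B + B*C + C*A = m" and pos: "A \<ge> 0" "B \<ge> 0" "C \<ge> 0" by auto
    have bound: "x \<le> m" if "x*(y+z) + y*z = m" "x \<ge> 0" "y \<ge> 0" "z \<ge> 0" for x y z :: int
    proof (cases "x = 0 \<or> y + z = 0")
      case True
      have "y = 0 \<and> z = 0" if "y + z = 0" using that \<open>y \<ge> 0\<close> \<open>z \<ge> 0\<close> by linarith
      then show ?thesis using True \<open>m > 0\<close> that(1) by auto
    next
      case False
      then show ?thesis using pos_mult_bound(1)[OF _ _ _ that(1)] that by auto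
    qed
    show "x \<in> {0..m} \<times> {0..m} \<times> {0..m}"
      unfolding x using bound[of A B C] bound[of B A C] bound[of C A B] pos e by (auto simp: algebra_simps)
  qed
qed simp

lemma signed_count_flip: "signed_count n P = signed_count n (\<lambda>A B C s. P A B C (-s))"
  unfolding signed_count_def
  by (rule sum.reindex_bij_witness[where i="\<lambda>(A,B,C,s). (A,B,C,-s)" and j="\<lambda>(A,B,C,s). (A,B,C,-s)"]) auto

lemma finite_quad_nonneg:
  assumes "n > 0"
  shows "finite {(A,B,C,s). s^2 + A*B + B*C + C*A = (n::int) \<and> A \<ge> 0 \<and> B \<ge> 0 \<and> C \<ge> 0 \<and> A*B + B*C + C*A > 0}" (is "finite ?S")
proof (rule finite_subset)
  show "?S \<subseteq> (\<Union>s\<in>{-n..n}. (if n - s^2 > 0 then (\<lambda>(A,B,C). (A,B,C,s)) ` {(A,B,C). A*B + B*C + C*A = (n - s^2) \<and> A \<ge> 0 \<and> B \<ge> 0 \<and> C \<ge> 0} else {}))"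
  proof
    fix x assume "x \<in> ?S"
    then obtain A B C s where x: "x = (A,B,C,s)" and e: "s^2 + A*B + B*C + C*A = n" and pos: "A \<ge> 0" "B \<ge> 0" "C \<ge> 0" "A*B + B*C + C*A > 0"
      by auto
    have "s \<in> {-n..n}" using e pos(4) abs_le_square_int[of s] by auto
    then show "x \<in> (\<Union>s\<in>{-n..n}. (if n - s^2 > 0 then (\<lambda>(A,B,C). (A,B,C,s)) ` {(A,B,C). A*B + B*C + C*A = (n - s^2) \<and> A \<ge> 0 \<and> B \<ge> 0 \<and> C \<ge> 0} else {}))"
      using e pos unfolding x by (intro UN_I[of s]) force+
  qed
  show "finite \<dots>" by (auto simp: finite_selling)
qed

lemma selling_pos:
  fixes A B C :: int
  assumes "(A>0 \<and> B\<ge>0 \<and> C\<ge>0 \<and> B+C>0) \<or> (A\<ge>0 \<and> B>0 \<and> C>0)"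
  shows "A*B + B*C + C*A > 0"
proof -
  have "A*B + B*C + C*A = A * (B+C) + B*C" by (simp add: algebra_simps)
  also have "\<dots> > 0"
  proof (cases "A > 0 \<and> B + C > 0")
    case True
    moreover have "B * C \<ge> 0" using assms by auto
    ultimately show ?thesis by (simp add: add_pos_nonneg)
  next
    case False
    then show ?thesis using assms by auto
  qed
  finally show ?thesis .
qed

text \<open>\<open>selling_mult\<close> splits into two half-open triangles, one containing the
  edges \<open>B = 0\<close> and \<open>C = 0\<close>, the other only the edge \<open>A = 0\<close>.
  No two parameters vanish together because \<open>A*B + B*C + C*A > 0\<close>. These are the first
  two conditions of the chamber identity, the second up to negating the matrix.\<close>

lemma sum_selling_signed_count:
  assumes n: "n > 0"
  shows "(\<Sum>s | s \<in> {-n..n} \<and> s^2 < n. selling_sum (n - s^2)) =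
    signed_count n (\<lambda>A B C s. A>0 \<and> B\<ge>0 \<and> C\<ge>0 \<and> B+C>0) + signed_count n (\<lambda>A B C s. A\<ge>0 \<and> B>0 \<and> C>0)"
proof -
  let ?T = "{(A,B,C,s). s^2 + A*B + B*C + C*A = (n::int) \<and> A \<ge> 0 \<and> B \<ge> 0 \<and> C \<ge> 0 \<and> A*B + B*C + C*A > 0}"
  let ?S = "{s. s \<in> {-n..n} \<and> s^2 < n}"
  have "(\<Sum>s\<in>?S. selling_sum (n - s^2)) =
     (\<Sum>(s,A,B,C) \<in> Sigma ?S (\<lambda>s. {(A,B,C). A*B + B*C + C*A = n - s^2 \<and> A \<ge> 0 \<and> B \<ge> 0 \<and> C \<ge> 0}). selling_sign A B C * selling_mult A B C)"
    unfolding selling_sum_def by (subst sum.Sigma) (auto intro!: finite_selling intro: finite_subset[of _ "{-n..n}"])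
  also have "\<dots> = (\<Sum>(A,B,C,s) \<in> ?T. selling_sign A B C * selling_mult A B C)"
  proof (rule sum.reindex_bij_witness[where i="\<lambda>(A,B,C,s). (s,A,B,C)" and j="\<lambda>(s,A,B,C). (A,B,C,s)"])
    fix x assume "x \<in> ?T"
    then obtain A B C s where x: "x = (A,B,C,s)" and e: "n = s^2 + A*B + B*C + C*A" and pos: "A \<ge> 0" "B \<ge> 0" "C \<ge> 0" "A*B + B*C + C*A > 0"
      by auto
    have "s \<in> {-n..n}" using e pos(4) abs_le_square_int[of s] by auto
    then show "(case x of (A,B,C,s) \<Rightarrow> (s,A,B,C)) \<in> Sigma ?S (\<lambda>s. {(A,B,C). A*B + B*C + C*A = n - s^2 \<and> A \<ge> 0 \<and> B \<ge> 0 \<and> C \<ge> 0})"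
      using e pos x by auto
  qed auto
  also have "\<dots> = (\<Sum>(A,B,C,s) \<in> ?T. selling_sign A B C * of_bool (A>0 \<and> B\<ge>0 \<and> C\<ge>0 \<and> B+C>0)) +
     (\<Sum>(A,B,C,s) \<in> ?T. selling_sign A B C * of_bool (A\<ge>0 \<and> B>0 \<and> C>0))"
    unfolding sum.distrib[symmetric]
  proof (rule sum.cong[OF refl])
    fix x assume "x \<in> ?T"
    then obtain A B C s where x: "x = (A,B,C,s)" and pos: "A \<ge> 0" "B \<ge> 0" "C \<ge> 0" "A*B + B*C + C*A > 0" by auto
    have "\<not> (A = 0 \<and> B = 0)" "\<not> (B = 0 \<and> C = 0)" "\<not> (A = 0 \<and> C = 0)" using pos(4) by auto
    then show "(case x of (A,B,C,s) \<Rightarrow> selling_sign A B C * selling_mult A B C) =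
      (case x of (A,B,C,s) \<Rightarrow> selling_sign A B C * of_bool (A>0 \<and> B\<ge>0 \<and> C\<ge>0 \<and> B+C>0)) +
      (case x of (A,B,C,s) \<Rightarrow> selling_sign A B C * of_bool (A\<ge>0 \<and> B>0 \<and> C>0))"
      using pos(1-3) unfolding x selling_mult_def by auto
  qed
  also have "(\<Sum>(A,B,C,s) \<in> ?T. selling_sign A B C * of_bool (A>0 \<and> B\<ge>0 \<and> C\<ge>0 \<and> B+C>0)) = signed_count n (\<lambda>A B C s. A>0 \<and> B\<ge>0 \<and> C\<ge>0 \<and> B+C>0)"
    unfolding signed_count_def by (rule sum.mono_neutral_cong_right[OF finite_quad_nonneg[OF n]]) (auto intro: selling_pos)
  also have "(\<Sum>(A,B,C,s) \<in> ?T. selling_sign A B C * of_bool (A\<ge>0 \<and> B>0 \<and> C>0)) = signed_count n (\<lambda>A B C s. A\<ge>0 \<and> B>0 \<and> C>0)"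
    unfolding signed_count_def by (rule sum.mono_neutral_cong_right[OF finite_quad_nonneg[OF n]]) (auto intro: selling_pos)
  finally show ?thesis .
qed

lemma signed_count_split_sign:
  assumes "finite {(A,B,C,s). s^2 + A*B + B*C + C*A = n \<and> P A B C s}"
  shows "signed_count n P = signed_count n (\<lambda>A B C s. 0 < s \<and> P A B C s) + signed_count n (\<lambda>A B C s. s = 0 \<and> P A B C s) + signed_count n (\<lambda>A B C s. s < 0 \<and> P A B C s)"
proof -
  have fin: "finite {(A,B,C,s). s^2 + A*B + B*C + C*A = n \<and> R A B C s \<and> P A B C s}" for R
    by (rule finite_subset[OF _ assms]) auto
  have "signed_count n P = signed_count n (\<lambda>A B C s. (0 < s \<or> s = 0) \<and> P A B C s \<or> s < 0 \<and> P A B C s)"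
    by (rule signed_count_cong) auto
  also have "\<dots> = signed_count n (\<lambda>A B C s. (0 < s \<or> s = 0) \<and> P A B C s) + signed_count n (\<lambda>A B C s. s < 0 \<and> P A B C s)"
    by (rule signed_count_disj) (use fin in auto)
  also have "signed_count n (\<lambda>A B C s. (0 < s \<or> s = 0) \<and> P A B C s) = signed_count n (\<lambda>A B C s. 0 < s \<and> P A B C s \<or> s = 0 \<and> P A B C s)"
    by (rule signed_count_cong) auto
  also have "\<dots> = signed_count n (\<lambda>A B C s. 0 < s \<and> P A B C s) + signed_count n (\<lambda>A B C s. s = 0 \<and> P A B C s)"
    by (rule signed_count_disj) (use fin[of "\<lambda>A B C s. 0 < s"] fin[of "\<lambda>A B C s. s = 0"] in auto)
  finally show ?thesis by simp
qed

lemma signed_count_zero: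
  "signed_count n (\<lambda>A B C s. s = 0 \<and> A = 0 \<and> B > 0 \<and> C > 0) = (\<Sum>(a,d) \<in> divpairs n. even_sign a d)"
  "signed_count n (\<lambda>A B C s. s = 0 \<and> B = 0 \<and> A > 0 \<and> C > 0) = (\<Sum>(a,d) \<in> divpairs n. even_sign a d)"
  "signed_count n (\<lambda>A B C s. s = 0 \<and> C = 0 \<and> A > 0 \<and> B > 0) = (\<Sum>(a,d) \<in> divpairs n. even_sign a d)"
  unfolding signed_count_def
  by (rule sum.reindex_bij_witness[where i="\<lambda>(a,d). (0,a,d,0)" and j="\<lambda>(A,B,C,s). (B,C)"] 
     sum.reindex_bij_witness[where i="\<lambda>(a,d). (a,0,d,0)" and j="\<lambda>(A,B,C,s). (A,C)"]
     sum.reindex_bij_witness[where i="\<lambda>(a,d). (a,d,0,0)" and j="\<lambda>(A,B,C,s). (A,B)"];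
     auto simp: divpairs_def selling_sign_def even_sign_def algebra_simps; fail)+

theorem kronecker_relation:
  assumes n: "n > 0"
  shows "(\<Sum>s | s \<in> {-n..n} \<and> s^2 < n. selling_sum (n - s^2)) =
    4 * (\<Sum>(a,d) \<in> divpairs n. even_sign a d * a) - of_bool (\<exists>l. n = l^2)"
proof -
  let ?X = "\<lambda>A B C s::int. A>0 \<and> B\<ge>0 \<and> C\<ge>0 \<and> B+C>(0::int)"
  let ?Y = "\<lambda>A B C s::int. A\<ge>0 \<and> B>0 \<and> C>(0::int)"
  let ?I = "\<lambda>A B C s::int. s+B>0 \<and> s+C>0 \<and> B+C>0 \<and> A>s"
  let ?q = "\<lambda>P. {(A,B,C,s). s^2 + A*B + B*C + C*A = n \<and> P A B C s}"
  have finX: "finite (?q ?X)" and finY: "finite (?q ?Y)"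
    by (rule finite_subset[OF _ finite_quad_nonneg[OF n]]; auto intro: selling_pos)+
  have finI: "finite (?q ?I)"
  proof (rule finite_subset)
    show "?q ?I \<subseteq> {-4*n..4*n} \<times> {-4*n..4*n} \<times> {-4*n..4*n} \<times> {-4*n..4*n}"
    proof
      fix x assume "x \<in> ?q ?I"
      then obtain A B C s where x: "x = (A,B,C,s)" and e: "s^2 + A*B + B*C + C*A = n" and I: "?I A B C s" by auto
      have "(s+B)*(s+C) + (B+C)*(A-s) = n" using e by (simp add: algebra_simps power2_eq_square)
      from pos_mult_bound2[OF _ _ _ _ this] I show "x \<in> {-4*n..4*n} \<times> {-4*n..4*n} \<times> {-4*n..4*n} \<times> {-4*n..4*n}"
        unfolding x by auto
    qed
  qed simp
  have X: "signed_count n ?X = 2 * signed_count n (\<lambda>A B C s. 0 < s \<and> ?X A B C s) + signed_count n (\<lambda>A B C s. s = 0 \<and> ?X A B C s)"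
    unfolding signed_count_split_sign[OF finX] using signed_count_flip[of n "\<lambda>A B C s. s < 0 \<and> ?X A B C s"] by simp
  have Y: "signed_count n ?Y = 2 * signed_count n (\<lambda>A B C s. 0 < s \<and> ?Y A B C s) + signed_count n (\<lambda>A B C s. s = 0 \<and> ?Y A B C s)"
    unfolding signed_count_split_sign[OF finY] using signed_count_flip[of n "\<lambda>A B C s. s < 0 \<and> ?Y A B C s"] by simp
  have L2: "signed_count n (\<lambda>A B C s. 0 < s \<and> A\<le>0 \<and> B<0 \<and> C<0) = signed_count n (\<lambda>A B C s. 0 < s \<and> ?Y A B C s)"
    using signed_count_flip[of n "\<lambda>A B C s. 0 < s \<and> ?Y A B C s"]
      signed_count_uminus[of n "\<lambda>A B C s. 0 < s \<and> A\<le>0 \<and> B<0 \<and> C<0"] by simp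
  \<comment> \<open>Negating the off-diagonal entries produces region \<open>?I\<close> with
    \<open>s\<close> of any sign. Its part \<open>s < 0\<close> is, after negation, another region
    on the right of the balance and cancels against it. Its part \<open>s = 0\<close> is the open
    triangle, the extra term \<open>?P0\<close> in \<open>main\<close>.\<close>
  have "signed_count n (\<lambda>A B C s. s < 0 \<and> ?I A B C s) = signed_count n (\<lambda>A B C s. 0 < s \<and> s+B<0 \<and> s+C<0 \<and> A<s)"
    unfolding signed_count_uminus[of n "\<lambda>A B C s. s < 0 \<and> ?I A B C s"] by (rule signed_count_cong) auto
  moreover have "signed_count n (\<lambda>A B C s. s = 0 \<and> ?I A B C s) = signed_count n (\<lambda>A B C s. s = 0 \<and> A>0 \<and> B>0 \<and> C>0)"
    by (rule signed_count_cong) auto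
  ultimately have I: "signed_count n ?I = signed_count n (\<lambda>A B C s. 0 < s \<and> ?I A B C s) + signed_count n (\<lambda>A B C s. s = 0 \<and> A>0 \<and> B>0 \<and> C>0)
      + signed_count n (\<lambda>A B C s. 0 < s \<and> s+B<0 \<and> s+C<0 \<and> A<s)"
    unfolding signed_count_split_sign[OF finI] by simp
  let ?E0 = "int (card {(a,d) \<in> divpairs n. even a \<and> even d})" and ?h = "int (card {(b,s) \<in> square_diff n. b > 0})"
  let ?P0 = "signed_count n (\<lambda>A B C s. s = 0 \<and> A>0 \<and> B>0 \<and> C>0)"
  let ?Z = "\<Sum>(a,d) \<in> divpairs n. even_sign a d"
  have main: "signed_count n (\<lambda>A B C s. 0 < s \<and> ?X A B C s) + signed_count n (\<lambda>A B C s. 0 < s \<and> ?Y A B C s) + ?P0 =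
     (\<Sum>(a,d) \<in> divpairs n. even_sign a d * ((a+d-1) div 2)) + (\<Sum>(a,d) \<in> divpairs n. even_sign a d * (a div 2))
     + (\<Sum>(a,d) \<in> divpairs n. even_sign a d * ((a-1) div 2)) + ?h - ?E0"
    using signed_count_boundary[OF n]
    unfolding signed_count_negate_offdiag I L2 signed_count_negate_BC signed_count_negate_AC signed_count_negate_AB signed_count_diag signed_count_diag_B signed_count_diag_C signed_count_beta signed_count_gamma signed_count_alpha card_square_diff_even
    by linarith
  have fin0: "finite (?q R)" if "\<And>A B C s. R A B C s \<Longrightarrow> ?X A B C s \<or> ?Y A B C s" for R
    by (rule finite_subset[of _ "?q ?X \<union> ?q ?Y"]) (use that finX finY in auto)
  have "signed_count n (\<lambda>A B C s. s = 0 \<and> ?X A B C s) = signed_count n (\<lambda>A B C s. (s = 0 \<and> A>0 \<and> B>0 \<and> C>0 \<or> s = 0 \<and> B = 0 \<and> A > 0 \<and> C > 0) \<or> s = 0 \<and> C = 0 \<and> A > 0 \<and> B > 0)"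
    by (rule signed_count_cong) auto
  also have "\<dots> = signed_count n (\<lambda>A B C s. s = 0 \<and> A>0 \<and> B>0 \<and> C>0 \<or> s = 0 \<and> B = 0 \<and> A > 0 \<and> C > 0) + ?Z"
    unfolding signed_count_zero(3)[symmetric] by (rule signed_count_disj; (rule fin0)?) auto
  also have "signed_count n (\<lambda>A B C s. s = 0 \<and> A>0 \<and> B>0 \<and> C>0 \<or> s = 0 \<and> B = 0 \<and> A > 0 \<and> C > 0) = ?P0 + ?Z"
    unfolding signed_count_zero(2)[symmetric] by (rule signed_count_disj; (rule fin0)?) auto
  finally have X0: "signed_count n (\<lambda>A B C s. s = 0 \<and> ?X A B C s) = ?P0 + ?Z + ?Z" .
  have "signed_count n (\<lambda>A B C s. s = 0 \<and> ?Y A B C s) = signed_count n (\<lambda>A B C s. s = 0 \<and> A>0 \<and> B>0 \<and> C>0 \<or> s = 0 \<and> A = 0 \<and> B > 0 \<and> C > 0)"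
    by (rule signed_count_cong) auto
  also have "\<dots> = ?P0 + ?Z"
    unfolding signed_count_zero(1)[symmetric] by (rule signed_count_disj; (rule fin0)?) auto
  finally have Y0: "signed_count n (\<lambda>A B C s. s = 0 \<and> ?Y A B C s) = ?P0 + ?Z" .
  have h: "2 * ?h = (\<Sum>(a,d) \<in> divpairs n. of_bool (even (a - d))) - of_bool (\<exists>l. n = l^2)"
    using card_square_diff_pos[OF n] finite_divpairs[of n] by (simp add: case_prod_unfold of_bool_def sum.If_cases Int_def)
  have E0: "?E0 = (\<Sum>(a,d) \<in> divpairs n. of_bool (even a \<and> even d))"
    using finite_divpairs[of n] by (simp add: case_prod_unfold of_bool_def sum.If_cases Int_def)
  \<comment> \<open>Solutions with nonzero \<open>s\<close> come in pairs. At \<open>s = 0\<close>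
    the two half-open triangles cover the interior twice, which \<open>main\<close> absorbs as
    \<open>?P0\<close>, and each of the three edges once, hence \<open>3 * ?Z\<close>.\<close>
  have "(\<Sum>s | s \<in> {-n..n} \<and> s^2 < n. selling_sum (n - s^2)) =
    2 * ((\<Sum>(a,d) \<in> divpairs n. even_sign a d * ((a+d-1) div 2)) + (\<Sum>(a,d) \<in> divpairs n. even_sign a d * (a div 2))
     + (\<Sum>(a,d) \<in> divpairs n. even_sign a d * ((a-1) div 2)) + ?h - ?E0) + 3 * ?Z"
    unfolding sum_selling_signed_count[OF n] X Y X0 Y0 main[symmetric] by (simp only: distrib_left)
  also have "\<dots> = (\<Sum>(a,d) \<in> divpairs n. even_sign a d * (2 * ((a+d-1) div 2) + 2 * (a div 2) + 2 * ((a-1) div 2) + 3)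
     + of_bool (even (a - d)) - 2 * of_bool (even a \<and> even d)) - of_bool (\<exists>l. n = l^2)"
    unfolding distrib_left right_diff_distrib h E0
    by (simp add: case_prod_unfold sum.distrib sum_subtractf sum_distrib_left algebra_simps)
  also have "(\<Sum>(a,d) \<in> divpairs n. even_sign a d * (2 * ((a+d-1) div 2) + 2 * (a div 2) + 2 * ((a-1) div 2) + 3)
     + of_bool (even (a - d)) - 2 * of_bool (even a \<and> even d)) = (\<Sum>(a,d) \<in> divpairs n. even_sign a d * (3 * a + d))"
  proof (rule sum.cong[OF refl], clarify)
    \<comment> \<open>Since \<open>a div 2 + (a-1) div 2 = a-1\<close>, only
      \<open>(a+d-1) div 2\<close> depends on parity; the two \<open>of_bool\<close> terms
      compensate exactly for that.\<close>
    fix a d :: int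
    show "even_sign a d * (2 * ((a+d-1) div 2) + 2 * (a div 2) + 2 * ((a-1) div 2) + 3)
     + of_bool (even (a - d)) - 2 * of_bool (even a \<and> even d) = even_sign a d * (3 * a + d)"
      by (cases "even a"; cases "even d"; simp add: even_sign_def; presburger)
  qed
  also have "\<dots> = 3 * (\<Sum>(a,d) \<in> divpairs n. even_sign a d * a) + (\<Sum>(a,d) \<in> divpairs n. even_sign a d * d)"
    by (simp add: case_prod_unfold sum.distrib sum_distrib_left algebra_simps)
  also have "(\<Sum>(a,d) \<in> divpairs n. even_sign a d * d) = (\<Sum>(a,d) \<in> divpairs n. even_sign a d * a)"
    by (rule sum.reindex_bij_witness[where i="\<lambda>(a,d). (d,a)" and j="\<lambda>(a,d). (d,a)"]) (auto simp: divpairs_def even_sign_def algebra_simps)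
  finally show ?thesis by simp
qed

section \<open>Four squares\<close>

text \<open>\<open>even_sign d e\<close> expressed through the coordinates \<open>x\<close> and
  \<open>z\<close> of either substitution below. It is invariant under sign changes of
  \<open>x\<close> and \<open>z\<close>.\<close>

definition mod4_sign :: "int \<Rightarrow> int \<Rightarrow> int" where
  "mod4_sign x z = (if even x \<and> even z \<and> 4 dvd (x - z) then -1 else 1)"

lemma mod4_sign_uminus: "mod4_sign (-x) z = mod4_sign x z" "mod4_sign x (-z) = mod4_sign x z"
  unfolding mod4_sign_def by presburger+

text \<open>The substitutions \<open>(x, y, z) = (e - 2s, s + d, 2s + 2d - e)\<close> and \<open>(x, y, z) = (d + e, s, d - e)\<close> map the solutions of
\<open>s^2 + d e = n\<close> to two different regions of one quadric; comparing the regions only uses sign changes of \<open>x\<close>, \<open>y\<close>, \<open>z\<close>.\<close>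

definition liouville_set :: "int \<Rightarrow> (int \<Rightarrow> int \<Rightarrow> int \<Rightarrow> bool) \<Rightarrow> (int \<times> int \<times> int) set" where
  "liouville_set n P = {(x,y,z). even (x - z) \<and> 4*y^2 + x^2 - z^2 = 4*n \<and> P x y z}"

text \<open>The weight is odd in each variable, so a region stable under a single sign change
  contributes 0.\<close>

definition liouville_sum :: "int \<Rightarrow> (int \<Rightarrow> int \<Rightarrow> int \<Rightarrow> bool) \<Rightarrow> int" where
  "liouville_sum n P = (\<Sum>(x,y,z) \<in> liouville_set n P. mod4_sign x z * (x * y * z))"

lemma liouville_sum_disj:
  assumes "finite (liouville_set n P)" "finite (liouville_set n Q)" "\<And>x y z. \<not> (P x y z \<and> Q x y z)"
  shows "liouville_sum n (\<lambda>x y z. P x y z \<or> Q x y z) = liouville_sum n P + liouville_sum n Q"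
proof -
  have *: "liouville_set n (\<lambda>x y z. P x y z \<or> Q x y z) = liouville_set n P \<union> liouville_set n Q"
    by (auto simp: liouville_set_def)
  show ?thesis unfolding liouville_sum_def *
    by (rule sum.union_disjoint) (use assms in \<open>auto simp: liouville_set_def\<close>)
qed

lemma liouville_sum_cong:
  "(\<And>x y z. P x y z \<longleftrightarrow> Q x y z) \<Longrightarrow> liouville_sum n P = liouville_sum n Q"
  unfolding liouville_sum_def liouville_set_def by (intro sum.cong) auto

lemma liouville_sum_uminus_x:
  "liouville_sum n P = - liouville_sum n (\<lambda>x y z. P (-x) y z)"
  unfolding liouville_sum_def sum_negf[symmetric]
  by (rule sum.reindex_bij_witness[where i="\<lambda>(x,y,z). (-x,y,z)" and j="\<lambda>(x,y,z). (-x,y,z)"])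
     (auto simp: liouville_set_def mod4_sign_uminus)

lemma liouville_sum_uminus_y:
  "liouville_sum n P = - liouville_sum n (\<lambda>x y z. P x (-y) z)"
  unfolding liouville_sum_def sum_negf[symmetric]
  by (rule sum.reindex_bij_witness[where i="\<lambda>(x,y,z). (x,-y,z)" and j="\<lambda>(x,y,z). (x,-y,z)"])
     (auto simp: liouville_set_def)

lemma liouville_sum_uminus_yz:
  "liouville_sum n P = liouville_sum n (\<lambda>x y z. P x (-y) (-z))"
  unfolding liouville_sum_def
  by (rule sum.reindex_bij_witness[where i="\<lambda>(x,y,z). (x,-y,-z)" and j="\<lambda>(x,y,z). (x,-y,-z)"])
     (auto simp: liouville_set_def mod4_sign_uminus)

definition square_plus_prod :: "int \<Rightarrow> (int \<times> int \<times> int) set" where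
  "square_plus_prod n = {(s,d,e). d > 0 \<and> e > 0 \<and> s^2 + d * e = n}"

lemma finite_square_plus_prod: "finite (square_plus_prod n)"
proof (rule finite_subset)
  show "square_plus_prod n \<subseteq> {-n..n} \<times> {1..n} \<times> {1..n}"
  proof
    fix x assume "x \<in> square_plus_prod n"
    then obtain s d e where x: "x = (s,d,e)" and de: "d > 0" "e > 0" and e1: "s^2 + d * e = n" by (auto simp: square_plus_prod_def)
    have "\<bar>s\<bar> \<le> n" using abs_le_square_int[of s] mult_pos_pos[OF de] e1 by linarith
    then show "x \<in> {-n..n} \<times> {1..n} \<times> {1..n}"
      using pos_mult_bound[of d e "s^2" n] de e1 unfolding x by auto
  qed
qed simp

text \<open>In these coordinates \<open>x+z = 2*d\<close> and \<open>2*y-z = e\<close>, so the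
  region says that \<open>d\<close> and \<open>e\<close> are positive.\<close>

lemma liouville_L_bij:
  "bij_betw (\<lambda>(s,d,e). (e - 2*s, s + d, 2*s + 2*d - e)) (square_plus_prod n) (liouville_set n (\<lambda>x y z. x + z > 0 \<and> 2*y > z))"
proof -
  have "t \<in> (\<lambda>(s,d,e). (e - 2*s, s + d, 2*s + 2*d - e)) ` square_plus_prod n"
    if t: "t \<in> liouville_set n (\<lambda>x y z. x + z > 0 \<and> 2*y > z)" for t
  proof -
    obtain x y z where xyz: "t = (x,y,z)" "even (x - z)" "4*y^2 + x^2 - z^2 = 4*n" "x + z > 0" "2*y > z"
      using t by (auto simp: liouville_set_def)
    then obtain k where "x - z = 2 * k" by blast
    then have x: "x = z + 2 * k" by simp
    have "(y - z - k, z + k, 2*y - z) \<in> square_plus_prod n"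
      using xyz(3-5) unfolding x square_plus_prod_def by (auto simp: algebra_simps power2_eq_square)
    then show ?thesis using xyz(1) x by force
  qed
  then show ?thesis
    unfolding bij_betw_def by (auto simp: inj_on_def square_plus_prod_def liouville_set_def algebra_simps power2_eq_square)
qed

lemma finite_liouville_L: "finite (liouville_set n (\<lambda>x y z. x + z > 0 \<and> 2*y > z))"
  using bij_betw_finite[OF liouville_L_bij] finite_square_plus_prod by blast

lemma finite_liouville_R: "finite (liouville_set n (\<lambda>x y z. x > \<bar>z\<bar>))"
proof (rule finite_surj[OF finite_square_plus_prod[of n]])
  show "liouville_set n (\<lambda>x y z. x > \<bar>z\<bar>) \<subseteq> (\<lambda>(s,d,e). (d + e, s, d - e)) ` square_plus_prod n"
  proof
    fix t assume "t \<in> liouville_set n (\<lambda>x y z. x > \<bar>z\<bar>)"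
    then obtain x y z where xyz: "t = (x,y,z)" "even (x - z)" "4*y^2 + x^2 - z^2 = 4*n" "x > \<bar>z\<bar>"
      by (auto simp: liouville_set_def)
    then obtain k where "x - z = 2 * k" by blast
    then have x: "x = z + 2 * k" by simp
    have "(y, z + k, k) \<in> square_plus_prod n"
      using xyz(3-4) unfolding x square_plus_prod_def by (auto simp: algebra_simps power2_eq_square)
    then show "t \<in> (\<lambda>(s,d,e). (d + e, s, d - e)) ` square_plus_prod n" using xyz(1) x by force
  qed
qed

text \<open>The regions \<open>x+z > 0\<close>, \<open>2*y > z\<close> and
  \<open>x > \<bar>z\<bar>\<close> share the part \<open>x > \<bar>z\<bar>\<close>,
  \<open>2*y > z\<close>. The rest of the first is the boundary \<open>x = z\<close> and the part
  \<open>\<bar>x\<bar> < z\<close>, which vanishes under \<open>x\<close> to \<open>-x\<close>. The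
  second has total 0 under \<open>y\<close> to \<open>-y\<close>, and negating both \<open>y\<close>
  and \<open>z\<close> exchanges its halves on either side of \<open>2*y = z\<close>.\<close>

lemma liouville_identity:
  "2 * liouville_sum n (\<lambda>x y z. x + z > 0 \<and> 2*y > z)
   = 2 * liouville_sum n (\<lambda>x y z. x = z \<and> z > 0 \<and> 2*y > z) - liouville_sum n (\<lambda>x y z. x > \<bar>z\<bar> \<and> 2*y = z)"
proof -
  have fL: "finite (liouville_set n P)" if "\<And>x y z. P x y z \<Longrightarrow> x + z > 0 \<and> 2*y > z" for P
    by (rule finite_subset[OF _ finite_liouville_L[of n]]) (use that in \<open>auto simp: liouville_set_def\<close>)
  have fR: "finite (liouville_set n P)" if "\<And>x y z. P x y z \<Longrightarrow> x > \<bar>z\<bar>" for P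
    by (rule finite_subset[OF _ finite_liouville_R[of n]]) (use that in \<open>auto simp: liouville_set_def\<close>)
  have "liouville_sum n (\<lambda>x y z. x + z > 0 \<and> 2*y > z) = liouville_sum n (\<lambda>x y z. (x > \<bar>z\<bar> \<and> 2*y > z \<or> x = z \<and> z > 0 \<and> 2*y > z) \<or> \<bar>x\<bar> < z \<and> 2*y > z)"
    by (rule liouville_sum_cong) auto
  also have "\<dots> = liouville_sum n (\<lambda>x y z. x > \<bar>z\<bar> \<and> 2*y > z \<or> x = z \<and> z > 0 \<and> 2*y > z) + liouville_sum n (\<lambda>x y z. \<bar>x\<bar> < z \<and> 2*y > z)"
    by (rule liouville_sum_disj; (rule fL)?) auto
  also have "liouville_sum n (\<lambda>x y z. x > \<bar>z\<bar> \<and> 2*y > z \<or> x = z \<and> z > 0 \<and> 2*y > z) = liouville_sum n (\<lambda>x y z. x > \<bar>z\<bar> \<and> 2*y > z) + liouville_sum n (\<lambda>x y z. x = z \<and> z > 0 \<and> 2*y > z)"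
    by (rule liouville_sum_disj; (rule fL)?) auto
  also have "liouville_sum n (\<lambda>x y z. \<bar>x\<bar> < z \<and> 2*y > z) = 0"
    using liouville_sum_uminus_x[of n "\<lambda>x y z. \<bar>x\<bar> < z \<and> 2*y > z"] by simp
  finally have L: "liouville_sum n (\<lambda>x y z. x + z > 0 \<and> 2*y > z) = liouville_sum n (\<lambda>x y z. x > \<bar>z\<bar> \<and> 2*y > z) + liouville_sum n (\<lambda>x y z. x = z \<and> z > 0 \<and> 2*y > z)"
    by simp
  have "liouville_sum n (\<lambda>x y z. x > \<bar>z\<bar>) = liouville_sum n (\<lambda>x y z. (x > \<bar>z\<bar> \<and> 2*y > z \<or> x > \<bar>z\<bar> \<and> 2*y < z) \<or> x > \<bar>z\<bar> \<and> 2*y = z)"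
    by (rule liouville_sum_cong) auto
  also have "\<dots> = liouville_sum n (\<lambda>x y z. x > \<bar>z\<bar> \<and> 2*y > z \<or> x > \<bar>z\<bar> \<and> 2*y < z) + liouville_sum n (\<lambda>x y z. x > \<bar>z\<bar> \<and> 2*y = z)"
    by (rule liouville_sum_disj; (rule fR)?) auto
  also have "liouville_sum n (\<lambda>x y z. x > \<bar>z\<bar> \<and> 2*y > z \<or> x > \<bar>z\<bar> \<and> 2*y < z) = liouville_sum n (\<lambda>x y z. x > \<bar>z\<bar> \<and> 2*y > z) + liouville_sum n (\<lambda>x y z. x > \<bar>z\<bar> \<and> 2*y < z)"
    by (rule liouville_sum_disj; (rule fR)?) auto
  also have "liouville_sum n (\<lambda>x y z. x > \<bar>z\<bar> \<and> 2*y < z) = liouville_sum n (\<lambda>x y z. x > \<bar>z\<bar> \<and> 2*y > z)"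
    using liouville_sum_uminus_yz[of n "\<lambda>x y z. x > \<bar>z\<bar> \<and> 2*y < z"] by simp
  also have "liouville_sum n (\<lambda>x y z. x > \<bar>z\<bar>) = 0"
    using liouville_sum_uminus_y[of n "\<lambda>x y z. x > \<bar>z\<bar>"] by simp
  finally show ?thesis using L by simp
qed

lemma alternating_squares:
  "(\<Sum>x\<in>{0<..<2 * int k}. if even x then - (x^2) else x^2) = int k * (2 * int k - 1)"
proof (induction k)
  case (Suc k)
  show ?case
  proof (cases "k = 0")
    case True
    have "{0<..<2 * int (Suc 0)} = {1}" by auto
    then show ?thesis using True by simp
  next
    case False
    then have "{0<..<2 * int (Suc k)} = insert (2 * int k + 1) (insert (2 * int k) {0<..<2 * int k})" by auto
    then show ?thesis using Suc by (simp add: algebra_simps power2_eq_square)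
  qed
qed simp

lemma alternating_squares_symmetric:
  "(\<Sum>y\<in>{-int k<..<int k}. if even (int k - y) then - (y^2) else y^2) = int k * (int k - 1)"
proof (induction k)
  case (Suc k)
  have "(\<Sum>y\<in>{-int k<..<int k}. if even (int (Suc k) - y) then - (y^2) else y^2) =
    (\<Sum>y\<in>{-int k<..<int k}. - (if even (int k - y) then - (y^2) else y^2))"
    by (rule sum.cong) auto
  also have "\<dots> = - (int k * (int k - 1))" using Suc by (simp only: sum_negf)
  finally have IH: "(\<Sum>y\<in>{-int k<..<int k}. if even (int (Suc k) - y) then - (y^2) else y^2) = - (int k * (int k - 1))" .
  show ?case
  proof (cases "k = 0")
    case True
    have "{-int (Suc 0)<..<int (Suc 0)} = {0}" by auto
    then show ?thesis using True by simp
  next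
    case False
    then have "{-int (Suc k)<..<int (Suc k)} = insert (-int k) (insert (int k) {-int k<..<int k})" by auto
    then show ?thesis using IH False by (simp add: algebra_simps power2_eq_square)
  qed
qed simp

text \<open>On \<open>x = z\<close> the equation is \<open>y^2 = n\<close>, on
  \<open>2*y = z\<close> it is \<open>x^2 = 4*n\<close>; either forces \<open>n = k^2\<close>. The
  remaining alternating sums give \<open>k^2*(2*k-1)\<close> and \<open>4*k^2*(k-1)\<close>, and
  twice the first minus the second is \<open>2*k^2\<close>.\<close>

lemma liouville_boundary:
  assumes "n > 0"
  shows "2 * liouville_sum n (\<lambda>x y z. x = z \<and> z > 0 \<and> 2*y > z) - liouville_sum n (\<lambda>x y z. x > \<bar>z\<bar> \<and> 2*y = z)
    = 2 * n * of_bool (\<exists>l. n = l^2)"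
proof (cases "\<exists>l. n = l^2")
  case False
  have "liouville_set n (\<lambda>x y z. x = z \<and> z > 0 \<and> 2*y > z) = {}"
    using False by (auto simp: liouville_set_def)
  moreover have "liouville_set n (\<lambda>x y z. x > \<bar>z\<bar> \<and> 2*y = z) = {}"
  proof -
    have "n = (x div 2)^2" if "even (x - 2*y)" "4*y^2 + x^2 - (2*y)^2 = 4*n" for x y
      using that by (auto elim!: evenE simp: power2_eq_square)
    then show ?thesis using False by (fastforce simp: liouville_set_def)
  qed
  ultimately show ?thesis using False by (simp add: liouville_sum_def)
next
  case True
  then obtain l where "n = l^2" by blast
  then have l: "n = (int (nat \<bar>l\<bar>))^2" by simp
  define k where "k = nat \<bar>l\<bar>"
  have n: "n = (int k)^2" using l unfolding k_def[symmetric] .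
  then have k: "k > 0" using assms by (cases k) auto
  have "liouville_sum n (\<lambda>x y z. x = z \<and> z > 0 \<and> 2*y > z) = (\<Sum>x\<in>{0<..<2 * int k}. int k * (if even x then - (x^2) else x^2))"
    unfolding liouville_sum_def
    by (rule sum.reindex_bij_witness[where i="\<lambda>x. (x, int k, x)" and j="\<lambda>(x,y,z). x"])
       (auto simp: liouville_set_def n mod4_sign_def power2_eq_iff algebra_simps, auto simp: power2_eq_square)
  also have "\<dots> = int k * (int k * (2 * int k - 1))"
    unfolding sum_distrib_left[symmetric] alternating_squares ..
  finally have T1: "liouville_sum n (\<lambda>x y z. x = z \<and> z > 0 \<and> 2*y > z) = int k * (int k * (2 * int k - 1))" .
  have xk: "x = 2 * int k" if "x^2 = 4 * n" "x > 0" for x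
  proof -
    have "x^2 = (2 * int k)^2" using that n by (simp add: power_mult_distrib)
    then show ?thesis by (rule power2_eq_imp_eq) (use that(2) in auto)
  qed
  have q4: "mod4_sign (2 * int k) (2 * y) = (if even (int k - y) then -1 else 1)" for y
    unfolding mod4_sign_def by presburger
  have "liouville_sum n (\<lambda>x y z. x > \<bar>z\<bar> \<and> 2*y = z) = (\<Sum>y\<in>{-int k<..<int k}. 4 * int k * (if even (int k - y) then - (y^2) else y^2))"
    unfolding liouville_sum_def
  proof (rule sum.reindex_bij_witness[where i="\<lambda>y. (2 * int k, y, 2 * y)" and j="\<lambda>(x,y,z). y"])
    fix t assume "t \<in> liouville_set n (\<lambda>x y z. x > \<bar>z\<bar> \<and> 2*y = z)"
    then obtain x y where t: "t = (x,y,2*y)" "x^2 = 4*n" "x > \<bar>2*y\<bar>" by (auto simp: liouville_set_def power_mult_distrib)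
    then have x: "x = 2 * int k" using xk[of x] by linarith
    show "(2 * int k, case t of (x,y,z) \<Rightarrow> y, 2 * (case t of (x,y,z) \<Rightarrow> y)) = t" using t x by simp
    show "(case t of (x,y,z) \<Rightarrow> y) \<in> {-int k<..<int k}" using t x by auto
    show "4 * int k * (if even (int k - (case t of (x,y,z) \<Rightarrow> y)) then - ((case t of (x,y,z) \<Rightarrow> y)^2) else (case t of (x,y,z) \<Rightarrow> y)^2) =
      (case t of (x,y,z) \<Rightarrow> mod4_sign x z * (x * y * z))"
      unfolding t x prod.case q4 by (simp add: power2_eq_square)
  next
    fix y assume "y \<in> {-int k<..<int k}"
    then show "(2 * int k, y, 2 * y) \<in> liouville_set n (\<lambda>x y z. x > \<bar>z\<bar> \<and> 2*y = z)"
      by (auto simp: liouville_set_def n power_mult_distrib)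
  qed auto
  also have "\<dots> = 4 * int k * (int k * (int k - 1))"
    unfolding sum_distrib_left[symmetric] alternating_squares_symmetric ..
  finally have T2: "liouville_sum n (\<lambda>x y z. x > \<bar>z\<bar> \<and> 2*y = z) = 4 * int k * (int k * (int k - 1))" .
  show ?thesis using True unfolding T1 T2 by (simp add: n algebra_simps power2_eq_square)
qed

text \<open>Averaging the cubic weight over \<open>s\<close> and \<open>-s\<close>, then exchanging
  \<open>d\<close> and \<open>e\<close>, turns it into \<open>d*(d*e - 4*s^2)\<close>, which is
  \<open>d*(n - 5*s^2)\<close> on the solution set.\<close>

lemma square_plus_prod_sum:
  assumes "n > 0"
  shows "(\<Sum>(s,d,e) \<in> square_plus_prod n. even_sign d e * d * (n - 5 * s^2)) = n * of_bool (\<exists>l. n = l^2)"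
proof -
  let ?S = "\<lambda>f. \<Sum>(s,d,e) \<in> square_plus_prod n. even_sign d e * (f s d e :: int)"
  have lin: "?S (\<lambda>s d e. f s d e + g s d e) = ?S f + ?S g" "?S (\<lambda>s d e. c * f s d e) = c * ?S f" for f g c
    by (simp_all add: case_prod_unfold sum.distrib sum_distrib_left algebra_simps)
  have flip: "?S f = ?S (\<lambda>s d e. f (-s) d e)" and swap: "?S f = ?S (\<lambda>s d e. f s e d)" for f
    by (rule sum.reindex_bij_witness[where i="\<lambda>(s,d,e). (-s,d,e)" and j="\<lambda>(s,d,e). (-s,d,e)"]
        sum.reindex_bij_witness[where i="\<lambda>(s,d,e). (s,e,d)" and j="\<lambda>(s,d,e). (s,e,d)"];
        auto simp: square_plus_prod_def even_sign_def algebra_simps; fail)+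
  have q: "mod4_sign (e - 2*s) (2*s + 2*d - e) = even_sign d e" for s d e
    unfolding mod4_sign_def even_sign_def by presburger
  have "liouville_sum n (\<lambda>x y z. x + z > 0 \<and> 2*y > z) = ?S (\<lambda>s d e. (e - 2*s) * (s + d) * (2*s + 2*d - e))"
    unfolding liouville_sum_def
    by (subst sum.reindex_bij_betw[OF liouville_L_bij, symmetric]) (simp add: case_prod_unfold q)
  moreover have "2 * liouville_sum n (\<lambda>x y z. x + z > 0 \<and> 2*y > z) = 2 * n * of_bool (\<exists>l. n = l^2)"
    using liouville_identity liouville_boundary[OF assms] by simp
  ultimately have "n * of_bool (\<exists>l. n = l^2) = ?S (\<lambda>s d e. (e - 2*s) * (s + d) * (2*s + 2*d - e))" by simp
  moreover have "2 * ?S (\<lambda>s d e. (e - 2*s) * (s + d) * (2*s + 2*d - e)) =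
     ?S (\<lambda>s d e. (e - 2*s) * (s + d) * (2*s + 2*d - e) + (e + 2*s) * (d - s) * (2*d - 2*s - e))"
    unfolding lin using flip[of "\<lambda>s d e. (e - 2*s) * (s + d) * (2*s + 2*d - e)"] by simp
  moreover have "\<dots> = ?S (\<lambda>s d e. 8 * (e*s^2) + (4 * (d*d*e) + ((-2) * (d*e*e) + (-16) * (d*s^2))))"
    by (rule sum.cong[OF refl]) (auto simp: algebra_simps power2_eq_square)
  moreover have "\<dots> = 8 * ?S (\<lambda>s d e. e*s^2) + (4 * ?S (\<lambda>s d e. d*d*e) + ((-2) * ?S (\<lambda>s d e. d*e*e) + (-16) * ?S (\<lambda>s d e. d*s^2)))"
    by (simp only: lin)
  moreover have "?S (\<lambda>s d e. e*s^2) = ?S (\<lambda>s d e. d*s^2)" by (rule swap)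
  moreover have "?S (\<lambda>s d e. d*e*e) = ?S (\<lambda>s d e. d*d*e)" by (subst swap) (simp add: algebra_simps)
  ultimately have "n * of_bool (\<exists>l. n = l^2) = ?S (\<lambda>s d e. d*d*e) + (-4) * ?S (\<lambda>s d e. d*s^2)" by linarith
  also have "\<dots> = ?S (\<lambda>s d e. d*d*e + (-4) * (d*s^2))" by (simp only: lin)
  also have "\<dots> = (\<Sum>(s,d,e) \<in> square_plus_prod n. even_sign d e * d * (n - 5 * s^2))"
    by (rule sum.cong[OF refl]) (auto simp: square_plus_prod_def algebra_simps power2_eq_square)
  finally show ?thesis by simp
qed

section \<open>Three squares\<close>

definition r4 :: "int \<Rightarrow> int" where
  "r4 n = int (card {(a::int,b::int,c::int,d::int). a^2 + b^2 + c^2 + d^2 = n})"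

lemma square_le_imp_range: "a^2 \<le> n \<Longrightarrow> a \<in> {-n..n}" for a n :: int
  using abs_le_square_int[of a] by auto

lemma finite_r3: "finite {(x::int,y::int,z::int). x^2 + y^2 + z^2 = n}"
  by (rule finite_subset[of _ "{-n..n} \<times> {-n..n} \<times> {-n..n}"])
    (auto intro!: square_le_imp_range simp del: atLeastAtMost_iff)

lemma r3_0: "r3 0 = 1"
proof -
  have "{(x::int,y::int,z::int). x^2 + y^2 + z^2 = 0} = {(0,0,0)}"
    by (auto simp: sum_power2_eq_zero_iff add_nonneg_eq_0_iff)
  then show ?thesis by (simp add: r3_def)
qed

lemma r3_neg: "n < 0 \<Longrightarrow> r3 n = 0"
proof -
  assume "n < 0"
  have "x^2 + y^2 + z^2 \<noteq> n" for x y z :: int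
    using \<open>n < 0\<close> zero_le_power2[of x] zero_le_power2[of y] zero_le_power2[of z] by linarith
  then have "{(x,y,z). x^2 + y^2 + z^2 = n} = {}" by auto
  then show ?thesis unfolding r3_def by (simp only: card.empty)
qed

lemma r4_eq: "r4 n = (\<Sum>s\<in>{-n..n}. int (r3 (n - s^2)))"
proof -
  have "{(a::int,b::int,c::int,d::int). a^2 + b^2 + c^2 + d^2 = n} =
     Sigma {-n..n} (\<lambda>s. {(x,y,z). x^2 + y^2 + z^2 = n - s^2})"
    by (auto intro!: square_le_imp_range simp del: atLeastAtMost_iff)
  then show ?thesis unfolding r4_def r3_def by (simp add: finite_r3)
qed

lemma finite_r4: "finite {(a::int,b::int,c::int,d::int). a^2 + b^2 + c^2 + d^2 = n}"
  by (rule finite_subset[of _ "{-n..n} \<times> {-n..n} \<times> {-n..n} \<times> {-n..n}"])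
    (auto intro!: square_le_imp_range simp del: atLeastAtMost_iff)

lemma r4_0: "r4 0 = 1"
  using r3_0 by (simp add: r4_eq)

lemma r4_neg: "n < 0 \<Longrightarrow> r4 n = 0"
  by (simp add: r4_eq)

text \<open>Over all representations of \<open>n\<close> by five squares, each square has the same
  average \<open>n/5\<close>.\<close>

lemma r4_recursion: "(\<Sum>s\<in>{-n..n}. (n - 5 * s^2) * r4 (n - s^2)) = 0"
proof -
  let ?Q = "{(v::int,a::int,b::int,c::int,d::int). v^2 + a^2 + b^2 + c^2 + d^2 = n}"
  let ?T = "\<lambda>f. \<Sum>(v,a,b,c,d) \<in> ?Q. (f v a b c d :: int)"
  have Q: "?Q = Sigma {-n..n} (\<lambda>s. {(a,b,c,d). a^2 + b^2 + c^2 + d^2 = n - s^2})"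
    by (auto intro!: square_le_imp_range simp del: atLeastAtMost_iff)
  have a: "?T (\<lambda>v a b c d. a^2) = ?T (\<lambda>v a b c d. v^2)" and b: "?T (\<lambda>v a b c d. b^2) = ?T (\<lambda>v a b c d. v^2)"
    and c: "?T (\<lambda>v a b c d. c^2) = ?T (\<lambda>v a b c d. v^2)" and d: "?T (\<lambda>v a b c d. d^2) = ?T (\<lambda>v a b c d. v^2)"
    by (rule sum.reindex_bij_witness[where i="\<lambda>(v,a,b,c,d). (a,v,b,c,d)" and j="\<lambda>(v,a,b,c,d). (a,v,b,c,d)"]
        sum.reindex_bij_witness[where i="\<lambda>(v,a,b,c,d). (b,a,v,c,d)" and j="\<lambda>(v,a,b,c,d). (b,a,v,c,d)"]
        sum.reindex_bij_witness[where i="\<lambda>(v,a,b,c,d). (c,a,b,v,d)" and j="\<lambda>(v,a,b,c,d). (c,a,b,v,d)"]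
        sum.reindex_bij_witness[where i="\<lambda>(v,a,b,c,d). (d,a,b,c,v)" and j="\<lambda>(v,a,b,c,d). (d,a,b,c,v)"];
        auto; fail)+
  have "?T (\<lambda>v a b c d. n - 5 * v^2) = ?T (\<lambda>v a b c d. v^2 + a^2 + b^2 + c^2 + d^2) - 5 * ?T (\<lambda>v a b c d. v^2)"
    unfolding sum_distrib_left sum_subtractf[symmetric] by (rule sum.cong) auto
  also have "?T (\<lambda>v a b c d. v^2 + a^2 + b^2 + c^2 + d^2) = ?T (\<lambda>v a b c d. v^2) + ?T (\<lambda>v a b c d. a^2) + ?T (\<lambda>v a b c d. b^2) + ?T (\<lambda>v a b c d. c^2) + ?T (\<lambda>v a b c d. d^2)"
    by (simp only: case_prod_unfold sum.distrib)
  finally have 1: "?T (\<lambda>v a b c d. n - 5 * v^2) = 0" using a b c d by linarith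
  have "?T (\<lambda>v a b c d. n - 5 * v^2) = (\<Sum>s\<in>{-n..n}. \<Sum>x\<in>{(a,b,c,d). a^2 + b^2 + c^2 + d^2 = n - s^2}. n - 5 * s^2)"
    unfolding Q by (subst sum.Sigma, simp, use finite_r4 in blast) (simp add: case_prod_unfold)
  also have "\<dots> = (\<Sum>s\<in>{-n..n}. (n - 5 * s^2) * r4 (n - s^2))"
    by (simp add: r4_def algebra_simps)
  finally show ?thesis using 1 by simp
qed

lemma sum_square_split:
  fixes R g :: "int \<Rightarrow> int"
  assumes "\<And>m. m < 0 \<Longrightarrow> R m = 0" "R 0 = 1" "n > 0"
  shows "(\<Sum>s\<in>{-n..n}. g s * R (n - s^2)) = (\<Sum>s | s \<in> {-n..n} \<and> s^2 < n. g s * R (n - s^2)) + (\<Sum>s | s^2 = n. g s)"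
proof -
  let ?A = "{s. s \<in> {-n..n} \<and> s^2 < n}" and ?B = "{s. s^2 = n}"
  have B: "?B \<subseteq> {-n..n}" by (auto intro!: square_le_imp_range simp del: atLeastAtMost_iff)
  have "(\<Sum>s\<in>{-n..n}. g s * R (n - s^2)) = (\<Sum>s\<in>?A \<union> ?B. g s * R (n - s^2))"
  proof (rule sum.mono_neutral_right)
    show "\<forall>s\<in>{-n..n} - (?A \<union> ?B). g s * R (n - s^2) = 0"
    proof
      fix s assume "s \<in> {-n..n} - (?A \<union> ?B)"
      then have "n - s^2 < 0" by auto
      then show "g s * R (n - s^2) = 0" using assms(1) by simp
    qed
  qed (use B in auto)
  also have "\<dots> = (\<Sum>s\<in>?A. g s * R (n - s^2)) + (\<Sum>s\<in>?B. g s * R (n - s^2))"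
    by (rule sum.union_disjoint) (use finite_subset[OF B] in \<open>auto intro: finite_subset[of _ "{-n..n}"]\<close>)
  also have "(\<Sum>s\<in>?B. g s * R (n - s^2)) = (\<Sum>s | s^2 = n. g s)"
    by (rule sum.cong) (auto simp: assms(2))
  finally show ?thesis .
qed

lemma sum_square_roots:
  fixes g :: "int \<Rightarrow> int"
  assumes "n > 0" "\<And>s. s^2 = n \<Longrightarrow> g s = c"
  shows "(\<Sum>s | s^2 = n. g s) = 2 * c * of_bool (\<exists>l. n = l^2)"
proof (cases "\<exists>l. n = l^2")
  case True
  then obtain l where l: "n = l^2" by blast
  have "{s. s^2 = n} = {l, -l}" using l by (auto simp: power2_eq_iff)
  moreover have "l \<noteq> 0" using l assms(1) by auto
  ultimately show ?thesis using True assms(2)[of l] assms(2)[of "-l"] l by simp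
next
  case False
  then have "{s. s^2 = n} = {}" by auto
  then show ?thesis using False by simp
qed

text \<open>Equals the sum of the divisors of \<open>n\<close> that are not divisible by 4, as \<open>even_sign\<close> subtracts twice the pairs with both
entries even.\<close>

definition divsum_not4 :: "int \<Rightarrow> int" where
  "divsum_not4 n = (\<Sum>(a,d) \<in> divpairs n. even_sign a d * a)"

lemma sum_square_plus_prod_divpairs:
  assumes "n > 0"
  shows "(\<Sum>(s,d,e) \<in> square_plus_prod n. even_sign d e * d * g s) = (\<Sum>s | s \<in> {-n..n} \<and> s^2 < n. g s * divsum_not4 (n - s^2))"
proof -
  have eq: "square_plus_prod n = Sigma {s. s \<in> {-n..n} \<and> s^2 < n} (\<lambda>s. divpairs (n - s^2))"
  proof -
    have "s \<in> {-n..n} \<and> s^2 < n" if "d > 0" "e > 0" "n = s^2 + d * e" for s d e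
      using mult_pos_pos[OF that(1,2)] that(3) square_le_imp_range[of s n] by simp
    then show ?thesis by (auto simp: square_plus_prod_def divpairs_def simp del: atLeastAtMost_iff)
  qed
  have "(\<Sum>(s,d,e) \<in> square_plus_prod n. even_sign d e * d * g s) = (\<Sum>s | s \<in> {-n..n} \<and> s^2 < n. \<Sum>(d,e) \<in> divpairs (n - s^2). even_sign d e * d * g s)"
    unfolding eq by (subst sum.Sigma) (auto simp: finite_divpairs case_prod_unfold intro: finite_subset[of _ "{-n..n}"])
  also have "\<dots> = (\<Sum>s | s \<in> {-n..n} \<and> s^2 < n. g s * divsum_not4 (n - s^2))"
    by (simp add: divsum_not4_def sum_distrib_left case_prod_unfold algebra_simps)
  finally show ?thesis .
qed

lemma square_less_split:
  assumes "n > (0::int)"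
  shows "{s. s \<in> {-n..n} \<and> s^2 < n} = insert 0 {s. s \<in> {-n..n} \<and> s^2 < n \<and> s \<noteq> 0}"
  using assms by auto

text \<open>The term \<open>s = 0\<close> of the recursion is \<open>n * r4 n\<close>, so smaller
  values determine \<open>r4 n\<close>. For square \<open>n\<close> the two roots of
  \<open>s^2 = n\<close> contribute \<open>-8*n\<close>, which matches 8 times the right-hand side
  of \<open>square_plus_prod_sum\<close>.\<close>

theorem jacobi_four_squares: "n > 0 \<Longrightarrow> r4 n = 8 * divsum_not4 n"
proof (induction "nat n" arbitrary: n rule: less_induct)
  case less
  let ?S = "{s. s \<in> {-n..n} \<and> s^2 < n \<and> s \<noteq> 0}"
  have fin: "finite ?S" by (rule finite_subset[of _ "{-n..n}"]) auto
  have IH: "r4 (n - s^2) = 8 * divsum_not4 (n - s^2)" if "s \<in> ?S" for s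
    using that less.prems by (intro less.hyps) auto
  have "0 = (\<Sum>s | s \<in> {-n..n} \<and> s^2 < n. (n - 5 * s^2) * r4 (n - s^2)) + (\<Sum>s | s^2 = n. n - 5 * s^2)"
    using sum_square_split[of r4 n "\<lambda>s. n - 5 * s^2", OF r4_neg r4_0 less.prems] r4_recursion[of n] by simp
  also have "(\<Sum>s | s^2 = n. n - 5 * s^2) = 2 * (- 4 * n) * of_bool (\<exists>l. n = l^2)"
    by (rule sum_square_roots[OF less.prems]) simp
  also have "(\<Sum>s | s \<in> {-n..n} \<and> s^2 < n. (n - 5 * s^2) * r4 (n - s^2)) = n * r4 n + (\<Sum>s\<in>?S. (n - 5 * s^2) * r4 (n - s^2))"
    unfolding square_less_split[OF less.prems] using fin by simp
  also have "(\<Sum>s\<in>?S. (n - 5 * s^2) * r4 (n - s^2)) = (\<Sum>s\<in>?S. 8 * ((n - 5 * s^2) * divsum_not4 (n - s^2)))"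
    by (rule sum.cong) (auto simp: IH)
  also have "\<dots> = 8 * (\<Sum>s\<in>?S. (n - 5 * s^2) * divsum_not4 (n - s^2))"
    by (simp only: sum_distrib_left)
  finally have 1: "0 = n * r4 n + 8 * (\<Sum>s\<in>?S. (n - 5 * s^2) * divsum_not4 (n - s^2)) - 8 * n * of_bool (\<exists>l. n = l^2)" by simp
  have "n * of_bool (\<exists>l. n = l^2) = (\<Sum>s | s \<in> {-n..n} \<and> s^2 < n. (n - 5 * s^2) * divsum_not4 (n - s^2))"
    using square_plus_prod_sum[OF less.prems] sum_square_plus_prod_divpairs[OF less.prems, of "\<lambda>s. n - 5 * s^2"] by simp
  also have "\<dots> = n * divsum_not4 n + (\<Sum>s\<in>?S. (n - 5 * s^2) * divsum_not4 (n - s^2))"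
    unfolding square_less_split[OF less.prems] using fin by simp
  finally have "n * r4 n = n * (8 * divsum_not4 n)" using 1 by linarith
  then show ?case using less.prems by simp
qed

text \<open>Doubling \<open>kronecker_relation\<close> gives the recursion satisfied by
  \<open>r3\<close>. Its defect at squares becomes 2, the contribution of \<open>r3 0 = 1\<close> at
  the two roots of \<open>s^2 = n\<close>.\<close>

theorem gauss_three_squares: "n > 0 \<Longrightarrow> int (r3 n) = 2 * selling_sum n"
proof (induction "nat n" arbitrary: n rule: less_induct)
  case less
  let ?S = "{s. s \<in> {-n..n} \<and> s^2 < n \<and> s \<noteq> 0}"
  have fin: "finite ?S" by (rule finite_subset[of _ "{-n..n}"]) auto
  have IH: "int (r3 (n - s^2)) = 2 * selling_sum (n - s^2)" if "s \<in> ?S" for s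
    using that less.prems by (intro less.hyps) auto
  have "8 * divsum_not4 n = (\<Sum>s\<in>{-n..n}. int (r3 (n - s^2)))"
    using jacobi_four_squares[OF less.prems] r4_eq[of n] by simp
  also have "\<dots> = (\<Sum>s | s \<in> {-n..n} \<and> s^2 < n. int (r3 (n - s^2))) + (\<Sum>s | s^2 = n. 1)"
    using sum_square_split[of "\<lambda>m. int (r3 m)" n "\<lambda>_. 1"] r3_neg r3_0 less.prems by simp
  also have "(\<Sum>s | s^2 = n. 1) = 2 * 1 * (of_bool (\<exists>l. n = l^2) :: int)"
    by (rule sum_square_roots[OF less.prems]) simp
  also have "(\<Sum>s | s \<in> {-n..n} \<and> s^2 < n. int (r3 (n - s^2))) = int (r3 n) + (\<Sum>s\<in>?S. int (r3 (n - s^2)))"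
    unfolding square_less_split[OF less.prems] using fin by simp
  also have "(\<Sum>s\<in>?S. int (r3 (n - s^2))) = (\<Sum>s\<in>?S. 2 * selling_sum (n - s^2))"
    by (rule sum.cong) (auto simp: IH)
  finally have 1: "8 * divsum_not4 n = int (r3 n) + 2 * (\<Sum>s\<in>?S. selling_sum (n - s^2)) + 2 * of_bool (\<exists>l. n = l^2)"
    by (simp add: sum_distrib_left)
  have "4 * divsum_not4 n - of_bool (\<exists>l. n = l^2) = selling_sum n + (\<Sum>s\<in>?S. selling_sum (n - s^2))"
    using kronecker_relation[OF less.prems] fin unfolding divsum_not4_def square_less_split[OF less.prems] by simp
  then show ?case using 1 by linarith
qed

section \<open>Orbit sums\<close>

fun mmul :: "mat2 \<Rightarrow> mat2 \<Rightarrow> mat2" where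
  "mmul (a,b,c,d) (a',b',c',d') = (a*a' + b*c', a*b' + b*d', c*a' + d*c', c*b' + d*d')"

fun minv :: "mat2 \<Rightarrow> mat2" where
  "minv (a,b,c,d) = (d,-b,-c,a)"

lemma act_mmul: "act (act Q g) h = act Q (mmul g h)"
  by (cases Q; cases g; cases h) (simp add: act_def algebra_simps power2_eq_square)

lemma act_one [simp]: "act Q (1,0,0,1) = Q"
  by (cases Q) (simp add: act_def)

lemma mmul_assoc: "mmul (mmul g h) k = mmul g (mmul h k)"
  by (cases g; cases h; cases k) (simp add: algebra_simps)

lemma mmul_one [simp]: "mmul (1,0,0,1) g = g" "mmul g (1,0,0,1) = g"
  by (cases g; simp)+

lemma mmul_minv [simp]: "g \<in> Gamma0 N \<Longrightarrow> mmul g (minv g) = (1,0,0,1)" "g \<in> Gamma0 N \<Longrightarrow> mmul (minv g) g = (1,0,0,1)"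
  by (cases g; simp add: Gamma0_def algebra_simps)+

lemma Gamma0_one: "(1,0,0,1) \<in> Gamma0 N"
  by (simp add: Gamma0_def)

lemma Gamma0_minv: "g \<in> Gamma0 N \<Longrightarrow> minv g \<in> Gamma0 N"
  by (cases g) (simp add: Gamma0_def algebra_simps)

lemma Gamma0_mmul:
  assumes "g \<in> Gamma0 N" "h \<in> Gamma0 N"
  shows "mmul g h \<in> Gamma0 N"
proof -
  obtain a b c d a' b' c' d' where gh: "g = (a,b,c,d)" "h = (a',b',c',d')" by (cases g; cases h) auto
  have "(a*a' + b*c') * (c*b' + d*d') - (a*b' + b*d') * (c*a' + d*c') = (a*d - b*c) * (a'*d' - b'*c')"
    by (simp add: algebra_simps)
  then show ?thesis using assms unfolding gh by (auto simp: Gamma0_def)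
qed

lemma Gamma0_subset: "Gamma0 N \<subseteq> Gamma0 1"
  by (auto simp: Gamma0_def)

lemma act_minv: "g \<in> Gamma0 N \<Longrightarrow> act (act Q g) (minv g) = Q" "g \<in> Gamma0 N \<Longrightarrow> act (act Q (minv g)) g = Q"
  by (simp_all add: act_mmul)

lemma bij_mmul_right:
  assumes "h \<in> Gamma0 N" "\<And>g. g \<in> Gamma0 N \<Longrightarrow> P g \<longleftrightarrow> P' (mmul g h)"
  shows "bij_betw (\<lambda>g. mmul g h) {g \<in> Gamma0 N. P g} {g \<in> Gamma0 N. P' g}"
proof (rule bij_betw_byWitness[where f'="\<lambda>g. mmul g (minv h)"])
  show "\<forall>g\<in>{g \<in> Gamma0 N. P g}. mmul (mmul g h) (minv h) = g" "\<forall>g\<in>{g \<in> Gamma0 N. P' g}. mmul (mmul g (minv h)) h = g"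
    using assms(1) by (simp_all add: mmul_assoc)
  show "(\<lambda>g. mmul g h) ` {g \<in> Gamma0 N. P g} \<subseteq> {g \<in> Gamma0 N. P' g}"
    using assms Gamma0_mmul by blast
  show "(\<lambda>g. mmul g (minv h)) ` {g \<in> Gamma0 N. P' g} \<subseteq> {g \<in> Gamma0 N. P g}"
    by (rule image_subsetI) (use assms Gamma0_mmul Gamma0_minv in \<open>simp add: mmul_assoc\<close>)
qed

lemma bij_mmul_left:
  assumes "h \<in> Gamma0 N" "\<And>g. g \<in> Gamma0 N \<Longrightarrow> P g \<longleftrightarrow> P' (mmul h g)"
  shows "bij_betw (mmul h) {g \<in> Gamma0 N. P g} {g \<in> Gamma0 N. P' g}"
proof (rule bij_betw_byWitness[where f'="mmul (minv h)"])
  show "\<forall>g\<in>{g \<in> Gamma0 N. P g}. mmul (minv h) (mmul h g) = g" "\<forall>g\<in>{g \<in> Gamma0 N. P' g}. mmul h (mmul (minv h) g) = g"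
    using assms(1) by (simp_all add: mmul_assoc[symmetric])
  show "mmul h ` {g \<in> Gamma0 N. P g} \<subseteq> {g \<in> Gamma0 N. P' g}"
    using assms Gamma0_mmul by blast
  show "mmul (minv h) ` {g \<in> Gamma0 N. P' g} \<subseteq> {g \<in> Gamma0 N. P g}"
    by (rule image_subsetI) (use assms Gamma0_mmul Gamma0_minv in \<open>simp add: mmul_assoc[symmetric]\<close>)
qed

lemma orbit_self: "Q \<in> orbit N Q"
  unfolding orbit_def using Gamma0_one act_one by (metis imageI)

lemma orbit_eq: "R \<in> orbit N Q \<Longrightarrow> orbit N R = orbit N Q"
proof -
  have sub: "orbit N R \<subseteq> orbit N Q" if "R \<in> orbit N Q" for R Q
    using that Gamma0_mmul by (auto simp: orbit_def act_mmul)
  assume R: "R \<in> orbit N Q"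
  then obtain g where "g \<in> Gamma0 N" "R = act Q g" by (auto simp: orbit_def)
  then have "Q \<in> orbit N R" by (auto simp: orbit_def act_minv Gamma0_minv intro!: image_eqI[of _ _ "minv g"])
  with sub R show ?thesis by blast
qed

lemma card_transporter:
  assumes "R \<in> orbit N Q"
  shows "card {g \<in> Gamma0 N. act Q g = R} = card (stab N Q)"
proof -
  obtain h where h: "h \<in> Gamma0 N" "R = act Q h" using assms by (auto simp: orbit_def)
  have "bij_betw (\<lambda>g. mmul g h) {g \<in> Gamma0 N. act Q g = Q} {g \<in> Gamma0 N. act Q g = R}"
  proof (rule bij_mmul_right[OF h(1)])
    fix g
    show "act Q g = Q \<longleftrightarrow> act Q (mmul g h) = R"
      unfolding h(2) act_mmul[symmetric] using h(1) act_minv(1) by metis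
  qed
  then show ?thesis unfolding stab_def by (rule bij_betw_same_card[symmetric])
qed

text \<open>As \<open>g\<close> runs through the group, \<open>act Q g\<close> visits each form of
  the orbit as often as the stabilizer has elements, so \<open>c\<close> is the stabilizer order
  times the sum of \<open>f\<close> over the orbit. Any \<open>f\<close> with constant total
  \<open>c\<close> thus serves as a weighted fundamental domain. The restriction to \<open>f\<close>
  nonzero keeps sums over an infinite group finite.\<close>

lemma orbit_sum_unfold:
  fixes f :: "qform \<Rightarrow> int"
  assumes closed: "\<And>Q g. Q \<in> Y \<Longrightarrow> g \<in> Gamma0 N \<Longrightarrow> act Q g \<in> Y"
    and fin: "finite {Q \<in> Y. f Q \<noteq> 0}"
    and fin': "\<And>Q. Q \<in> Y \<Longrightarrow> finite {g \<in> Gamma0 N. f (act Q g) \<noteq> 0}"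
    and sum: "\<And>Q. Q \<in> Y \<Longrightarrow> (\<Sum>g | g \<in> Gamma0 N \<and> f (act Q g) \<noteq> 0. f (act Q g)) = c"
    and c: "c \<noteq> 0"
  shows "(\<Sum>Ob\<in>orbit N ` Y. 1 / real (card (stab N (SOME Q. Q \<in> Ob)))) = of_int (\<Sum>Q | Q \<in> Y \<and> f Q \<noteq> 0. f Q) / of_int c"
proof -
  let ?S = "{Q \<in> Y. f Q \<noteq> 0}"
  have ob: "of_int (\<Sum>Q | Q \<in> Ob \<and> f Q \<noteq> 0. f Q) = of_int c * (1 / real (card (stab N (SOME Q. Q \<in> Ob))))"
     "\<exists>Q \<in> ?S. orbit N Q = Ob"
    if Ob: "Ob \<in> orbit N ` Y" for Ob
  proof -
    define q where "q = (SOME Q. Q \<in> Ob)"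
    have "\<exists>Q. Q \<in> Ob" using Ob orbit_self by blast
    then have q: "q \<in> Ob" unfolding q_def by (rule someI_ex)
    then have Oq: "Ob = orbit N q" using Ob orbit_eq by blast
    have qY: "q \<in> Y" using q Ob closed by (auto simp: orbit_def)
    let ?G = "{g \<in> Gamma0 N. f (act q g) \<noteq> 0}"
    have img: "act q ` ?G = {Q \<in> Ob. f Q \<noteq> 0}" unfolding Oq orbit_def by auto
    have "c = (\<Sum>g\<in>?G. f (act q g))" using sum[OF qY] by simp
    also have "\<dots> = (\<Sum>Q\<in>act q ` ?G. \<Sum>g\<in>{g \<in> ?G. act q g = Q}. f (act q g))"
      by (rule sum.image_gen[OF fin'[OF qY]])
    also have "\<dots> = (\<Sum>Q\<in>{Q \<in> Ob. f Q \<noteq> 0}. int (card (stab N q)) * f Q)"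
      unfolding img
    proof (rule sum.cong[OF refl])
      fix Q assume Q: "Q \<in> {Q \<in> Ob. f Q \<noteq> 0}"
      then have "{g \<in> ?G. act q g = Q} = {g \<in> Gamma0 N. act q g = Q}" by auto
      then have "card {g \<in> ?G. act q g = Q} = card (stab N q)" using card_transporter Q Oq by auto
      then show "(\<Sum>g\<in>{g \<in> ?G. act q g = Q}. f (act q g)) = int (card (stab N q)) * f Q" by simp
    qed
    finally have e: "c = int (card (stab N q)) * (\<Sum>Q | Q \<in> Ob \<and> f Q \<noteq> 0. f Q)" by (simp add: sum_distrib_left)
    \<comment> \<open>An infinite stabilizer would have \<open>card\<close> 0 and force
      \<open>c = 0\<close>.\<close>
    then have "real (card (stab N q)) \<noteq> 0" using c by auto
    then show "of_int (\<Sum>Q | Q \<in> Ob \<and> f Q \<noteq> 0. f Q) = of_int c * (1 / real (card (stab N (SOME Q. Q \<in> Ob))))"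
      unfolding q_def[symmetric] e by (simp add: field_simps)
    \<comment> \<open>A nonzero total makes every orbit meet the finite support of
      \<open>f\<close>.\<close>
    have "(\<Sum>Q | Q \<in> Ob \<and> f Q \<noteq> 0. f Q) \<noteq> 0" using e c by auto
    then obtain R where "R \<in> Ob" "f R \<noteq> 0" by (metis (mono_tags, lifting) mem_Collect_eq sum.neutral)
    moreover have "R \<in> Y" if "R \<in> Ob" for R using that qY closed unfolding Oq orbit_def by blast
    ultimately show "\<exists>Q \<in> ?S. orbit N Q = Ob" using orbit_eq Oq by blast
  qed
  have img: "orbit N ` ?S = orbit N ` Y"
  proof
    show "orbit N ` Y \<subseteq> orbit N ` ?S"
    proof
      fix Ob assume "Ob \<in> orbit N ` Y"
      from ob(2)[OF this] obtain Q where "Q \<in> ?S" "orbit N Q = Ob" by (elim bexE)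
      then show "Ob \<in> orbit N ` ?S" by (intro image_eqI[of _ _ Q]) simp_all
    qed
  qed (intro image_mono Collect_restrict)
  have "(\<Sum>Q\<in>?S. f Q) = (\<Sum>Ob\<in>orbit N ` ?S. \<Sum>Q\<in>{Q \<in> ?S. orbit N Q = Ob}. f Q)"
    by (rule sum.image_gen[OF fin])
  also have "\<dots> = (\<Sum>Ob\<in>orbit N ` Y. \<Sum>Q | Q \<in> Ob \<and> f Q \<noteq> 0. f Q)"
    unfolding img
  proof (rule sum.cong[OF refl])
    fix Ob assume "Ob \<in> orbit N ` Y"
    then obtain Q0 where Q0: "Q0 \<in> Y" "Ob = orbit N Q0" by blast
    have "{Q \<in> ?S. orbit N Q = Ob} = {Q. Q \<in> Ob \<and> f Q \<noteq> 0}"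
    proof (intro set_eqI iffI)
      fix Q assume "Q \<in> {Q \<in> ?S. orbit N Q = Ob}"
      then show "Q \<in> {Q. Q \<in> Ob \<and> f Q \<noteq> 0}" using orbit_self[of Q N] by simp
    next
      fix Q assume Q: "Q \<in> {Q. Q \<in> Ob \<and> f Q \<noteq> 0}"
      then obtain g where "g \<in> Gamma0 N" "Q = act Q0 g" unfolding Q0 orbit_def by blast
      then have "Q \<in> Y" using closed Q0(1) by simp
      moreover have "orbit N Q = Ob" using Q orbit_eq unfolding Q0 by simp
      ultimately show "Q \<in> {Q \<in> ?S. orbit N Q = Ob}" using Q by simp
    qed
    then show "(\<Sum>Q\<in>{Q \<in> ?S. orbit N Q = Ob}. f Q) = (\<Sum>Q | Q \<in> Ob \<and> f Q \<noteq> 0. f Q)" by simp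
  qed
  finally have "of_int (\<Sum>Q | Q \<in> Y \<and> f Q \<noteq> 0. f Q) = (\<Sum>Ob\<in>orbit N ` Y. of_int c * (1 / real (card (stab N (SOME Q. Q \<in> Ob)))))"
    using ob(1) by (simp add: of_int_sum)
  also have "\<dots> = of_int c * (\<Sum>Ob\<in>orbit N ` Y. 1 / real (card (stab N (SOME Q. Q \<in> Ob))))"
    by (simp only: sum_distrib_left)
  finally show ?thesis using c by simp
qed

section \<open>Obtuse superbases\<close>

definition posdef :: "int \<Rightarrow> qform set" where
  "posdef D = {(a,b,c). a > 0 \<and> 4*a*c - b^2 = D}"

text \<open>The condition that the basis vectors v1, v2 and v0 = -v1-v2 have pairwise nonpositive
  inner products. \<open>2*a+b\<close>, \<open>2*c+b\<close> and \<open>-b\<close> are the Selling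
  parameters of twice the form; doubling avoids halves when \<open>b\<close> is odd.\<close>

definition chamber :: "qform set" where
  "chamber = {(a,b,c). 2*a + b \<ge> 0 \<and> 2*c + b \<ge> 0 \<and> b \<le> 0}"

definition chamber_int :: "qform set" where
  "chamber_int = {(a,b,c). 2*a + b > 0 \<and> 2*c + b > 0 \<and> b < 0}"

definition chamber_mult :: "qform \<Rightarrow> int" where
  "chamber_mult Q = of_bool (Q \<in> chamber) + of_bool (Q \<in> chamber_int)"

lemma chamber_int_subset: "chamber_int \<subseteq> chamber"
  by (auto simp: chamber_def chamber_int_def)

lemma chamber_mult_eq_0: "chamber_mult Q = 0 \<longleftrightarrow> Q \<notin> chamber"
  using chamber_int_subset by (auto simp: chamber_mult_def)

lemma chamber_mult_nonneg: "chamber_mult Q \<ge> 0"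
  by (simp add: chamber_mult_def)

lemma posdef_act:
  assumes "D > 0" "Q \<in> posdef D" "g \<in> Gamma0 N"
  shows "act Q g \<in> posdef D"
proof -
  obtain a b c where Q: "Q = (a,b,c)" by (cases Q)
  obtain p r q t where g: "g = (p,r,q,t)" by (cases g)
  have pos: "a > 0" and D: "4*a*c - b^2 = D" and det: "p*t - r*q = 1"
    using assms unfolding Q g by (auto simp: posdef_def Gamma0_def)
  have "4 * (a*p^2 + b*p*q + c*q^2) * (a*r^2 + b*r*t + c*t^2) - (2*a*p*r + b*(p*t + r*q) + 2*c*q*t)^2
      = (4*a*c - b^2) * (p*t - r*q)^2"
    by (simp add: algebra_simps power2_eq_square)
  moreover have "a*p^2 + b*p*q + c*q^2 > 0"
  proof -
    have e: "4 * a * (a*p^2 + b*p*q + c*q^2) = (2*a*p + b*q)^2 + D * q^2"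
      unfolding D[symmetric] by (simp add: algebra_simps power2_eq_square)
    have "(2*a*p + b*q)^2 + D * q^2 > 0"
    proof (cases "q = 0")
      case True
      then have "p \<noteq> 0" using det by auto
      then show ?thesis using True pos by simp
    next
      case False
      then show ?thesis using assms(1) by (intro add_nonneg_pos) auto
    qed
    then show ?thesis using e pos by (metis mult_pos_pos zero_less_mult_pos zero_less_numeral)
  qed
  ultimately show ?thesis unfolding Q g using D det by (simp add: act_def posdef_def)
qed

lemma consecutive_mult_nonneg:
  fixes u v :: int
  assumes "\<bar>u - v\<bar> = 1"
  shows "u * v \<ge> 0"
  unfolding zero_le_mult_iff using assms by linarith

text \<open>Each of the three factorizations below is a product of two consecutive integers. Geometrically, edges of the Farey
triangulation do not cross.\<close>

lemma unimodular_signs: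
  fixes p q r t :: int
  assumes "\<bar>p*t - r*q\<bar> = 1"
  shows "(p*r) * (q*t) \<ge> 0" "(p*r) * ((p-q)*(r-t)) \<ge> 0" "(q*t) * ((p-q)*(r-t)) \<ge> 0"
proof -
  have "(p*r) * (q*t) = (p*t) * (r*q)" "(p*r) * ((p-q)*(r-t)) = (p*(r-t)) * (r*(p-q))"
    "(q*t) * ((p-q)*(r-t)) = (q*(r-t)) * (t*(p-q))" by (simp_all add: algebra_simps)
  moreover have "p*(r-t) - r*(p-q) = -(p*t - r*q)" "q*(r-t) - t*(p-q) = -(p*t - r*q)"
    by (simp_all add: algebra_simps)
  ultimately show "(p*r) * (q*t) \<ge> 0" "(p*r) * ((p-q)*(r-t)) \<ge> 0" "(q*t) * ((p-q)*(r-t)) \<ge> 0"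
    using assms consecutive_mult_nonneg by (metis abs_minus_cancel)+
qed

lemma weighted_sum_nonpos:
  fixes A B C x y z :: int
  assumes "A > 0" "B \<ge> 0" "C \<ge> 0" "x*y \<ge> 0" "x*z \<ge> 0" "A*x + B*y + C*z \<le> 0"
  shows "x \<le> 0"
proof (rule ccontr)
  assume "\<not> x \<le> 0"
  then have x: "x > 0" by simp
  then have "y \<ge> 0" "z \<ge> 0" using assms(4,5) by (simp_all add: zero_le_mult_iff)
  then have "A*x > 0" "B*y \<ge> 0" "C*z \<ge> 0" using x assms(1-3) by auto
  then show False using assms(6) by linarith
qed

text \<open>No two of the three products have opposite signs, so a nonpositive combination forces
  each product of positive weight to be nonpositive.\<close>

lemma weighted_sum_unimodular:
  fixes A B C p q r t :: int
  assumes "\<bar>p*t - r*q\<bar> = 1" "A \<ge> 0" "B \<ge> 0" "C \<ge> 0" "A*(p*r) + B*(q*t) + C*((p-q)*(r-t)) \<le> 0"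
  shows "A > 0 \<Longrightarrow> p*r \<le> 0" "B > 0 \<Longrightarrow> q*t \<le> 0" "C > 0 \<Longrightarrow> (p-q)*(r-t) \<le> 0"
proof -
  note u = unimodular_signs[OF assms(1)]
  show "A > 0 \<Longrightarrow> p*r \<le> 0" using weighted_sum_nonpos[of A B C "p*r" "q*t" "(p-q)*(r-t)"] assms u by simp
  show "B > 0 \<Longrightarrow> q*t \<le> 0" using weighted_sum_nonpos[of B A C "q*t" "p*r" "(p-q)*(r-t)"] assms u by (simp add: mult.commute)
  show "C > 0 \<Longrightarrow> (p-q)*(r-t) \<le> 0" using weighted_sum_nonpos[of C A B "(p-q)*(r-t)" "p*r" "q*t"] assms u by (simp add: mult.commute)
qed

text \<open>The numbers \<open>p\<close>, \<open>r\<close>, \<open>-p-r\<close> have pairwise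
  nonpositive products, so no two share a sign and one of the three is 0.\<close>

lemma superbase_coord:
  fixes p r :: int
  assumes "p*r \<le> 0" "p*(p+r) \<ge> 0" "r*(p+r) \<ge> 0"
  shows "p = 0 \<or> r = 0 \<or> r = -p"
  using assms unfolding mult_le_0_iff zero_le_mult_iff by linarith

text \<open>The columns are the positively oriented bases contained in the superbase (1,0), (0,1),
  (-1,-1) or its negative: three rotations times two signs.\<close>

definition stdbases :: "mat2 list" where
  "stdbases = [(0,1,-1,1), (0,-1,1,-1), (1,0,0,1), (-1,0,0,-1), (1,-1,1,0), (-1,1,-1,0)]"

text \<open>The same for (1,0), (0,-1), (-1,1), the superbase on the other side of the wall
  \<open>b = 0\<close>.\<close>

definition stdbases' :: "mat2 list" where
  "stdbases' = [(0,1,-1,0), (0,-1,1,0), (1,0,-1,1), (-1,0,1,-1), (1,-1,0,1), (-1,1,0,-1)]"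

text \<open>The columns of \<open>g\<close> and the negative of their sum form a second obtuse
  superbase. Each coordinate with positive weight vanishes on one of its three vectors, and
  determinant 1 then leaves finitely many matrices. For \<open>b < 0\<close> the difference of the
  coordinates also has positive weight, which excludes \<open>stdbases'\<close>.\<close>

lemma chamber_transport:
  fixes a b c :: int
  assumes A: "2*a + b > 0" and B: "2*c + b > 0" and C: "b \<le> 0"
    and g: "g \<in> Gamma0 1" and act: "act (a,b,c) g \<in> chamber"
  shows "g \<in> set stdbases \<or> g \<in> set stdbases'" "b < 0 \<Longrightarrow> g \<in> set stdbases"
proof -
  obtain p r q t where g': "g = (p,r,q,t)" by (cases g)
  have det: "p*t - r*q = 1" using g unfolding g' by (simp add: Gamma0_def)
  let ?A = "2*a + b" and ?B = "2*c + b" and ?C = "-b"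
  \<comment> \<open>Twice the inner products of the new superbase, up to sign, in terms of the old
    Selling parameters.\<close>
  have eqs: "2*a*p*r + b*(p*t + r*q) + 2*c*q*t = ?A*(p*r) + ?B*(q*t) + ?C*((p-q)*(r-t))"
    "2*(a*p^2 + b*p*q + c*q^2) + (2*a*p*r + b*(p*t + r*q) + 2*c*q*t) = - (?A*(p*(-p-r)) + ?B*(q*(-q-t)) + ?C*((p-q)*((-p-r)-(-q-t))))"
    "2*(a*r^2 + b*r*t + c*t^2) + (2*a*p*r + b*(p*t + r*q) + 2*c*q*t) = - (?A*(r*(-p-r)) + ?B*(t*(-q-t)) + ?C*((r-t)*((-p-r)-(-q-t))))"
    by (simp_all add: algebra_simps power2_eq_square)
  have ch: "?A*(p*r) + ?B*(q*t) + ?C*((p-q)*(r-t)) \<le> 0"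
     "?A*(p*(-p-r)) + ?B*(q*(-q-t)) + ?C*((p-q)*((-p-r)-(-q-t))) \<le> 0"
     "?A*(r*(-p-r)) + ?B*(t*(-q-t)) + ?C*((r-t)*((-p-r)-(-q-t))) \<le> 0"
  proof -
    have "act (a,b,c) g = (a*p^2 + b*p*q + c*q^2, 2*a*p*r + b*(p*t + r*q) + 2*c*q*t, a*r^2 + b*r*t + c*t^2)"
      by (simp add: g' act_def)
    then have "2*(a*p^2 + b*p*q + c*q^2) + (2*a*p*r + b*(p*t + r*q) + 2*c*q*t) \<ge> 0"
      "2*(a*r^2 + b*r*t + c*t^2) + (2*a*p*r + b*(p*t + r*q) + 2*c*q*t) \<ge> 0" "2*a*p*r + b*(p*t + r*q) + 2*c*q*t \<le> 0"
      using act by (simp_all only: chamber_def mem_Collect_eq prod.case)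
    then show "?A*(p*r) + ?B*(q*t) + ?C*((p-q)*(r-t)) \<le> 0"
     "?A*(p*(-p-r)) + ?B*(q*(-q-t)) + ?C*((p-q)*((-p-r)-(-q-t))) \<le> 0"
     "?A*(r*(-p-r)) + ?B*(t*(-q-t)) + ?C*((r-t)*((-p-r)-(-q-t))) \<le> 0"
      using eqs by linarith+
  qed
  have d: "\<bar>p*t - r*q\<bar> = 1" "\<bar>p*(-q-t) - (-p-r)*q\<bar> = 1" "\<bar>r*(-q-t) - (-p-r)*t\<bar> = 1"
    using det by (auto simp: algebra_simps)
  have nn: "?A \<ge> 0" "?B \<ge> 0" "?C \<ge> 0" using A B C by auto
  note w1 = weighted_sum_unimodular[OF d(1) nn ch(1)] and w2 = weighted_sum_unimodular[OF d(2) nn ch(2)]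
    and w3 = weighted_sum_unimodular[OF d(3) nn ch(3)]
  have pr: "p = 0 \<or> r = 0 \<or> r = -p"
    by (rule superbase_coord) (use w1(1) w2(1) w3(1) A in \<open>simp_all add: algebra_simps\<close>)
  have qt: "q = 0 \<or> t = 0 \<or> t = -q"
    by (rule superbase_coord) (use w1(2) w2(2) w3(2) B in \<open>simp_all add: algebra_simps\<close>)
  show main: "g \<in> set stdbases \<or> g \<in> set stdbases'"
    using pr
  proof (elim disjE)
    assume p: "p = 0"
    then have "r * (-q) = 1" using det by simp
    then have "r = 1 \<and> q = -1 \<or> r = -1 \<and> q = 1" unfolding zmult_eq_1_iff by linarith
    then show ?thesis using qt p unfolding g' stdbases_def stdbases'_def by auto
  next
    assume r: "r = 0"
    then have "p * t = 1" using det by simp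
    then have "p = 1 \<and> t = 1 \<or> p = -1 \<and> t = -1" unfolding zmult_eq_1_iff .
    then show ?thesis using qt r unfolding g' stdbases_def stdbases'_def by auto
  next
    assume r: "r = -p"
    then have "p * (t + q) = 1" using det by (simp add: algebra_simps)
    then have "p = 1 \<and> t + q = 1 \<or> p = -1 \<and> t + q = -1" unfolding zmult_eq_1_iff .
    then have "p = 1 \<and> q = 0 \<and> t = 1 \<or> p = 1 \<and> q = 1 \<and> t = 0 \<or> p = -1 \<and> q = 0 \<and> t = -1 \<or> p = -1 \<and> q = -1 \<and> t = 0"
      using qt by presburger
    then show ?thesis using r unfolding g' stdbases_def stdbases'_def by auto
  qed
  show "g \<in> set stdbases" if "b < 0"
  proof -
    have "p - q = 0 \<or> r - t = 0 \<or> r - t = -(p - q)"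
      by (rule superbase_coord) (use w1(3) w2(3) w3(3) that in \<open>simp_all add: algebra_simps\<close>)
    moreover have False if "g \<in> set stdbases'"
    proof -
      have "p - q \<noteq> 0 \<and> r - t \<noteq> 0 \<and> r - t \<noteq> -(p - q)"
        using that unfolding g' stdbases'_def by auto
      then show False using calculation by blast
    qed
    ultimately show ?thesis using main by blast
  qed
qed

lemma stdbases_Gamma0: "set stdbases \<subseteq> Gamma0 1" "set stdbases' \<subseteq> Gamma0 1"
  by (auto simp: stdbases_def stdbases'_def Gamma0_def)

lemma chamber_mult_sum:
  assumes "finite {g \<in> Gamma0 1. act Q g \<in> chamber}"
  shows "(\<Sum>g | g \<in> Gamma0 1 \<and> chamber_mult (act Q g) \<noteq> 0. chamber_mult (act Q g)) =
    int (card {g \<in> Gamma0 1. act Q g \<in> chamber}) + int (card {g \<in> Gamma0 1. act Q g \<in> chamber_int})"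
proof -
  let ?G = "{g \<in> Gamma0 1. act Q g \<in> chamber}"
  have "(\<Sum>g | g \<in> Gamma0 1 \<and> chamber_mult (act Q g) \<noteq> 0. chamber_mult (act Q g)) = (\<Sum>g\<in>?G. 1 + of_bool (act Q g \<in> chamber_int))"
    unfolding chamber_mult_eq_0 not_not by (rule sum.cong) (auto simp: chamber_mult_def)
  also have "\<dots> = int (card ?G) + int (card (?G \<inter> {g. act Q g \<in> chamber_int}))"
    using assms by (simp add: sum.distrib of_bool_def sum.If_cases)
  also have "?G \<inter> {g. act Q g \<in> chamber_int} = {g \<in> Gamma0 1. act Q g \<in> chamber_int}"
    using chamber_int_subset by blast
  finally show ?thesis .
qed

text \<open>Exactly six bases reach the chamber, all in its interior with multiplicity 2.\<close>

lemma chamber_total_int: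
  assumes "2*a + b > 0" "2*c + b > 0" "b < 0"
  shows "finite {g \<in> Gamma0 1. act (a,b,c) g \<in> chamber}"
    "(\<Sum>g | g \<in> Gamma0 1 \<and> chamber_mult (act (a,b,c) g) \<noteq> 0. chamber_mult (act (a,b,c) g)) = 12"
proof -
  have "\<forall>g\<in>set stdbases. act (a,b,c) g \<in> chamber_int"
    using assms by (simp add: stdbases_def act_def chamber_int_def)
  moreover have "g \<in> set stdbases" if "g \<in> Gamma0 1" "act (a,b,c) g \<in> chamber" for g
    using chamber_transport(2)[of a b c g] that assms by simp
  ultimately have "{g \<in> Gamma0 1. act (a,b,c) g \<in> chamber} = set stdbases" "{g \<in> Gamma0 1. act (a,b,c) g \<in> chamber_int} = set stdbases"
    using stdbases_Gamma0(1) chamber_int_subset by blast+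
  moreover have "card (set stdbases) = 6" by (simp add: stdbases_def)
  ultimately show "finite {g \<in> Gamma0 1. act (a,b,c) g \<in> chamber}"
    "(\<Sum>g | g \<in> Gamma0 1 \<and> chamber_mult (act (a,b,c) g) \<noteq> 0. chamber_mult (act (a,b,c) g)) = 12"
    by (simp_all add: chamber_mult_sum)
qed

text \<open>On the wall both superbases are obtuse: twelve bases of multiplicity 1, hence the same
  total.\<close>

lemma chamber_total_wall:
  assumes "a > 0" "c > 0"
  shows "finite {g \<in> Gamma0 1. act (a,0,c) g \<in> chamber}"
    "(\<Sum>g | g \<in> Gamma0 1 \<and> chamber_mult (act (a,0,c) g) \<noteq> 0. chamber_mult (act (a,0,c) g)) = 12"
proof -
  have c: "\<forall>g\<in>set stdbases \<union> set stdbases'. act (a,0,c) g \<in> chamber \<and> act (a,0,c) g \<notin> chamber_int"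
    using assms by (simp add: stdbases_def stdbases'_def act_def chamber_int_def chamber_def)
  have t: "g \<in> set stdbases \<union> set stdbases'" if "g \<in> Gamma0 1" "act (a,0,c) g \<in> chamber" for g
    using chamber_transport(1)[of a 0 c g] that assms by auto
  have e1: "{g \<in> Gamma0 1. act (a,0,c) g \<in> chamber} = set stdbases \<union> set stdbases'"
    using c t stdbases_Gamma0 by blast
  have e2: "{g \<in> Gamma0 1. act (a,0,c) g \<in> chamber_int} = {}"
    using c t chamber_int_subset by blast
  have e3: "card (set stdbases \<union> set stdbases') = 12" by (simp add: stdbases_def stdbases'_def)
  show fin: "finite {g \<in> Gamma0 1. act (a,0,c) g \<in> chamber}" unfolding e1 by simp
  show "(\<Sum>g | g \<in> Gamma0 1 \<and> chamber_mult (act (a,0,c) g) \<noteq> 0. chamber_mult (act (a,0,c) g)) = 12"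
    unfolding chamber_mult_sum[OF fin] e1 e2 e3 by simp
qed

text \<open>Selling's reduction: \<open>2*a + 2*c + b\<close> is the sum of the values of the form
  on v1, v2 and v0. Comparing a minimizer with three neighbouring superbases yields the three
  inequalities. Positivity of the sum keeps \<open>nat\<close> from distorting the
  comparison.\<close>

lemma exists_chamber:
  assumes "D > 0" "Q \<in> posdef D"
  shows "\<exists>g \<in> Gamma0 1. act Q g \<in> chamber"
proof -
  define \<sigma> where "\<sigma> = (\<lambda>(a,b,c). nat (2*a + 2*c + b))"
  obtain g where g: "g \<in> Gamma0 1" and min: "\<And>h. h \<in> Gamma0 1 \<Longrightarrow> \<sigma> (act Q g) \<le> \<sigma> (act Q h)"
    using ex_has_least_nat[of "\<lambda>g. g \<in> Gamma0 1" "(1,0,0,1)" "\<lambda>g. \<sigma> (act Q g)"] Gamma0_one by blast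
  obtain a b c where R: "act Q g = (a,b,c)" by (cases "act Q g")
  have "(a,b,c) \<in> posdef D" using posdef_act[OF assms g] R by simp
  then have a: "a > 0" and D: "4*a*c - b^2 = D" by (auto simp: posdef_def)
  have le: "\<sigma> (a,b,c) \<le> \<sigma> (act (a,b,c) h)" if "h \<in> Gamma0 1" for h
    using min[OF Gamma0_mmul[OF g that]] unfolding act_mmul[symmetric] R .
  have pos: "2*a + 2*c + b > 0"
  proof -
    have "4*a*(2*a + 2*c + b) = (2*a + b)^2 + 4*a^2 + b^2 + 2*(4*a*c - b^2)" by (simp add: algebra_simps power2_eq_square)
    also have "\<dots> > 0" using a D assms(1) by (intro add_nonneg_pos add_nonneg_nonneg) auto
    finally show ?thesis using a by (simp add: zero_less_mult_iff)
  qed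
  have "2*a + 2*c + b \<le> 2*a + 2*c - b" using le[of "(0,-1,1,0)"] pos by (simp add: Gamma0_def act_def \<sigma>_def)
  moreover have "2*a + 2*c + b \<le> 2*a + 6*c + 3*b" using le[of "(1,0,1,1)"] pos by (simp add: Gamma0_def act_def \<sigma>_def)
  moreover have "2*a + 2*c + b \<le> 6*a + 2*c + 3*b" using le[of "(1,1,0,1)"] pos by (simp add: Gamma0_def act_def \<sigma>_def)
  ultimately have "(a,b,c) \<in> chamber" by (simp add: chamber_def)
  then show ?thesis using g R by (intro bexI[of _ g]) simp_all
qed

lemma chamber_sum_act:
  assumes h: "h \<in> Gamma0 1"
  shows "finite {g \<in> Gamma0 1. act (act Q h) g \<in> chamber} \<longleftrightarrow> finite {g \<in> Gamma0 1. act Q g \<in> chamber}"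
    "(\<Sum>g | g \<in> Gamma0 1 \<and> chamber_mult (act (act Q h) g) \<noteq> 0. chamber_mult (act (act Q h) g)) =
     (\<Sum>g | g \<in> Gamma0 1 \<and> chamber_mult (act Q g) \<noteq> 0. chamber_mult (act Q g))"
proof -
  have "bij_betw (mmul h) {g \<in> Gamma0 1. act (act Q h) g \<in> chamber} {g \<in> Gamma0 1. act Q g \<in> chamber}"
    by (rule bij_mmul_left[OF h]) (simp add: act_mmul)
  then show "finite {g \<in> Gamma0 1. act (act Q h) g \<in> chamber} \<longleftrightarrow> finite {g \<in> Gamma0 1. act Q g \<in> chamber}"
    by (rule bij_betw_finite)
  have "bij_betw (mmul h) {g \<in> Gamma0 1. chamber_mult (act (act Q h) g) \<noteq> 0} {g \<in> Gamma0 1. chamber_mult (act Q g) \<noteq> 0}"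
    by (rule bij_mmul_left[OF h]) (simp add: act_mmul)
  from sum.reindex_bij_betw[OF this, of "\<lambda>g. chamber_mult (act Q g)"]
  show "(\<Sum>g | g \<in> Gamma0 1 \<and> chamber_mult (act (act Q h) g) \<noteq> 0. chamber_mult (act (act Q h) g)) =
     (\<Sum>g | g \<in> Gamma0 1 \<and> chamber_mult (act Q g) \<noteq> 0. chamber_mult (act Q g))"
    by (simp add: act_mmul)
qed

lemma posdef_lead:
  assumes "D > 0" "(a,b,c) \<in> posdef D"
  shows "a > 0" "c > 0"
proof -
  show a: "a > 0" using assms by (simp add: posdef_def)
  have "4*a*c - b^2 > 0" using assms by (simp add: posdef_def)
  with zero_le_power2[of b] have "4*a*c > 0" by linarith
  then show "c > 0" using a by (simp add: zero_less_mult_iff)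
qed

theorem chamber_total:
  assumes "D > 0" "Q \<in> posdef D"
  shows "finite {g \<in> Gamma0 1. act Q g \<in> chamber}"
    "(\<Sum>g | g \<in> Gamma0 1 \<and> chamber_mult (act Q g) \<noteq> 0. chamber_mult (act Q g)) = 12"
proof -
  obtain h where h: "h \<in> Gamma0 1" and ch: "act Q h \<in> chamber" using exists_chamber[OF assms] by blast
  \<comment> \<open>A chamber form outside the interior lies on a wall. The matrices
    \<open>(1,1,0,1)\<close> and \<open>(1,0,1,1)\<close> carry the walls \<open>2*a+b = 0\<close>
    and \<open>2*c+b = 0\<close> to \<open>b = 0\<close>.\<close>
  have "\<exists>k \<in> Gamma0 1. act Q k \<in> chamber_int \<or> (\<exists>a c. act Q k = (a,0,c) \<and> a > 0 \<and> c > 0)"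
  proof (rule ccontr)
    assume contra: "\<not> ?thesis"
    obtain a b c where R: "act Q h = (a,b,c)" by (cases "act Q h")
    have pd: "(a,b,c) \<in> posdef D" using posdef_act[OF assms h] R by simp
    have no: False if "k \<in> Gamma0 1" "act (a,b,c) k = (a',0,c')" for k a' c'
      using contra that Gamma0_mmul[OF h that(1)] posdef_lead[OF assms(1), of a' 0 c'] posdef_act[OF assms(1) pd that(1)]
      by (metis R act_mmul)
    have "b \<noteq> 0" using no[of "(1,0,0,1)"] Gamma0_one by auto
    moreover have "2*a + b \<noteq> 0" using no[of "(1,1,0,1)"] by (auto simp: Gamma0_def act_def)
    moreover have "2*c + b \<noteq> 0" using no[of "(1,0,1,1)"] by (auto simp: Gamma0_def act_def)
    ultimately have "act Q h \<in> chamber_int" using ch unfolding R chamber_def chamber_int_def by auto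
    then show False using contra h by blast
  qed
  then obtain k where k: "k \<in> Gamma0 1" and "act Q k \<in> chamber_int \<or> (\<exists>a c. act Q k = (a,0,c) \<and> a > 0 \<and> c > 0)" by blast
  then have "finite {g \<in> Gamma0 1. act (act Q k) g \<in> chamber} \<and>
    (\<Sum>g | g \<in> Gamma0 1 \<and> chamber_mult (act (act Q k) g) \<noteq> 0. chamber_mult (act (act Q k) g)) = 12"
    using chamber_total_int chamber_total_wall unfolding chamber_int_def by (cases "act Q k") auto
  then show "finite {g \<in> Gamma0 1. act Q g \<in> chamber}"
    "(\<Sum>g | g \<in> Gamma0 1 \<and> chamber_mult (act Q g) \<noteq> 0. chamber_mult (act Q g)) = 12"
    unfolding chamber_sum_act[OF k] by simp_all
qed

section \<open>Passing to level p\<close>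

text \<open>Representatives of \<open>\<Gamma>_0(p) \ SL_2(Z)\<close>, that is, the points of the projective line over \<open>F_p\<close>.\<close>

definition cosets :: "int \<Rightarrow> mat2 set" where
  "cosets p = insert (1,0,0,1) ((\<lambda>j. (0,-1,1,j)) ` {0..<p})"

definition level_mult :: "int \<Rightarrow> qform \<Rightarrow> int" where
  "level_mult p Q = (\<Sum>g\<in>cosets p. chamber_mult (act Q g))"

lemma finite_cosets [simp]: "finite (cosets p)"
  by (simp add: cosets_def)

lemma cosets_Gamma0: "g \<in> cosets p \<Longrightarrow> g \<in> Gamma0 1"
  by (auto simp: cosets_def Gamma0_def)

lemma card_cosets: "p > 0 \<Longrightarrow> int (card (cosets p)) = p + 1"
proof -
  assume "p > 0"
  have "inj_on (\<lambda>j. (0,-1,1,j) :: mat2) {0..<p}" by (simp add: inj_on_def)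
  from card_image[OF this] have im: "card ((\<lambda>j. (0,-1,1,j) :: mat2) ` {0..<p}) = nat p" by simp
  have "card (cosets p) = Suc (card ((\<lambda>j. (0,-1,1,j) :: mat2) ` {0..<p}))"
    unfolding cosets_def by (rule card_insert_disjoint) (simp_all add: image_iff)
  then show ?thesis unfolding im using \<open>p > 0\<close> by simp
qed

lemma level_mult_eq_0: "level_mult p Q = 0 \<longleftrightarrow> (\<forall>g\<in>cosets p. chamber_mult (act Q g) = 0)"
  unfolding level_mult_def by (rule sum_nonneg_eq_0_iff) (simp_all add: chamber_mult_nonneg)

lemma residue_unique:
  fixes p c d :: int
  assumes p: "prime p" and c: "\<not> p dvd c"
  shows "\<exists>!j. j \<in> {0..<p} \<and> p dvd c*j - d"
proof (rule ex_ex1I)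
  have p0: "p > 0" using p prime_gt_0_int by blast
  have "coprime c p" using p c prime_imp_coprime_int coprime_commute by blast
  then obtain u v where uv: "u*c + v*p = 1" using bezout_int[of c p] by (auto simp: coprime_iff_gcd_eq_1)
  have "c*((d*u) mod p) - d = c*(d*u) - d - c*(p*((d*u) div p))"
    by (simp add: minus_mult_div_eq_mod[symmetric] algebra_simps)
  also have "c*(d*u) - d = d*(u*c) - d" by (simp add: algebra_simps)
  also have "u*c = 1 - v*p" using uv by simp
  finally have "c*((d*u) mod p) - d = p*(-d*v - c*((d*u) div p))" by (simp add: algebra_simps)
  then show "\<exists>j. j \<in> {0..<p} \<and> p dvd c*j - d"
    using p0 by (intro exI[of _ "(d*u) mod p"]) simp
next
  fix j k assume j: "j \<in> {0..<p} \<and> p dvd c*j - d" and k: "k \<in> {0..<p} \<and> p dvd c*k - d"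
  then have "p dvd (c*j - d) - (c*k - d)" using dvd_diff by blast
  then have "p dvd c * (j - k)" by (simp add: algebra_simps)
  then have "p dvd j - k" using p c prime_dvd_mult_iff by blast
  moreover have "\<bar>j - k\<bar> < p" using j k by auto
  ultimately show "j = k" using zdvd_not_zless[of "\<bar>j - k\<bar>" p] by (cases "j = k") auto
qed

text \<open>The coset depends only on the bottom row \<open>(c,d)\<close> as a projective point
  modulo \<open>p\<close>: the identity stands for \<open>p dvd c\<close>, the other representatives
  for the residue \<open>j\<close> with \<open>c*j = d\<close> modulo \<open>p\<close>.\<close>

lemma cosets_unique:
  assumes p: "prime p" and \<gamma>: "\<gamma> \<in> Gamma0 1"
  shows "\<exists>!g. g \<in> cosets p \<and> mmul \<gamma> (minv g) \<in> Gamma0 p"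
proof -
  obtain a b c d where g: "\<gamma> = (a,b,c,d)" by (cases \<gamma>)
  have det: "a*d - b*c = 1" using \<gamma> unfolding g by (simp add: Gamma0_def)
  have one: "mmul \<gamma> (minv (1,0,0,1)) \<in> Gamma0 p \<longleftrightarrow> p dvd c" using det unfolding g by (simp add: Gamma0_def)
  have oth: "mmul \<gamma> (minv (0,-1,1,j)) \<in> Gamma0 p \<longleftrightarrow> p dvd c*j - d" for j
    using det unfolding g by (simp add: Gamma0_def algebra_simps)
  show ?thesis
  proof (cases "p dvd c")
    case True
    have "\<not> p dvd c*j - d" for j
    proof
      assume "p dvd c*j - d"
      then have "p dvd d" using True by (metis dvd_diff_right_iff dvd_mult2)
      then have "p dvd a*d - b*c" using True by simp
      then show False using det p by auto
    qed
    then show ?thesis using True one oth by (intro ex1I[of _ "(1,0,0,1)"]) (auto simp: cosets_def simp del: mmul.simps minv.simps)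
  next
    case False
    from residue_unique[OF p this, of d] obtain j where j: "j \<in> {0..<p}" "p dvd c*j - d"
      and u: "\<And>k. k \<in> {0..<p} \<Longrightarrow> p dvd c*k - d \<Longrightarrow> k = j" by blast
    show ?thesis
    proof (rule ex1I[of _ "(0,-1,1,j)"])
      show "(0,-1,1,j) \<in> cosets p \<and> mmul \<gamma> (minv (0,-1,1,j)) \<in> Gamma0 p"
        unfolding oth using j by (simp add: cosets_def)
    next
      fix g assume "g \<in> cosets p \<and> mmul \<gamma> (minv g) \<in> Gamma0 p"
      then have g: "g \<in> cosets p" and m: "mmul \<gamma> (minv g) \<in> Gamma0 p" by blast+
      from g consider "g = (1,0,0,1)" | k where "k \<in> {0..<p}" "g = (0,-1,1,k)" unfolding cosets_def by blast
      then show "g = (0,-1,1,j)"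
      proof cases
        case 1
        then show ?thesis using m[unfolded 1 one] False by blast
      next
        case 2
        then show ?thesis using m[unfolded 2(2) oth] u 2 by blast
      qed
    qed
  qed
qed

lemma cosets_bij:
  assumes "prime p"
  shows "bij_betw (\<lambda>(h,g). mmul h g) (Gamma0 p \<times> cosets p) (Gamma0 1)"
  unfolding bij_betw_def
proof
  have cancel: "mmul (mmul h g) (minv g) = h" if "g \<in> cosets p" for h g
    using cosets_Gamma0[OF that] by (simp add: mmul_assoc)
  have mem: "mmul h g \<in> Gamma0 1" if "h \<in> Gamma0 p" "g \<in> cosets p" for h g
    using that Gamma0_subset cosets_Gamma0 Gamma0_mmul by blast
  show "inj_on (\<lambda>(h,g). mmul h g) (Gamma0 p \<times> cosets p)"
  proof (rule inj_onI)
    fix x y assume x: "x \<in> Gamma0 p \<times> cosets p" and y: "y \<in> Gamma0 p \<times> cosets p"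
      and e: "(case x of (h,g) \<Rightarrow> mmul h g) = (case y of (h,g) \<Rightarrow> mmul h g)"
    obtain h g where xg: "x = (h,g)" "h \<in> Gamma0 p" "g \<in> cosets p" using x by blast
    obtain h' g' where yg: "y = (h',g')" "h' \<in> Gamma0 p" "g' \<in> cosets p" using y by blast
    have e': "mmul h g = mmul h' g'" using e xg yg by simp
    have "g = g'"
      using cosets_unique[OF assms mem[OF xg(2,3)]] cancel[OF xg(3), of h] cancel[OF yg(3), of h'] xg yg e' by metis
    moreover have "h = h'" using cancel[OF xg(3), of h] cancel[OF yg(3), of h'] e' calculation by metis
    ultimately show "x = y" using xg(1) yg(1) by blast
  qed
  show "(\<lambda>(h,g). mmul h g) ` (Gamma0 p \<times> cosets p) = Gamma0 1"
  proof
    show "(\<lambda>(h,g). mmul h g) ` (Gamma0 p \<times> cosets p) \<subseteq> Gamma0 1" 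
    proof (rule image_subsetI)
      fix x assume "x \<in> Gamma0 p \<times> cosets p"
      then obtain h g where "x = (h,g)" "h \<in> Gamma0 p" "g \<in> cosets p" by blast
      then show "(case x of (h,g) \<Rightarrow> mmul h g) \<in> Gamma0 1" using mem by simp
    qed
    show "Gamma0 1 \<subseteq> (\<lambda>(h,g). mmul h g) ` (Gamma0 p \<times> cosets p)"
    proof
      fix \<gamma> assume "\<gamma> \<in> Gamma0 1"
      then obtain g where g: "g \<in> cosets p" "mmul \<gamma> (minv g) \<in> Gamma0 p" using cosets_unique[OF assms] by blast
      then have "\<gamma> = mmul (mmul \<gamma> (minv g)) g" using cosets_Gamma0[OF g(1)] by (simp add: mmul_assoc)
      then show "\<gamma> \<in> (\<lambda>(h,g). mmul h g) ` (Gamma0 p \<times> cosets p)" using g by (intro image_eqI[of _ _ "(mmul \<gamma> (minv g), g)"]) simp_all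
    qed
  qed
qed

lemma image_Collect_surj: "f ` A = B \<Longrightarrow> f ` {x \<in> A. P (f x)} = {y \<in> B. P y}"
  by auto

text \<open>Unique factorization into an element of \<open>Gamma0 p\<close> and a representative
  turns the double sum into the sum over the full modular group.\<close>

lemma level_total:
  assumes p: "prime p" and Q: "D > 0" "Q \<in> posdef D"
  shows "finite {h \<in> Gamma0 p. level_mult p (act Q h) \<noteq> 0}"
    "(\<Sum>h | h \<in> Gamma0 p \<and> level_mult p (act Q h) \<noteq> 0. level_mult p (act Q h)) = 12"
proof -
  let ?H = "{h \<in> Gamma0 p. level_mult p (act Q h) \<noteq> 0}"
  let ?f = "\<lambda>x. chamber_mult (act Q (case x of (h,g) \<Rightarrow> mmul h g))"
  let ?Z = "{x \<in> Gamma0 p \<times> cosets p. ?f x \<noteq> 0}"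
  have bij: "bij_betw (\<lambda>(h,g). mmul h g) ?Z {g \<in> Gamma0 1. chamber_mult (act Q g) \<noteq> 0}"
  proof (rule bij_betw_subset[OF cosets_bij[OF p]])
    show "(\<lambda>(h,g). mmul h g) ` ?Z = {g \<in> Gamma0 1. chamber_mult (act Q g) \<noteq> 0}"
      by (rule image_Collect_surj[OF bij_betw_imp_surj_on[OF cosets_bij[OF p]], of "\<lambda>g. chamber_mult (act Q g) \<noteq> 0"])
  qed blast
  have finZ: "finite ?Z"
    using bij_betw_finite[OF bij] chamber_total(1)[OF Q] by (simp add: chamber_mult_eq_0)
  have "?H = fst ` ?Z"
  proof (intro set_eqI iffI)
    fix h assume "h \<in> ?H"
    then obtain g where "h \<in> Gamma0 p" "g \<in> cosets p" "chamber_mult (act (act Q h) g) \<noteq> 0" by (auto simp: level_mult_eq_0)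
    then show "h \<in> fst ` ?Z" by (intro image_eqI[of _ _ "(h,g)"]) (simp_all add: act_mmul)
  next
    fix h assume "h \<in> fst ` ?Z"
    then show "h \<in> ?H" by (fastforce simp: level_mult_eq_0 act_mmul)
  qed
  then show finH: "finite ?H" using finZ by simp
  have "(\<Sum>h\<in>?H. level_mult p (act Q h)) = (\<Sum>x\<in>?H \<times> cosets p. ?f x)"
    unfolding level_mult_def act_mmul by (subst sum.cartesian_product) (simp add: case_prod_unfold)
  also have "\<dots> = (\<Sum>x\<in>?Z. ?f x)"
  proof (rule sum.mono_neutral_right)
    show "?Z \<subseteq> ?H \<times> cosets p" using \<open>?H = fst ` ?Z\<close> by (force simp: image_iff)
  qed (use finH in auto)
  also have "\<dots> = (\<Sum>g | g \<in> Gamma0 1 \<and> chamber_mult (act Q g) \<noteq> 0. chamber_mult (act Q g))"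
    by (rule sum.reindex_bij_betw[OF bij])
  finally show "(\<Sum>h\<in>?H. level_mult p (act Q h)) = 12" using chamber_total(2)[OF Q] by simp
qed

section \<open>Weighted counts of reduced forms\<close>

definition chamber_forms :: "int \<Rightarrow> qform set" where
  "chamber_forms D = {Q \<in> posdef D. chamber_mult Q \<noteq> 0}"

text \<open>Six times the weighted class number H(D), for \<open>D > 0\<close>.\<close>

definition class_weight :: "int \<Rightarrow> int" where
  "class_weight D = (\<Sum>Q\<in>chamber_forms D. chamber_mult Q)"

lemma finite_chamber_forms:
  assumes "D > 0"
  shows "finite (chamber_forms D)"
proof (rule finite_surj[OF finite_selling[OF assms]])
  show "chamber_forms D \<subseteq> (\<lambda>(A,B,C). ((A + C) div 2, -C, (B + C) div 2)) ` {(A,B,C). A*B + B*C + C*A = D \<and> A \<ge> 0 \<and> B \<ge> 0 \<and> C \<ge> 0}"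
  proof
    fix Q assume Q: "Q \<in> chamber_forms D"
    obtain a b c where abc: "Q = (a,b,c)" by (cases Q)
    have "(2*a + b)*(2*c + b) + (2*c + b)*(-b) + (-b)*(2*a + b) = 4*a*c - b^2" by (simp add: algebra_simps power2_eq_square)
    then have "(2*a + b, 2*c + b, -b) \<in> {(A,B,C). A*B + B*C + C*A = D \<and> A \<ge> 0 \<and> B \<ge> 0 \<and> C \<ge> 0}"
      using Q unfolding abc chamber_forms_def chamber_mult_eq_0 posdef_def chamber_def by simp
    then show "Q \<in> (\<lambda>(A,B,C). ((A + C) div 2, -C, (B + C) div 2)) ` {(A,B,C). A*B + B*C + C*A = D \<and> A \<ge> 0 \<and> B \<ge> 0 \<and> C \<ge> 0}"
      by (intro image_eqI[of _ _ "(2*a + b, 2*c + b, -b)"]) (simp_all add: abc)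
  qed
qed

text \<open>Interchange of summation: a reduced form arises from \<open>Y\<close> once for every
  representative whose inverse sends it back into \<open>Y\<close>. It is applied with
  \<open>Y\<close> being \<open>posdef\<close>, \<open>lattice_forms\<close> and
  \<open>level_forms\<close>.\<close>

lemma level_sum_fold:
  assumes D: "D > 0" and Y: "Y \<subseteq> posdef D"
  shows "finite {Q \<in> Y. level_mult p Q \<noteq> 0}"
    "(\<Sum>Q | Q \<in> Y \<and> level_mult p Q \<noteq> 0. level_mult p Q) =
      (\<Sum>Q\<in>chamber_forms D. chamber_mult Q * int (card {g \<in> cosets p. act Q (minv g) \<in> Y}))"
proof -
  let ?Z = "{x \<in> Y \<times> cosets p. act (fst x) (snd x) \<in> chamber_forms D}"
  let ?Z' = "Sigma (chamber_forms D) (\<lambda>Q. {g \<in> cosets p. act Q (minv g) \<in> Y})"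
  let ?Y = "{Q \<in> Y. level_mult p Q \<noteq> 0}"
  have bij: "bij_betw (\<lambda>x. (act (fst x) (snd x), snd x)) ?Z ?Z'"
  proof (rule bij_betw_byWitness[where f'="\<lambda>x. (act (fst x) (minv (snd x)), snd x)"])
    show "\<forall>x\<in>?Z. (act (fst (act (fst x) (snd x), snd x)) (minv (snd (act (fst x) (snd x), snd x))), snd (act (fst x) (snd x), snd x)) = x"
    proof
      fix x assume "x \<in> ?Z"
      then have "snd x \<in> cosets p" by (simp add: mem_Times_iff)
      then show "(act (fst (act (fst x) (snd x), snd x)) (minv (snd (act (fst x) (snd x), snd x))), snd (act (fst x) (snd x), snd x)) = x"
        by (simp add: act_minv(1)[OF cosets_Gamma0])
    qed
    show "\<forall>x\<in>?Z'. (act (fst (act (fst x) (minv (snd x)), snd x)) (snd (act (fst x) (minv (snd x)), snd x)), snd (act (fst x) (minv (snd x)), snd x)) = x"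
    proof
      fix x assume "x \<in> ?Z'"
      then have "snd x \<in> cosets p" by (simp add: mem_Sigma_iff[of "fst x" "snd x", simplified])
      then show "(act (fst (act (fst x) (minv (snd x)), snd x)) (snd (act (fst x) (minv (snd x)), snd x)), snd (act (fst x) (minv (snd x)), snd x)) = x"
        by (simp add: act_minv(2)[OF cosets_Gamma0])
    qed
    show "(\<lambda>x. (act (fst x) (snd x), snd x)) ` ?Z \<subseteq> ?Z'"
    proof (rule image_subsetI)
      fix x assume x: "x \<in> ?Z"
      then have "snd x \<in> cosets p" by (simp add: mem_Times_iff)
      then show "(act (fst x) (snd x), snd x) \<in> ?Z'" using x by (simp add: mem_Times_iff act_minv(1)[OF cosets_Gamma0])
    qed
    show "(\<lambda>x. (act (fst x) (minv (snd x)), snd x)) ` ?Z' \<subseteq> ?Z"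
    proof (rule image_subsetI)
      fix x assume "x \<in> ?Z'"
      then obtain Q g where x: "x = (Q,g)" "Q \<in> chamber_forms D" "g \<in> cosets p" "act Q (minv g) \<in> Y" by blast
      then show "(act (fst x) (minv (snd x)), snd x) \<in> ?Z" by (simp add: act_minv(2)[OF cosets_Gamma0])
    qed
  qed
  have finZ': "finite ?Z'" using finite_chamber_forms[OF D] by (intro finite_SigmaI) simp_all
  then have finZ: "finite ?Z" using bij_betw_finite[OF bij] by blast
  have nz: "act Q g \<in> chamber_forms D \<longleftrightarrow> chamber_mult (act Q g) \<noteq> 0" if "Q \<in> Y" "g \<in> cosets p" for Q g
    using posdef_act[OF D _ cosets_Gamma0[OF that(2)], of Q] that Y by (auto simp: chamber_forms_def)
  have YZ: "?Y = fst ` ?Z"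
  proof (intro set_eqI iffI)
    fix Q assume "Q \<in> ?Y"
    then have "Q \<in> Y" "\<not> (\<forall>g\<in>cosets p. chamber_mult (act Q g) = 0)" by (simp_all add: level_mult_eq_0)
    then obtain g where "g \<in> cosets p" "chamber_mult (act Q g) \<noteq> 0" by blast
    then show "Q \<in> fst ` ?Z" using nz[of Q g] \<open>Q \<in> Y\<close> by (intro image_eqI[of _ _ "(Q,g)"]) simp_all
  next
    fix Q assume "Q \<in> fst ` ?Z"
    then obtain x where x: "x \<in> ?Z" "Q = fst x" by (elim imageE)
    then have "Q \<in> Y" "snd x \<in> cosets p" "act Q (snd x) \<in> chamber_forms D" by (simp_all add: mem_Times_iff)
    then show "Q \<in> ?Y" using nz[of Q "snd x"] by (simp add: level_mult_eq_0) blast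
  qed
  show finY: "finite ?Y" unfolding YZ using finZ by simp
  have "(\<Sum>Q\<in>?Y. level_mult p Q) = (\<Sum>x\<in>?Y \<times> cosets p. chamber_mult (act (fst x) (snd x)))"
    unfolding level_mult_def by (subst sum.cartesian_product) (simp add: case_prod_unfold)
  also have "\<dots> = (\<Sum>x\<in>?Z. chamber_mult (act (fst x) (snd x)))"
  proof (rule sum.mono_neutral_right)
    show "finite (?Y \<times> cosets p)" using finY by simp
    show "?Z \<subseteq> ?Y \<times> cosets p"
    proof
      fix x assume x: "x \<in> ?Z"
      then have "fst x \<in> ?Y" unfolding YZ by (rule imageI)
      then show "x \<in> ?Y \<times> cosets p" using x by (simp add: mem_Times_iff)
    qed
    show "\<forall>x\<in>?Y \<times> cosets p - ?Z. chamber_mult (act (fst x) (snd x)) = 0"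
    proof
      fix x assume "x \<in> ?Y \<times> cosets p - ?Z"
      then have "fst x \<in> Y" "snd x \<in> cosets p" "act (fst x) (snd x) \<notin> chamber_forms D" by (simp_all add: mem_Times_iff)
      then show "chamber_mult (act (fst x) (snd x)) = 0" using nz by simp
    qed
  qed
  also have "\<dots> = (\<Sum>x\<in>?Z'. chamber_mult (fst x))"
    using sum.reindex_bij_betw[OF bij, of "\<lambda>x. chamber_mult (fst x)"] by simp
  also have "\<dots> = (\<Sum>Q\<in>chamber_forms D. \<Sum>g\<in>{g \<in> cosets p. act Q (minv g) \<in> Y}. chamber_mult Q)"
    by (subst sum.Sigma) (simp_all add: finite_chamber_forms[OF D] case_prod_unfold)
  also have "\<dots> = (\<Sum>Q\<in>chamber_forms D. chamber_mult Q * int (card {g \<in> cosets p. act Q (minv g) \<in> Y}))"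
    by (simp add: mult.commute)
  finally show "(\<Sum>Q\<in>?Y. level_mult p Q) = (\<Sum>Q\<in>chamber_forms D. chamber_mult Q * int (card {g \<in> cosets p. act Q (minv g) \<in> Y}))" .
qed

lemma level_sum_posdef:
  assumes D: "D > 0" and p: "p > 0"
  shows "(\<Sum>Q | Q \<in> posdef D \<and> level_mult p Q \<noteq> 0. level_mult p Q) = (p + 1) * class_weight D"
proof -
  have "act Q (minv g) \<in> posdef D" if "Q \<in> chamber_forms D" "g \<in> cosets p" for Q g
    using posdef_act[OF D _ Gamma0_minv[OF cosets_Gamma0[OF that(2)]]] that(1) by (simp add: chamber_forms_def)
  then have "{g \<in> cosets p. act Q (minv g) \<in> posdef D} = cosets p" if "Q \<in> chamber_forms D" for Q
    using that by blast
  then show ?thesis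
    using level_sum_fold(2)[OF D order_refl, of p] card_cosets[OF p] by (simp add: class_weight_def sum_distrib_left mult.commute)
qed

text \<open>The forms of discriminant \<open>-p^2 D\<close> that come from a form of discriminant \<open>-D\<close> by restriction to a fixed sublattice of index \<open>p\<close>.\<close>

definition lattice_forms :: "int \<Rightarrow> int \<Rightarrow> qform set" where
  "lattice_forms p D = {(a,b,c). (a,b,c) \<in> posdef (p^2 * D) \<and> p^2 dvd a \<and> p dvd b}"

definition level_forms :: "int \<Rightarrow> int \<Rightarrow> qform set" where
  "level_forms p D = {(a,b,c). (a,b,c) \<in> posdef D \<and> p dvd a}"

fun scale_form :: "int \<Rightarrow> qform \<Rightarrow> qform" where
  "scale_form k (a,b,c) = (k*a, k*b, k*c)"

lemma act_scale_form: "act (scale_form k Q) g = scale_form k (act Q g)"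
  by (cases Q; cases g) (simp add: act_def algebra_simps)

lemma scale_form_posdef: "k > 0 \<Longrightarrow> scale_form k Q \<in> posdef (k^2 * D) \<longleftrightarrow> Q \<in> posdef D"
proof -
  assume k: "k > 0"
  obtain a b c where Q: "Q = (a,b,c)" by (cases Q)
  have "4*(k*a)*(k*c) - (k*b)^2 = k^2 * (4*a*c - b^2)" by (simp add: algebra_simps power2_eq_square)
  then show ?thesis using k unfolding Q by (simp add: posdef_def zero_less_mult_iff)
qed

lemma scale_form_chamber_mult: "k > 0 \<Longrightarrow> chamber_mult (scale_form k Q) = chamber_mult Q"
proof -
  assume k: "k > 0"
  obtain a b c where Q: "Q = (a,b,c)" by (cases Q)
  have e: "2*(k*a) + k*b = k*(2*a + b)" "2*(k*c) + k*b = k*(2*c + b)" by (simp_all add: algebra_simps)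
  show ?thesis using k unfolding Q chamber_mult_def chamber_def chamber_int_def
    by (simp add: e zero_less_mult_iff zero_le_mult_iff mult_le_0_iff mult_less_0_iff)
qed

lemma scale_form_lattice_forms:
  assumes "p > 0"
  shows "scale_form p Q \<in> lattice_forms p D \<longleftrightarrow> Q \<in> level_forms p D"
proof -
  obtain a b c where Q: "Q = (a,b,c)" by (cases Q)
  show ?thesis using assms scale_form_posdef[of p "(a,b,c)" D] unfolding Q by (simp add: lattice_forms_def level_forms_def power2_eq_square)
qed

text \<open>Modulo the odd prime \<open>p\<close> the form has rank 1, hence exactly one isotropic
  line. On this line the value is divisible even by \<open>p^2\<close>, as completing the square
  shows: \<open>4*a\<close> times the value is a square divisible by \<open>p^2\<close> plus
  \<open>p^2 * D\<close>. When \<open>p dvd a\<close>, the line is the first axis and the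
  discriminant equation gives \<open>p^2 dvd a\<close>.\<close>

lemma lattice_cosets_unique:
  assumes p: "prime p" "p \<noteq> 2" and D: "D > 0" and Q: "(a,b,c) \<in> posdef (p^2 * D)"
    and nd: "\<not> (p dvd a \<and> p dvd b \<and> p dvd c)"
  shows "card {g \<in> cosets p. act (a,b,c) (minv g) \<in> lattice_forms p D} = 1"
proof -
  have p0: "p > 0" using p prime_gt_0_int by blast
  have pD: "p^2 * D > 0" using p0 D by simp
  have disc: "4*a*c - b^2 = p^2 * D" using Q by (simp add: posdef_def)
  have p2: "\<not> p dvd 2"
  proof
    assume "p dvd 2"
    then have "p = 2" using p(1) by (metis primes_dvd_imp_eq two_is_prime)
    then show False using p(2) by simp
  qed
  have pos: "act (a,b,c) (minv g) \<in> posdef (p^2 * D)" if "g \<in> cosets p" for g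
    using posdef_act[OF pD Q Gamma0_minv[OF cosets_Gamma0[OF that]]] .
  have one: "act (a,b,c) (minv (1,0,0,1)) \<in> lattice_forms p D \<longleftrightarrow> p^2 dvd a \<and> p dvd b"
    using Q by (simp add: lattice_forms_def)
  have oth: "act (a,b,c) (minv (0,-1,1,j)) \<in> lattice_forms p D \<longleftrightarrow> p^2 dvd a*j^2 - b*j + c \<and> p dvd 2*a*j - b" if "j \<in> {0..<p}" for j
    using pos[of "(0,-1,1,j)"] that by (simp add: lattice_forms_def act_def cosets_def)
  have cancel: "p^2 dvd y" if "p^2 dvd x * y" "\<not> p dvd x" for x y
  proof -
    have "coprime (p^2) x" using prime_imp_coprime_int[OF p(1) that(2)] by simp
    then show ?thesis using that(1) coprime_dvd_mult_right_iff by blast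
  qed
  have "\<exists>!g. g \<in> cosets p \<and> act (a,b,c) (minv g) \<in> lattice_forms p D"
  proof (cases "p dvd a")
    case True
    have "b^2 = 4*a*c - p^2 * D" using disc by simp
    then have "p dvd b^2" using True by (simp add: power2_eq_square)
    then have b: "p dvd b" using p(1) prime_dvd_power by blast
    then have c: "\<not> p dvd c" using nd True by blast
    have "4*a*c = p^2 * D + b^2" using disc by simp
    moreover have "p^2 dvd b^2" using b by simp
    ultimately have "p^2 dvd (2*2*c) * a" by (simp add: ac_simps)
    moreover have "\<not> p dvd 2*2*c" using p2 c p(1) by (simp only: prime_dvd_mult_iff) blast
    ultimately have a: "p^2 dvd a" by (rule cancel)
    show ?thesis
    proof (rule ex1I[of _ "(1,0,0,1)"])
      show "(1,0,0,1) \<in> cosets p \<and> act (a,b,c) (minv (1,0,0,1)) \<in> lattice_forms p D"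
        unfolding one using a b by (simp add: cosets_def)
    next
      fix g assume "g \<in> cosets p \<and> act (a,b,c) (minv g) \<in> lattice_forms p D"
      then have g: "g \<in> cosets p" and m: "act (a,b,c) (minv g) \<in> lattice_forms p D" by blast+
      from g consider "g = (1,0,0,1)" | k where "k \<in> {0..<p}" "g = (0,-1,1,k)" unfolding cosets_def by blast
      then show "g = (1,0,0,1)"
      proof cases
        case 2
        have "p dvd a*k^2 - b*k + c" using m[unfolded 2(2) oth[OF 2(1)]] by (metis dvd_trans dvd_triv_left power2_eq_square)
        moreover have "p dvd a*k^2 - b*k" using True b by simp
        ultimately have "p dvd c" by (simp add: dvd_add_right_iff)
        then show ?thesis using c by blast
      qed
    qed
  next
    case False
    then have a2: "\<not> p dvd 2*a" using p2 p(1) by (simp only: prime_dvd_mult_iff) blast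
    from residue_unique[OF p(1) this, of b] obtain j where j: "j \<in> {0..<p}" "p dvd 2*a*j - b"
      and u: "\<And>k. k \<in> {0..<p} \<Longrightarrow> p dvd 2*a*k - b \<Longrightarrow> k = j" by blast
    have "2*(2*a) * (a*j^2 - b*j + c) = (2*a*j - b)^2 + p^2 * D"
      unfolding disc[symmetric] by (simp add: algebra_simps power2_eq_square)
    moreover have "p^2 dvd (2*a*j - b)^2" using j(2) by simp
    ultimately have "p^2 dvd 2*(2*a) * (a*j^2 - b*j + c)" by simp
    moreover have "\<not> p dvd 2*(2*a)" using p2 a2 p(1) prime_dvd_mult_iff by blast
    ultimately have j2: "p^2 dvd a*j^2 - b*j + c" by (rule cancel)
    show ?thesis
    proof (rule ex1I[of _ "(0,-1,1,j)"])
      show "(0,-1,1,j) \<in> cosets p \<and> act (a,b,c) (minv (0,-1,1,j)) \<in> lattice_forms p D"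
        unfolding oth[OF j(1)] using j j2 by (simp add: cosets_def)
    next
      fix g assume "g \<in> cosets p \<and> act (a,b,c) (minv g) \<in> lattice_forms p D"
      then have g: "g \<in> cosets p" and m: "act (a,b,c) (minv g) \<in> lattice_forms p D" by blast+
      from g consider "g = (1,0,0,1)" | k where "k \<in> {0..<p}" "g = (0,-1,1,k)" unfolding cosets_def by blast
      then show "g = (0,-1,1,j)"
      proof cases
        case 1
        then have "p^2 dvd a" using m unfolding 1 one by blast
        then show ?thesis using False by (metis dvd_trans dvd_triv_left power2_eq_square)
      next
        case 2
        then show ?thesis using m[unfolded 2(2) oth[OF 2(1)]] u by blast
      qed
    qed
  qed
  then obtain g where "{g \<in> cosets p. act (a,b,c) (minv g) \<in> lattice_forms p D} = {g}" by blast
  then show ?thesis by simp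
qed

lemma scale_form_chamber_forms:
  assumes "k > 0"
  shows "bij_betw (scale_form k) (chamber_forms D) {(a,b,c). (a,b,c) \<in> chamber_forms (k^2 * D) \<and> k dvd a \<and> k dvd b \<and> k dvd c}"
proof -
  have mem: "scale_form k Q \<in> chamber_forms (k^2 * D) \<longleftrightarrow> Q \<in> chamber_forms D" for Q
    using scale_form_posdef[OF assms] scale_form_chamber_mult[OF assms] by (simp add: chamber_forms_def)
  have "inj_on (scale_form k) (chamber_forms D)"
  proof (rule inj_onI)
    fix Q R assume "scale_form k Q = scale_form k R"
    then show "Q = R" using assms by (cases Q; cases R) simp
  qed
  moreover have "scale_form k ` chamber_forms D = {(a,b,c). (a,b,c) \<in> chamber_forms (k^2 * D) \<and> k dvd a \<and> k dvd b \<and> k dvd c}"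
  proof (intro set_eqI iffI)
    fix R assume "R \<in> scale_form k ` chamber_forms D"
    then obtain Q where "R = scale_form k Q" "Q \<in> chamber_forms D" by (elim imageE)
    then show "R \<in> {(a,b,c). (a,b,c) \<in> chamber_forms (k^2 * D) \<and> k dvd a \<and> k dvd b \<and> k dvd c}"
      using mem[of Q] by (cases Q) simp
  next
    fix R assume R: "R \<in> {(a,b,c). (a,b,c) \<in> chamber_forms (k^2 * D) \<and> k dvd a \<and> k dvd b \<and> k dvd c}"
    obtain a b c where abc: "R = (a,b,c)" by (cases R)
    then obtain a' b' c' where "a = k*a'" "b = k*b'" "c = k*c'" using R by (auto elim!: dvdE)
    then have "R = scale_form k (a',b',c')" by (simp add: abc)
    then show "R \<in> scale_form k ` chamber_forms D" using mem[of "(a',b',c')"] R abc by (intro image_eqI[of _ _ "(a',b',c')"]) simp_all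
  qed
  ultimately show ?thesis by (simp add: bij_betw_def)
qed

text \<open>Reduced forms not divisible by \<open>p\<close> count once. A multiple of
  \<open>p\<close> is \<open>p\<close> times a form of discriminant \<open>-D\<close>, and it lies
  in \<open>lattice_forms\<close> iff that form lies in \<open>level_forms\<close>.\<close>

lemma level_sum_lattice:
  assumes p: "prime p" "p \<noteq> 2" and D: "D > 0"
  shows "(\<Sum>Q | Q \<in> lattice_forms p D \<and> level_mult p Q \<noteq> 0. level_mult p Q) =
    class_weight (p^2 * D) - class_weight D + (\<Sum>Q | Q \<in> level_forms p D \<and> level_mult p Q \<noteq> 0. level_mult p Q)"
proof -
  have p0: "p > 0" using p prime_gt_0_int by blast
  have pD: "p^2 * D > 0" using p0 D by simp
  let ?S = "chamber_forms (p^2 * D)" and ?P = "{(a,b,c). (a,b,c) \<in> chamber_forms (p^2 * D) \<and> p dvd a \<and> p dvd b \<and> p dvd c}"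
  let ?n = "\<lambda>Q. int (card {g \<in> cosets p. act Q (minv g) \<in> lattice_forms p D})"
  have sub: "lattice_forms p D \<subseteq> posdef (p^2 * D)" "level_forms p D \<subseteq> posdef D" by (auto simp: lattice_forms_def level_forms_def)
  have PS: "?P \<subseteq> ?S" by blast
  have fin: "finite ?S" by (rule finite_chamber_forms[OF pD])
  have n1: "?n Q = 1" if "Q \<in> ?S - ?P" for Q
  proof -
    obtain a b c where abc: "Q = (a,b,c)" by (cases Q)
    have "(a,b,c) \<in> posdef (p^2 * D)" "\<not> (p dvd a \<and> p dvd b \<and> p dvd c)"
      using that unfolding abc chamber_forms_def by blast+
    from lattice_cosets_unique[OF p D this] show ?thesis unfolding abc by simp
  qed
  have "(\<Sum>Q | Q \<in> lattice_forms p D \<and> level_mult p Q \<noteq> 0. level_mult p Q) = (\<Sum>Q\<in>?S. chamber_mult Q * ?n Q)"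
    by (rule level_sum_fold(2)[OF pD sub(1)])
  also have "\<dots> = (\<Sum>Q\<in>?S - ?P. chamber_mult Q * ?n Q) + (\<Sum>Q\<in>?P. chamber_mult Q * ?n Q)"
    by (rule sum.subset_diff[OF PS fin])
  also have "(\<Sum>Q\<in>?S - ?P. chamber_mult Q * ?n Q) = (\<Sum>Q\<in>?S - ?P. chamber_mult Q)"
    by (rule sum.cong[OF refl]) (simp only: n1 mult_1_right)
  also have "\<dots> = class_weight (p^2 * D) - (\<Sum>Q\<in>?P. chamber_mult Q)"
    unfolding class_weight_def by (rule sum_diff[OF fin PS])
  also have "(\<Sum>Q\<in>?P. chamber_mult Q) = class_weight D"
    unfolding class_weight_def sum.reindex_bij_betw[OF scale_form_chamber_forms[OF p0], symmetric] scale_form_chamber_mult[OF p0] ..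
  also have "(\<Sum>Q\<in>?P. chamber_mult Q * ?n Q) = (\<Sum>Q\<in>chamber_forms D. chamber_mult Q * int (card {g \<in> cosets p. act Q (minv g) \<in> level_forms p D}))"
    unfolding sum.reindex_bij_betw[OF scale_form_chamber_forms[OF p0], symmetric] scale_form_chamber_mult[OF p0] act_scale_form scale_form_lattice_forms[OF p0] ..
  also have "\<dots> = (\<Sum>Q | Q \<in> level_forms p D \<and> level_mult p Q \<noteq> 0. level_mult p Q)"
    by (rule level_sum_fold(2)[OF D sub(2), symmetric])
  finally show ?thesis .
qed

text \<open>\<open>fricke p Q\<close> is the form \<open>Q(y, -p x)\<close>.\<close>

fun fricke :: "int \<Rightarrow> qform \<Rightarrow> qform" where
  "fricke p (a,b,c) = (c*p^2, -b*p, a)"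

fun unfricke :: "int \<Rightarrow> qform \<Rightarrow> qform" where
  "unfricke p (a,b,c) = (c, -(b div p), a div p^2)"

text \<open>Conjugation by the Fricke matrix with rows (0, 1) and (-p, 0).\<close>

fun fricke_conj :: "int \<Rightarrow> mat2 \<Rightarrow> mat2" where
  "fricke_conj p (a,b,c,d) = (d, -(c div p), -p*b, a)"

lemma unfricke_fricke: "p > 0 \<Longrightarrow> unfricke p (fricke p Q) = Q"
  by (cases Q) (simp add: dvd_neg_div)

lemma fricke_posdef:
  assumes "p > 0" "D > 0" "Q \<in> posdef D"
  shows "fricke p Q \<in> lattice_forms p D"
proof -
  obtain a b c where Q: "Q = (a,b,c)" by (cases Q)
  have "c > 0" using posdef_lead assms(2,3) unfolding Q by blast
  moreover have "4*(c*p^2)*a - (-b*p)^2 = p^2 * (4*a*c - b^2)" by (simp add: algebra_simps power2_eq_square)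
  ultimately show ?thesis using assms unfolding Q by (simp add: lattice_forms_def posdef_def)
qed

lemma unfricke_lattice:
  assumes "p > 0" "D > 0" "R \<in> lattice_forms p D"
  shows "unfricke p R \<in> posdef D" "fricke p (unfricke p R) = R"
proof -
  obtain a b c where R: "R = (a,b,c)" by (cases R)
  have pd: "(a,b,c) \<in> posdef (p^2 * D)" and "p^2 dvd a" "p dvd b" using assms(3) unfolding R by (simp_all add: lattice_forms_def)
  then obtain a' b' where ab: "a = p^2 * a'" "b = p * b'" by (auto elim!: dvdE)
  show "fricke p (unfricke p R) = R" using assms(1) unfolding R ab by (simp add: ac_simps)
  have "c > 0" using posdef_lead(2)[OF _ pd] assms(1,2) by simp
  have "4*a*c - b^2 = p^2 * (4*a'*c - b'^2)" unfolding ab by (simp add: algebra_simps power2_eq_square)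
  then have "p^2 * (4*a'*c - b'^2) = p^2 * D" using pd by (simp add: posdef_def)
  then have "4*a'*c - b'^2 = D" using assms(1) by (simp only: mult_cancel_left) simp
  then show "unfricke p R \<in> posdef D" using assms(1) \<open>c > 0\<close> unfolding R ab by (simp add: posdef_def ac_simps)
qed

lemma fricke_bij:
  assumes "p > 0" "D > 0"
  shows "bij_betw (fricke p) {Q \<in> posdef D. P Q} {R \<in> lattice_forms p D. P (unfricke p R)}"
proof (rule bij_betw_byWitness[where f'="unfricke p"])
  show "\<forall>Q\<in>{Q \<in> posdef D. P Q}. unfricke p (fricke p Q) = Q" using unfricke_fricke[OF assms(1)] by blast
  show "\<forall>R\<in>{R \<in> lattice_forms p D. P (unfricke p R)}. fricke p (unfricke p R) = R" using unfricke_lattice(2)[OF assms] by blast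
  show "fricke p ` {Q \<in> posdef D. P Q} \<subseteq> {R \<in> lattice_forms p D. P (unfricke p R)}"
    by (rule image_subsetI) (simp add: unfricke_fricke[OF assms(1)] fricke_posdef[OF assms])
  show "unfricke p ` {R \<in> lattice_forms p D. P (unfricke p R)} \<subseteq> {Q \<in> posdef D. P Q}"
    by (rule image_subsetI) (simp add: unfricke_lattice[OF assms])
qed

lemma act_fricke:
  assumes "p > 0" "g \<in> Gamma0 p"
  shows "act (fricke p Q) g = fricke p (act Q (fricke_conj p g))"
proof -
  obtain a b c where Q: "Q = (a,b,c)" by (cases Q)
  obtain \<alpha> \<beta> \<gamma> \<delta> where g: "g = (\<alpha>,\<beta>,\<gamma>,\<delta>)" by (cases g)
  then obtain k where "\<gamma> = p * k" using assms(2) by (auto simp: Gamma0_def elim!: dvdE)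
  then show ?thesis using assms(1) unfolding Q g by (simp add: act_def algebra_simps power2_eq_square)
qed

lemma fricke_conj:
  assumes "p > 0" "g \<in> Gamma0 p"
  shows "fricke_conj p g \<in> Gamma0 p" "fricke_conj p (fricke_conj p g) = g"
proof -
  obtain \<alpha> \<beta> \<gamma> \<delta> where g: "g = (\<alpha>,\<beta>,\<gamma>,\<delta>)" by (cases g)
  then obtain k where "\<gamma> = p * k" using assms(2) by (auto simp: Gamma0_def elim!: dvdE)
  then show "fricke_conj p g \<in> Gamma0 p" "fricke_conj p (fricke_conj p g) = g"
    using assms unfolding g by (simp_all add: Gamma0_def dvd_neg_div algebra_simps)
qed

lemma lattice_forms_act:
  assumes "p > 0" "D > 0" "R \<in> lattice_forms p D" "g \<in> Gamma0 p"
  shows "act R g \<in> lattice_forms p D" "unfricke p (act R g) = act (unfricke p R) (fricke_conj p g)"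
proof -
  have e: "act R g = fricke p (act (unfricke p R) (fricke_conj p g))"
    using act_fricke[OF assms(1,4), of "unfricke p R"] unfricke_lattice(2)[OF assms(1-3)] by simp
  show "act R g \<in> lattice_forms p D"
    unfolding e
    by (rule fricke_posdef[OF assms(1,2) posdef_act[OF assms(2) unfricke_lattice(1)[OF assms(1-3)] fricke_conj(1)[OF assms(1,4)]]])
  show "unfricke p (act R g) = act (unfricke p R) (fricke_conj p g)"
    unfolding e by (rule unfricke_fricke[OF assms(1)])
qed

text \<open>Two weights on the same orbits in \<open>lattice_forms\<close>:
  \<open>level_mult\<close> itself and \<open>level_mult\<close> pulled back along
  \<open>unfricke\<close>. Both have total 12, so both sums are 12 times the same orbit sum.\<close>

lemma level_sum_fricke:
  assumes p: "prime p" and D: "D > 0"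
  shows "(\<Sum>Q | Q \<in> lattice_forms p D \<and> level_mult p Q \<noteq> 0. level_mult p Q) =
    (\<Sum>Q | Q \<in> posdef D \<and> level_mult p Q \<noteq> 0. level_mult p Q)"
proof -
  have p0: "p > 0" using p prime_gt_0_int by blast
  have pD: "p^2 * D > 0" using p0 D by simp
  have sub: "lattice_forms p D \<subseteq> posdef (p^2 * D)" by (auto simp: lattice_forms_def)
  let ?f = "\<lambda>R. level_mult p (unfricke p R)"
  have closed: "act R g \<in> lattice_forms p D" if "R \<in> lattice_forms p D" "g \<in> Gamma0 p" for R g
    using lattice_forms_act(1)[OF p0 D that] .
  have bij: "bij_betw (fricke p) {Q \<in> posdef D. level_mult p Q \<noteq> 0} {R \<in> lattice_forms p D. ?f R \<noteq> 0}"
    by (rule fricke_bij[OF p0 D])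
  have conj: "bij_betw (fricke_conj p) {g \<in> Gamma0 p. ?f (act R g) \<noteq> 0} {g \<in> Gamma0 p. level_mult p (act (unfricke p R) g) \<noteq> 0}"
    if R: "R \<in> lattice_forms p D" for R
  proof (rule bij_betw_byWitness[where f'="fricke_conj p"])
    show "\<forall>g\<in>{g \<in> Gamma0 p. ?f (act R g) \<noteq> 0}. fricke_conj p (fricke_conj p g) = g"
      "\<forall>g\<in>{g \<in> Gamma0 p. level_mult p (act (unfricke p R) g) \<noteq> 0}. fricke_conj p (fricke_conj p g) = g"
      using fricke_conj(2)[OF p0] by blast+
    show "fricke_conj p ` {g \<in> Gamma0 p. ?f (act R g) \<noteq> 0} \<subseteq> {g \<in> Gamma0 p. level_mult p (act (unfricke p R) g) \<noteq> 0}"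
    proof (rule image_subsetI)
      fix g assume "g \<in> {g \<in> Gamma0 p. ?f (act R g) \<noteq> 0}"
      then have g: "g \<in> Gamma0 p" "?f (act R g) \<noteq> 0" by simp_all
      show "fricke_conj p g \<in> {g \<in> Gamma0 p. level_mult p (act (unfricke p R) g) \<noteq> 0}"
        using g fricke_conj(1)[OF p0 g(1)] unfolding lattice_forms_act(2)[OF p0 D R g(1)] by simp
    qed
    show "fricke_conj p ` {g \<in> Gamma0 p. level_mult p (act (unfricke p R) g) \<noteq> 0} \<subseteq> {g \<in> Gamma0 p. ?f (act R g) \<noteq> 0}"
    proof (rule image_subsetI)
      fix g assume "g \<in> {g \<in> Gamma0 p. level_mult p (act (unfricke p R) g) \<noteq> 0}"
      then have g: "g \<in> Gamma0 p" "level_mult p (act (unfricke p R) g) \<noteq> 0" by simp_all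
      note c = fricke_conj[OF p0 g(1)]
      show "fricke_conj p g \<in> {g \<in> Gamma0 p. ?f (act R g) \<noteq> 0}"
        using g c(1) lattice_forms_act(2)[OF p0 D R c(1)] unfolding c(2) by simp
    qed
  qed
  have 1: "(\<Sum>Ob\<in>orbit p ` lattice_forms p D. 1 / real (card (stab p (SOME Q. Q \<in> Ob)))) =
      of_int (\<Sum>Q | Q \<in> lattice_forms p D \<and> level_mult p Q \<noteq> 0. level_mult p Q) / of_int 12"
  proof (rule orbit_sum_unfold[OF closed])
    fix Q assume "Q \<in> lattice_forms p D"
    then have "Q \<in> posdef (p^2 * D)" using sub by blast
    from level_total[OF p pD this] show "finite {g \<in> Gamma0 p. level_mult p (act Q g) \<noteq> 0}"
      "(\<Sum>g | g \<in> Gamma0 p \<and> level_mult p (act Q g) \<noteq> 0. level_mult p (act Q g)) = 12" .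
  qed (use level_sum_fold(1)[OF pD sub] in simp_all)
  have 2: "(\<Sum>Ob\<in>orbit p ` lattice_forms p D. 1 / real (card (stab p (SOME Q. Q \<in> Ob)))) =
      of_int (\<Sum>R | R \<in> lattice_forms p D \<and> ?f R \<noteq> 0. ?f R) / of_int 12"
  proof (rule orbit_sum_unfold[OF closed])
    show "finite {Q \<in> lattice_forms p D. ?f Q \<noteq> 0}"
      using bij_betw_finite[OF bij] level_sum_fold(1)[OF D order_refl] by blast
  next
    fix R assume R: "R \<in> lattice_forms p D"
    note T = level_total[OF p D unfricke_lattice(1)[OF p0 D R]]
    show "finite {g \<in> Gamma0 p. ?f (act R g) \<noteq> 0}" using bij_betw_finite[OF conj[OF R]] T(1) by blast
    have "(\<Sum>g | g \<in> Gamma0 p \<and> ?f (act R g) \<noteq> 0. ?f (act R g)) =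
      (\<Sum>g | g \<in> Gamma0 p \<and> ?f (act R g) \<noteq> 0. level_mult p (act (unfricke p R) (fricke_conj p g)))"
      by (rule sum.cong) (simp_all add: lattice_forms_act(2)[OF p0 D R])
    also have "\<dots> = 12" unfolding sum.reindex_bij_betw[OF conj[OF R], of "\<lambda>g. level_mult p (act (unfricke p R) g)"] T(2) ..
    finally show "(\<Sum>g | g \<in> Gamma0 p \<and> ?f (act R g) \<noteq> 0. ?f (act R g)) = 12" .
  qed simp_all
  have "(\<Sum>R | R \<in> lattice_forms p D \<and> ?f R \<noteq> 0. ?f R) = (\<Sum>Q | Q \<in> posdef D \<and> level_mult p Q \<noteq> 0. ?f (fricke p Q))"
    by (rule sum.reindex_bij_betw[OF bij, symmetric])
  also have "\<dots> = (\<Sum>Q | Q \<in> posdef D \<and> level_mult p Q \<noteq> 0. level_mult p Q)"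
    unfolding unfricke_fricke[OF p0] ..
  finally have 3: "(\<Sum>R | R \<in> lattice_forms p D \<and> ?f R \<noteq> 0. ?f R) = (\<Sum>Q | Q \<in> posdef D \<and> level_mult p Q \<noteq> 0. level_mult p Q)" .
  have "real_of_int (\<Sum>Q | Q \<in> lattice_forms p D \<and> level_mult p Q \<noteq> 0. level_mult p Q) =
    real_of_int (\<Sum>Q | Q \<in> posdef D \<and> level_mult p Q \<noteq> 0. level_mult p Q)"
    using 1 2 unfolding 3 by (simp del: of_int_sum)
  then show ?thesis by (simp only: of_int_eq_iff)
qed

text \<open>The sum over \<open>lattice_forms\<close> has two evaluations, through the Fricke
  substitution and through divisibility by \<open>p\<close>; equating them isolates the sum over
  \<open>level_forms\<close>.\<close>

lemma level_sum_level_forms: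
  assumes "prime p" "p \<noteq> 2" "D > 0"
  shows "(\<Sum>Q | Q \<in> level_forms p D \<and> level_mult p Q \<noteq> 0. level_mult p Q) = (p + 2) * class_weight D - class_weight (p^2 * D)"
proof -
  have "p > 0" using assms prime_gt_0_int by blast
  then show ?thesis
    using level_sum_lattice[OF assms] level_sum_fricke[OF assms(1,3)] level_sum_posdef[OF assms(3)] by (simp add: algebra_simps)
qed

section \<open>Negative definite forms and the final comparison\<close>

fun neg_form :: "qform \<Rightarrow> qform" where
  "neg_form (a,b,c) = (-a,-b,-c)"

lemma act_neg_form: "act (neg_form Q) g = neg_form (act Q g)"
  by (cases Q; cases g) (simp add: act_def algebra_simps)

lemma neg_form_neg_form [simp]: "neg_form (neg_form Q) = Q"
  by (cases Q) simp

lemma QF_eq: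
  assumes "D > 0"
  shows "QF p (-D) = level_forms p D \<union> neg_form ` level_forms p D"
proof (intro set_eqI iffI)
  fix Q assume Q: "Q \<in> QF p (-D)"
  obtain a b c where abc: "Q = (a,b,c)" by (cases Q)
  have d: "p dvd a" "b^2 - 4*a*c = -D" using Q unfolding abc by (simp_all add: QF_def)
  have "a \<noteq> 0"
  proof
    assume "a = 0"
    then have "b^2 = -D" using d(2) by simp
    then show False using assms zero_le_power2[of b] by linarith
  qed
  show "Q \<in> level_forms p D \<union> neg_form ` level_forms p D"
  proof (cases "a > 0")
    case True
    then show ?thesis using d unfolding abc by (simp add: level_forms_def posdef_def)
  next
    case False
    then have "(-a,-b,-c) \<in> level_forms p D" using d \<open>a \<noteq> 0\<close> by (simp add: level_forms_def posdef_def)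
    then show ?thesis unfolding abc by (intro UnI2 image_eqI[of _ _ "(-a,-b,-c)"]) simp_all
  qed
next
  fix Q assume Q: "Q \<in> level_forms p D \<union> neg_form ` level_forms p D"
  then obtain R where R: "R \<in> level_forms p D" "Q = R \<or> Q = neg_form R" by blast
  then show "Q \<in> QF p (-D)" by (cases R) (auto simp: level_forms_def posdef_def QF_def)
qed

lemma level_forms_act:
  assumes "D > 0" "Q \<in> level_forms p D" "g \<in> Gamma0 p"
  shows "act Q g \<in> level_forms p D"
proof -
  obtain a b c where Q: "Q = (a,b,c)" by (cases Q)
  obtain \<alpha> \<beta> \<gamma> \<delta> where g: "g = (\<alpha>,\<beta>,\<gamma>,\<delta>)" by (cases g)
  have "p dvd a" "p dvd \<gamma>" using assms unfolding Q g by (simp_all add: level_forms_def Gamma0_def)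
  moreover have "act Q g \<in> posdef D" using posdef_act[OF assms(1) _ assms(3)] assms(2) unfolding Q level_forms_def by blast
  ultimately show ?thesis unfolding Q g by (simp add: level_forms_def act_def power2_eq_square)
qed

text \<open>Weighting a negative definite form like its negative doubles the sum. Together with the
  numerator 2 and the total 12 this gives the factor 1/3.\<close>

theorem orbsum_class_weight:
  assumes p: "prime p" "p \<noteq> 2" and D: "D > 0"
  shows "3 * orbsum p (-D) = of_int ((p + 2) * class_weight D - class_weight (p^2 * D))"
proof -
  define f where "f Q = level_mult p (if fst Q > 0 then Q else neg_form Q)" for Q
  let ?L = "level_forms p D"
  have sub: "?L \<subseteq> posdef D" by (auto simp: level_forms_def)
  have fpos: "f Q = level_mult p Q" if "Q \<in> ?L" for Q
    using that sub by (cases Q) (auto simp: f_def posdef_def)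
  have fneg: "f (neg_form Q) = level_mult p Q" if "Q \<in> ?L" for Q
    using that sub by (cases Q) (auto simp: f_def posdef_def)
  note fin = level_sum_fold(1)[OF D sub, of p]
  have inj: "inj_on neg_form {Q \<in> ?L. level_mult p Q \<noteq> 0}" by (rule inj_on_inverseI[of _ neg_form]) simp
  have supp: "{Q \<in> QF p (-D). f Q \<noteq> 0} = {Q \<in> ?L. level_mult p Q \<noteq> 0} \<union> neg_form ` {Q \<in> ?L. level_mult p Q \<noteq> 0}"
    unfolding QF_eq[OF D]
  proof (intro set_eqI iffI)
    fix Q assume "Q \<in> {Q \<in> ?L \<union> neg_form ` ?L. f Q \<noteq> 0}"
    then show "Q \<in> {Q \<in> ?L. level_mult p Q \<noteq> 0} \<union> neg_form ` {Q \<in> ?L. level_mult p Q \<noteq> 0}"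
      using fpos fneg by (elim CollectE conjE UnE imageE) simp_all
  next
    fix Q assume "Q \<in> {Q \<in> ?L. level_mult p Q \<noteq> 0} \<union> neg_form ` {Q \<in> ?L. level_mult p Q \<noteq> 0}"
    then show "Q \<in> {Q \<in> ?L \<union> neg_form ` ?L. f Q \<noteq> 0}"
      using fpos fneg by (elim CollectE conjE UnE imageE) simp_all
  qed
  have disj: "?L \<inter> neg_form ` ?L = {}"
  proof (rule equals0I)
    fix Q assume "Q \<in> ?L \<inter> neg_form ` ?L"
    then obtain R where "Q \<in> ?L" "R \<in> ?L" "Q = neg_form R" by blast
    then show False by (cases R) (simp add: level_forms_def posdef_def)
  qed
  have tot: "finite {g \<in> Gamma0 p. f (act Q g) \<noteq> 0} \<and> (\<Sum>g | g \<in> Gamma0 p \<and> f (act Q g) \<noteq> 0. f (act Q g)) = 12"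
    if mem: "Q \<in> QF p (-D)" for Q
  proof -
    obtain R where R: "R \<in> ?L" and Q: "Q = R \<or> Q = neg_form R" using mem unfolding QF_eq[OF D] by blast
    have e: "f (act Q g) = level_mult p (act R g)" if "g \<in> Gamma0 p" for g
      using Q fpos[OF level_forms_act[OF D R that]] fneg[OF level_forms_act[OF D R that]] act_neg_form by metis
    then have "{g \<in> Gamma0 p. f (act Q g) \<noteq> 0} = {g \<in> Gamma0 p. level_mult p (act R g) \<noteq> 0}" by auto
    moreover have "(\<Sum>g\<in>{g \<in> Gamma0 p. level_mult p (act R g) \<noteq> 0}. f (act Q g)) = (\<Sum>g\<in>{g \<in> Gamma0 p. level_mult p (act R g) \<noteq> 0}. level_mult p (act R g))"
      by (rule sum.cong) (use e in auto)
    moreover have "R \<in> posdef D" using R sub by blast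
    ultimately show ?thesis using level_total[OF p(1) D, of R] by simp
  qed
  have "(\<Sum>Ob\<in>orbit p ` QF p (-D). 1 / real (card (stab p (SOME Q. Q \<in> Ob)))) =
      of_int (\<Sum>Q | Q \<in> QF p (-D) \<and> f Q \<noteq> 0. f Q) / of_int 12"
  proof (rule orbit_sum_unfold)
    fix Q g assume Q: "Q \<in> QF p (-D)" and g: "g \<in> Gamma0 p"
    then obtain R where R: "R \<in> ?L" "Q = R \<or> Q = neg_form R" unfolding QF_eq[OF D] by blast
    have "act R g \<in> ?L" by (rule level_forms_act[OF D R(1) g])
    then show "act Q g \<in> QF p (-D)" unfolding QF_eq[OF D] using R(2) act_neg_form by (elim disjE) simp_all
  next
    show "finite {Q \<in> QF p (-D). f Q \<noteq> 0}" unfolding supp using fin by simp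
  qed (use tot in auto)
  moreover have "(\<Sum>Q | Q \<in> QF p (-D) \<and> f Q \<noteq> 0. f Q) = 2 * (\<Sum>Q | Q \<in> ?L \<and> level_mult p Q \<noteq> 0. level_mult p Q)"
  proof -
    have "(\<Sum>Q | Q \<in> QF p (-D) \<and> f Q \<noteq> 0. f Q) = (\<Sum>Q | Q \<in> ?L \<and> level_mult p Q \<noteq> 0. f Q) + (\<Sum>Q\<in>neg_form ` {Q \<in> ?L. level_mult p Q \<noteq> 0}. f Q)"
      unfolding supp by (rule sum.union_disjoint) (use fin disj in auto)
    also have "(\<Sum>Q\<in>neg_form ` {Q \<in> ?L. level_mult p Q \<noteq> 0}. f Q) = (\<Sum>Q | Q \<in> ?L \<and> level_mult p Q \<noteq> 0. level_mult p Q)"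
      unfolding sum.reindex[OF inj] by (rule sum.cong) (use fneg in auto)
    also have "(\<Sum>Q | Q \<in> ?L \<and> level_mult p Q \<noteq> 0. f Q) = (\<Sum>Q | Q \<in> ?L \<and> level_mult p Q \<noteq> 0. level_mult p Q)"
      by (rule sum.cong) (use fpos in auto)
    finally show ?thesis by simp
  qed
  moreover have "orbsum p (-D) = 2 * (\<Sum>Ob\<in>orbit p ` QF p (-D). 1 / real (card (stab p (SOME Q. Q \<in> Ob))))"
    unfolding orbsum_def orbits_def sum_distrib_left by simp
  ultimately show ?thesis unfolding level_sum_level_forms[OF p D, symmetric] by simp
qed

text \<open>Triples correspond to reduced forms of discriminant \<open>-4*n\<close>, whose middle
  coefficient is even. The sign -1 falls on doubles of forms of discriminant \<open>-n\<close>;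
  these change from +1 to -1, so their weight is subtracted twice.\<close>

lemma selling_sum_class_weight:
  assumes n: "n > 0"
  shows "selling_sum n = class_weight (4*n) - 2 * class_weight n"
proof -
  let ?T = "{(A,B,C). A*B + B*C + C*A = n \<and> A \<ge> 0 \<and> B \<ge> 0 \<and> C \<ge> 0}"
  let ?e = "\<lambda>(A,B,C). even (A - B) \<and> even (B - C)"
  let ?m = "\<lambda>(A,B,C). selling_mult A B C"
  have bij: "bij_betw (\<lambda>(A,B,C). (A + C, -2*C, B + C)) ?T (chamber_forms (4*n))"
  proof (rule bij_betw_byWitness[where f'="\<lambda>(a,b,c). ((2*a + b) div 2, (2*c + b) div 2, (-b) div 2)"])
    have ev: "even b" if "(a,b,c) \<in> chamber_forms (4*n)" for a b c
    proof -
      have "b^2 = 4*a*c - 4*n" using that by (simp add: chamber_forms_def posdef_def)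
      then have "even (b^2)" by simp
      then show ?thesis by simp
    qed
    show "(\<lambda>(A,B,C). (A + C, -2*C, B + C)) ` ?T \<subseteq> chamber_forms (4*n)"
    proof
      fix x assume "x \<in> (\<lambda>(A,B,C). (A + C, -2*C, B + C)) ` ?T"
      then obtain A B C where x: "x = (A + C, -2*C, B + C)" and e: "A*B + B*C + C*A = n" and pos: "A \<ge> 0" "B \<ge> 0" "C \<ge> 0" by auto
      have "\<not> (A = 0 \<and> C = 0)" using e n by auto
      then have "A + C > 0" using pos by linarith
      moreover have "4*(A + C)*(B + C) - (-2*C)^2 = 4*n" unfolding e[symmetric] by (simp add: algebra_simps power2_eq_square)
      ultimately show "x \<in> chamber_forms (4*n)" using pos unfolding x chamber_forms_def chamber_mult_eq_0 chamber_def posdef_def by simp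
    qed
    show "\<forall>x\<in>chamber_forms (4*n). (\<lambda>(A,B,C). (A + C, -2*C, B + C)) ((\<lambda>(a,b,c). ((2*a + b) div 2, (2*c + b) div 2, (-b) div 2)) x) = x"
    proof
      fix x assume x: "x \<in> chamber_forms (4*n)"
      obtain a b c where abc: "x = (a,b,c)" by (cases x)
      obtain b' where "b = 2*b'" using ev x unfolding abc by blast
      then show "(\<lambda>(A,B,C). (A + C, -2*C, B + C)) ((\<lambda>(a,b,c). ((2*a + b) div 2, (2*c + b) div 2, (-b) div 2)) x) = x"
        unfolding abc by simp
    qed
    show "(\<lambda>(a,b,c). ((2*a + b) div 2, (2*c + b) div 2, (-b) div 2)) ` chamber_forms (4*n) \<subseteq> ?T"
    proof (rule image_subsetI)
      fix x assume x: "x \<in> chamber_forms (4*n)"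
      obtain a b c where abc: "x = (a,b,c)" by (cases x)
      obtain b' where b: "b = 2*b'" using ev x unfolding abc by blast
      have "4*a*c - (2*b')^2 = 4*n" using x unfolding abc b chamber_forms_def posdef_def by simp
      then have "(a + b')*(c + b') + (c + b')*(-b') + (-b')*(a + b') = n" by (simp add: algebra_simps power2_eq_square)
      then show "(\<lambda>(a,b,c). ((2*a + b) div 2, (2*c + b) div 2, (-b) div 2)) x \<in> ?T"
        using x unfolding abc b chamber_forms_def chamber_mult_eq_0 chamber_def by (simp add: dvd_neg_div)
    qed
  qed auto
  have mult: "chamber_mult ((\<lambda>(A,B,C). (A + C, -2*C, B + C)) x) = ?m x" for x
    by (cases x) (auto simp: chamber_mult_def chamber_def chamber_int_def selling_mult_def)
  have W4: "class_weight (4*n) = (\<Sum>x\<in>?T. ?m x)"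
    unfolding class_weight_def sum.reindex_bij_betw[OF bij, symmetric] mult ..
  have "class_weight n = (\<Sum>Q\<in>{(a,b,c). (a,b,c) \<in> chamber_forms (2^2 * n) \<and> 2 dvd a \<and> 2 dvd b \<and> 2 dvd c}. chamber_mult Q)"
    unfolding class_weight_def sum.reindex_bij_betw[OF scale_form_chamber_forms[of 2 n], OF zero_less_numeral, symmetric]
    by (simp add: scale_form_chamber_mult)
  also have "{(a,b,c). (a,b,c) \<in> chamber_forms (2^2 * n) \<and> 2 dvd a \<and> 2 dvd b \<and> 2 dvd c} = (\<lambda>(A,B,C). (A + C, -2*C, B + C)) ` {x \<in> ?T. ?e x}"
  proof -
    have "(\<lambda>(A,B,C). (A + C, -2*C, B + C)) ` {x \<in> ?T. ?e x} = {Q \<in> chamber_forms (4*n). (\<lambda>(a,b,c). 2 dvd a \<and> 2 dvd b \<and> 2 dvd c) Q}"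
      unfolding image_Collect_surj[OF bij_betw_imp_surj_on[OF bij], of "\<lambda>(a,b,c). 2 dvd a \<and> 2 dvd b \<and> 2 dvd c", symmetric]
      by (rule arg_cong[where f="image _"]) auto
    then show ?thesis by auto
  qed
  also have "(\<Sum>Q\<in>\<dots>. chamber_mult Q) = (\<Sum>x\<in>{x \<in> ?T. ?e x}. ?m x)"
  proof -
    have "inj_on (\<lambda>(A,B,C). (A + C, -2*C, B + C)) {x \<in> ?T. ?e x}"
      by (rule inj_on_subset[OF bij_betw_imp_inj_on[OF bij]]) (rule Collect_restrict)
    from sum.reindex[OF this, of chamber_mult] show ?thesis unfolding o_def mult .
  qed
  finally have W1: "class_weight n = (\<Sum>x\<in>{x \<in> ?T. ?e x}. ?m x)" .
  have "selling_sum n = (\<Sum>x\<in>?T. ?m x - 2 * (if ?e x then ?m x else 0))"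
    unfolding selling_sum_def by (rule sum.cong) (simp_all add: selling_sign_def case_prod_unfold)
  also have "\<dots> = (\<Sum>x\<in>?T. ?m x) - 2 * (\<Sum>x\<in>?T. if ?e x then ?m x else 0)"
    by (simp only: sum_subtractf sum_distrib_left)
  also have "(\<Sum>x\<in>?T. if ?e x then ?m x else 0) = (\<Sum>x\<in>{x \<in> ?T. ?e x}. ?m x)"
    by (rule sum.inter_filter[symmetric]) (rule finite_selling[OF n])
  finally show ?thesis unfolding W4 W1 .
qed

theorem theorem1p1:
  fixes p n :: int
  assumes "prime p" and "p \<noteq> 2" and "n > 0" and "n mod 4 = 0 \<or> n mod 4 = 3"
  shows "12 * orbsum p (-4*n) - 24 * orbsum p (-n)
         = 4 * real (r3 n) - 2 * (real (r3 (p^2 * n)) - real_of_int p * real (r3 n))"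
proof -
  have p2n: "p^2 * n > 0" using assms(1,3) prime_gt_0_int[of p] by simp
  have r: "real (r3 n) = of_int (2 * (class_weight (4*n) - 2 * class_weight n))"
    unfolding selling_sum_class_weight[OF assms(3), symmetric] gauss_three_squares[OF assms(3), symmetric] by simp
  have rp: "real (r3 (p^2 * n)) = of_int (2 * (class_weight (p^2 * (4*n)) - 2 * class_weight (p^2 * n)))"
  proof -
    have "p^2 * (4*n) = 4 * (p^2 * n)" by simp
    then show ?thesis
      by (simp only: selling_sum_class_weight[OF p2n, symmetric] gauss_three_squares[OF p2n, symmetric] of_int_of_nat_eq)
  qed
  have "3 * orbsum p (-4*n) = of_int ((p + 2) * class_weight (4*n) - class_weight (p^2 * (4*n)))"
    using orbsum_class_weight[OF assms(1,2), of "4*n"] assms(3) by simp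
  moreover have "3 * orbsum p (-n) = of_int ((p + 2) * class_weight n - class_weight (p^2 * n))"
    using orbsum_class_weight[OF assms(1-3)] .
  \<comment> \<open>Both sides equal \<open>2*(p+2)*r3 n - 2*r3 (p^2*n)\<close>.\<close>
  ultimately show ?thesis unfolding r rp by (simp add: algebra_simps)
qed

end
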